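(* Let $(\Phi,\mathbb P)$ be a simple stationary point process on $\mathbb R^d$ with non-degenerate intensity, and let $f$ be a point-map which is 1-periodic on $(\Phi,\mathbb P)$. Then the $f$-probability $\mathcal P_0^f$ of $\mathcal P_0=\Phi_*\mathbb P_\Phi$ exists and is given by $$\mathcal P_0^f=\Phi_*\,\mathbb P_{\Phi_f^\infty}.$$ Moreover, with $m_f^\infty(\phi)$ denoting the multiplicity of the origin in $\phi_f^\infty$, $\mathcal P_0^f$ is absolutely continuous with respect to $\mathcal P_0$, with $$\frac{d\mathcal P_0^f}{d\mathcal P_0}(\phi)=m_f^\infty(\phi).$$ In addition, $\mathcal P_0^f=(\theta_f)_*\mathcal P_0^f$.
   Context: $\mathbf N$ is the space of locally finite counting measures on $\mathbb R^d$ (not necessarily simple; identified with multisets), with the vague topology and its Borel $\sigma$-field $\mathcal N$. $\overline\phi$ is the support of $\phi$; $x\in\phi$ means $\phi(\{x\})>0$. $\mathbf N^0=\{\phi\in\mathbf N:0\in\phi\}$. For $t\in\mathbb R^d$, $\theta_t\phi(B)=\phi(B+t)$ (translation by $-t$). $\mathbf M^1(\mathbf N^0)$ is the set of probability measures on $\mathbf N^0$ with the topology of weak convergence. Point-map: a measurable $f:\mathbf N^0\to\mathbb R^d$ with $f(\phi)=f(\overline\phi)\in\overline\phi$ for all $\phi$. Its point-shift is $F(\phi,x)=f(\theta_x\phi)+x$ for $x\in\phi$. Iterates: $F^0(\phi,x)=x$, $F^{k+1}(\phi,x)=F(\phi,F^k(\phi,x))$; $F^{-n}(\phi,y)=\{x\in\phi:F^n(\phi,x)=y\}$.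 For $\phi\in\mathbf N^0$, $\theta_f(\phi)=\theta_{f(\phi)}\phi\in\mathbf N^0$, with $n$-th iterate $\theta_f^n$. For $y\in\phi$, $m_f^n(\phi,y)=\phi(F^{-n}(\phi,y))$, and $\phi_f^n=\sum_{y\in\overline\phi}m_f^n(\phi,y)\delta_y$ is the $n$-th image counting measure ($\Phi_f^n$ when $\phi=\Phi$). Stationary point process: $(\theta_t)_{t\in\mathbb R^d}$ is a measurable flow on a probability space $(\Omega,\mathcal F,\mathbb P)$ leaving $\mathbb P$ invariant, and $\Phi:\Omega\to\mathbf N$ is measurable with $\Phi\circ\theta_t=\theta_t\circ\Phi$. Its intensity $\lambda$ is the mean number of points (with multiplicity) in the unit cube; it is non-degenerate if $0<\lambda<\infty$. For a stationary point process $\Psi$ on $(\Omega,\mathcal F,\mathbb P)$ with non-degenerate intensity $\lambda_\Psi$, the Palm probability w.r.t. $\Psi$ is $\mathbb P_\Psi[A]=\frac1{\lambda_\Psi|B|}\int_\Omega\int_B\mathbf 1\{\theta_t\omega\in A\}\,\Psi(\omega,dt)\,\mathbb P[d\omega]$ for any Borel $B$ with Lebesgue measure $0<|B|<\infty$ (atoms counted with multiplicity). Here $h_*\mu(A)=\mu(h^{-1}A)$. 1-periodic: for $\mathcal P_0$-almost all $\phi$ there is an integer $K=K(\phi)$ such that $\theta_f^n(\phi)=\theta_f^K(\phi)$ for all $n>K$. In the 1-periodic case, a.s. $\lim_n\Phi_f^n(\{x\})$ exists and is finite for all $x\in\Phi$; $\Phi_f^\infty$ is the stationary point process (of non-degenerate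 intensity) with $\Phi_f^\infty(\{x\})=\lim_n\Phi_f^n(\{x\})$, and $\phi_f^\infty$ is defined in the same way from $\phi$, so $m_f^\infty(\phi)=\lim_n m_f^n(\phi,0)$. The $f$-probability of $\mathcal P_0$ is $\mathcal P_0^f=\lim_{n\to\infty}(\theta_f^n)_*\mathcal P_0$ in $\mathbf M^1(\mathbf N^0)$, when this limit exists. *)

theory Defs
  imports "HOL-Probability.Probability"
begin

text \<open>The space \<open>\<real>\<^sup>d\<close> is an arbitrary \<^class>\<open>euclidean_space\<close>. A counting measure is a Borel measure whose
  values on bounded Borel sets are natural numbers; such a measure is automatically a locally
  finite sum of Dirac measures.\<close>

definition count_meas :: "'a::euclidean_space measure set" where
  "count_meas = {\<phi>. sets \<phi> = sets borel \<and>
     (\<forall>B\<in>sets borel. bounded B \<longrightarrow> (\<exists>k::nat. emeasure \<phi> B = of_nat k))}"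

definition msupport :: "'a::euclidean_space measure \<Rightarrow> 'a set" where
  "msupport \<phi> = {x. \<forall>U. open U \<longrightarrow> x \<in> U \<longrightarrow> emeasure \<phi> U > 0}"

definition points :: "'a::euclidean_space measure \<Rightarrow> 'a set" where
  "points \<phi> = {x. emeasure \<phi> {x} > 0}"

definition simple_meas :: "'a::euclidean_space measure \<Rightarrow> bool" where
  "simple_meas \<phi> \<longleftrightarrow> (\<forall>x. emeasure \<phi> {x} \<le> 1)"

text \<open>The Borel measure \<open>\<Sum>x\<in>S. m x \<cdot> \<delta>\<^sub>x\<close>. The measure \<^term>\<open>point_measure S m\<close> lives on the power set
  of \<open>S\<close>; \<^const>\<open>distr\<close> along the inclusion makes it a Borel measure on the whole space.\<close>

definition dirac_sum :: "'a::euclidean_space set \<Rightarrow> ('a \<Rightarrow> ennreal) \<Rightarrow> 'a measure" where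
  "dirac_sum S m = distr (point_measure S m) borel (\<lambda>x. x)"

definition translate :: "'a::euclidean_space \<Rightarrow> 'a measure \<Rightarrow> 'a measure" where
  "translate t \<phi> = distr \<phi> borel (\<lambda>x. x - t)"

definition vague_topology :: "'a::euclidean_space measure topology" where
  "vague_topology = topology_generated_by
     {{\<phi> \<in> count_meas. (\<integral>x. g x \<partial>\<phi>) \<in> U} | (g :: 'a \<Rightarrow> real) U.
        continuous_on UNIV g \<and> (\<exists>K. compact K \<and> (\<forall>x. x \<notin> K \<longrightarrow> g x = 0)) \<and> open U}"

definition N_space :: "'a::euclidean_space measure measure" where
  "N_space = sigma count_meas {U. openin vague_topology U}"

definition count_meas0 :: "'a::euclidean_space measure set" where
  "count_meas0 = {\<phi> \<in> count_meas. 0 \<in> points \<phi>}"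

definition N0_space :: "'a::euclidean_space measure measure" where
  "N0_space = restrict_space N_space count_meas0"

definition prob_N0 :: "'a::euclidean_space measure measure set" where
  "prob_N0 = {P. prob_space P \<and> sets P = sets N0_space}"

definition weak_topology_N0 :: "'a::euclidean_space measure measure topology" where
  "weak_topology_N0 = topology_generated_by
     {{P \<in> prob_N0. (\<integral>\<phi>. h \<phi> \<partial>P) \<in> U} | (h :: 'a measure \<Rightarrow> real) U.
        continuous_map (subtopology vague_topology count_meas0) euclideanreal h \<and>
        bounded (h ` count_meas0) \<and> open U}"

definition point_map :: "('a::euclidean_space measure \<Rightarrow> 'a) \<Rightarrow> bool" where
  "point_map f \<longleftrightarrow> f \<in> borel_measurable N0_space \<and>
     (\<forall>\<phi>\<in>count_meas0. f \<phi> = f (dirac_sum (msupport \<phi>) (\<lambda>_. 1)) \<and> f \<phi> \<in> msupport \<phi>)"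

definition point_shift :: "('a::euclidean_space measure \<Rightarrow> 'a) \<Rightarrow> 'a measure \<Rightarrow> 'a \<Rightarrow> 'a" where
  "point_shift f \<phi> x = f (translate x \<phi>) + x"

definition shift_by :: "('a::euclidean_space measure \<Rightarrow> 'a) \<Rightarrow> 'a measure \<Rightarrow> 'a measure" where
  "shift_by f \<phi> = translate (f \<phi>) \<phi>"

definition image_mult ::
  "('a::euclidean_space measure \<Rightarrow> 'a) \<Rightarrow> nat \<Rightarrow> 'a measure \<Rightarrow> 'a \<Rightarrow> ennreal" where
  "image_mult f n \<phi> y = emeasure \<phi> {x \<in> points \<phi>. (point_shift f \<phi> ^^ n) x = y}"

definition image_meas ::
  "('a::euclidean_space measure \<Rightarrow> 'a) \<Rightarrow> nat \<Rightarrow> 'a measure \<Rightarrow> 'a measure" where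
  "image_meas f n \<phi> = dirac_sum (msupport \<phi>) (image_mult f n \<phi>)"

text \<open>The limit \<open>\<phi>\<^sub>f\<^sup>\<infinity>\<close> of the image counting measures. In the 1-periodic case the pointwise limits exist
  and are finite only almost surely; on the exceptional (translation-invariant) set of
  configurations the value is the null measure.\<close>

definition image_limit ::
  "('a::euclidean_space measure \<Rightarrow> 'a) \<Rightarrow> 'a measure \<Rightarrow> 'a measure" where
  "image_limit f \<phi> =
     (if \<forall>x\<in>points \<phi>. \<exists>l<\<infinity>. (\<lambda>n. emeasure (image_meas f n \<phi>) {x}) \<longlonglongrightarrow> l
      then dirac_sum (msupport \<phi>) (\<lambda>x. lim (\<lambda>n. emeasure (image_meas f n \<phi>) {x}))
      else null_measure borel)"

definition mult_limit :: "('a::euclidean_space measure \<Rightarrow> 'a) \<Rightarrow> 'a measure \<Rightarrow> ennreal" where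
  "mult_limit f \<phi> = emeasure (image_limit f \<phi>) {0}"

definition one_periodic ::
  "('a::euclidean_space measure \<Rightarrow> 'a) \<Rightarrow> 'a measure measure \<Rightarrow> bool" where
  "one_periodic f P \<longleftrightarrow>
     (AE \<phi> in P. \<exists>K::nat. \<forall>n>K. (shift_by f ^^ n) \<phi> = (shift_by f ^^ K) \<phi>)"

definition has_f_probability ::
  "('a::euclidean_space measure \<Rightarrow> 'a) \<Rightarrow> 'a measure measure \<Rightarrow> 'a measure measure \<Rightarrow> bool" where
  "has_f_probability f P Q \<longleftrightarrow>
     limitin weak_topology_N0 (\<lambda>n. distr P N0_space (shift_by f ^^ n)) Q sequentially"

definition f_probability ::
  "('a::euclidean_space measure \<Rightarrow> 'a) \<Rightarrow> 'a measure measure \<Rightarrow> 'a measure measure" where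
  "f_probability f P = (THE Q. has_f_probability f P Q)"

definition stationary_flow :: "'w measure \<Rightarrow> ('a::euclidean_space \<Rightarrow> 'w \<Rightarrow> 'w) \<Rightarrow> bool" where
  "stationary_flow M \<theta> \<longleftrightarrow> prob_space M \<and>
     (\<lambda>(t, \<omega>). \<theta> t \<omega>) \<in> measurable (borel \<Otimes>\<^sub>M M) M \<and>
     (\<forall>\<omega>\<in>space M. \<theta> 0 \<omega> = \<omega> \<and> (\<forall>s t. \<theta> s (\<theta> t \<omega>) = \<theta> (s + t) \<omega>)) \<and>
     (\<forall>t. distr M M (\<theta> t) = M)"

definition stationary_point_process ::
  "'w measure \<Rightarrow> ('a::euclidean_space \<Rightarrow> 'w \<Rightarrow> 'w) \<Rightarrow> ('w \<Rightarrow> 'a measure) \<Rightarrow> bool" where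
  "stationary_point_process M \<theta> \<Psi> \<longleftrightarrow> stationary_flow M \<theta> \<and> \<Psi> \<in> measurable M N_space \<and>
     (\<forall>t. \<forall>\<omega>\<in>space M. \<Psi> (\<theta> t \<omega>) = translate t (\<Psi> \<omega>))"

definition intensity :: "'w measure \<Rightarrow> ('w \<Rightarrow> 'a::euclidean_space measure) \<Rightarrow> ennreal" where
  "intensity M \<Psi> = (\<integral>\<^sup>+\<omega>. emeasure (\<Psi> \<omega>) (cbox 0 One) \<partial>M)"

definition nondegenerate :: "'w measure \<Rightarrow> ('w \<Rightarrow> 'a::euclidean_space measure) \<Rightarrow> bool" where
  "nondegenerate M \<Psi> \<longleftrightarrow> 0 < intensity M \<Psi> \<and> intensity M \<Psi> < \<infinity>"

text \<open>The measure satisfying the Palm formula simultaneously for all Borel sets \<open>B\<close> of positive finite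
  volume (not just for one choice of \<open>B\<close>); it exists and is unique for stationary point processes of non-degenerate intensity.\<close>

definition palm_prob ::
  "'w measure \<Rightarrow> ('a::euclidean_space \<Rightarrow> 'w \<Rightarrow> 'w) \<Rightarrow> ('w \<Rightarrow> 'a measure) \<Rightarrow> 'w measure" where
  "palm_prob M \<theta> \<Psi> = (THE Q. sets Q = sets M \<and>
     (\<forall>A\<in>sets M. \<forall>B\<in>sets borel. 0 < emeasure lborel B \<and> emeasure lborel B < \<infinity> \<longrightarrow>
        emeasure Q A =
          (\<integral>\<^sup>+\<omega>. (\<integral>\<^sup>+t\<in>B. indicator A (\<theta> t \<omega>) \<partial>\<Psi> \<omega>) \<partial>M) / (intensity M \<Psi> * emeasure lborel B)))"

text \<open>The image \<open>\<Phi>\<^sub>*\<close> of a probability \<open>P\<close> on the sample space, as a measure on \<open>N\<^sup>0\<close>. The map \<open>\<Phi>\<close> takes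
  values in \<open>N\<close>, and in \<open>N\<^sup>0\<close> only \<open>P\<close>-almost surely, whence the restriction.\<close>

definition law_N0 :: "'w measure \<Rightarrow> ('w \<Rightarrow> 'a::euclidean_space measure) \<Rightarrow> 'a measure measure" where
  "law_N0 P \<Phi> = restrict_space (distr P N_space \<Phi>) count_meas0"

end

theory Submission
  imports Defs
begin

text \<open>
  The proof rests on a mass transport identity. If every point of \<open>\<Phi>\<close> sends its unit mass to its
  \<open>n\<close>-th image under the point-shift, then the mass arriving at a point \<open>y\<close> is the multiplicity of \<open>y\<close> in
  the \<open>n\<close>-th image measure. Under the Palm probability the mean mass sent equals the mean mass
  received (\<open>mass_transport\<close>), which with a test function of the environment of the receiver becomes
  \<open>E\<^sub>0[h(\<theta>\<^sub>f\<^sup>n \<phi>)] = E\<^sub>0[h(\<phi>) m\<^sup>n(\<phi>)]\<close>, where \<open>m\<^sup>n(\<phi>)\<close> is the multiplicity of the origin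
  (\<open>shift_transport\<close>). So the law of \<open>\<theta>\<^sub>f\<^sup>n\<close> under \<open>P0\<close> has density \<open>m\<^sup>n\<close>, and the task is to let \<open>n\<close> tend
  to infinity on both sides.

  On the left, 1-periodicity says that almost every trajectory of environments ends in a fixed
  environment; dominated convergence gives weak convergence to the law of the terminal environment
  \<open>shift_limit\<close>, on which \<open>\<theta>\<^sub>f\<close> acts as the identity. This yields existence of the limit and its
  invariance.

  On the right, the multiplicities have to converge. A fixed environment is not the same as a
  fixed point: it means that \<open>f\<close> selects a period of the configuration. The point-shift therefore acts
  on the points that see a given fixed environment as a translation by a period, in particular
  bijectively. Hence the multiplicity of such a point never decreases (\<open>fixed_image_mult_mono\<close>), and
  it is almost surely bounded because its mean is at most one. Any other point enters, after
  finitely many steps, the set of points with fixed environment through some last point outside of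
  it, and the multiplicity of the latter is bounded by the increments of a convergent sequence. So it
  vanishes in the limit (\<open>image_mult_vanishes\<close>). Monotone convergence along absorbed trajectories then
  identifies the terminal law with the measure of density \<open>m\<^sup>\<infinity> = lim m\<^sup>n\<close> with respect to \<open>P0\<close>
  (\<open>Q_eq_distr\<close>).

  Finally \<open>\<Phi>\<^sub>f\<^sup>\<infinity>\<close> is \<open>\<Phi>\<close> with each point weighted by \<open>m\<^sup>\<infinity>\<close> of the environment that it sees, so the
  Campbell formula for \<open>\<Phi>\<close> shows that its intensity is that of \<open>\<Phi>\<close> and that its Palm probability is the
  one of \<open>\<Phi>\<close> with density \<open>m\<^sup>\<infinity> \<circ> \<Phi>\<close> (\<open>palm_image_limit\<close>).

  Two foundations are needed. The Borel \<open>\<sigma>\<close>-field of the vague topology is generated by the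
  masses of Borel sets, and equality of two random configurations is an event
  (\<open>measurable_N_spaceI\<close>, \<open>sets_Collect_N_space_eq\<close>); and a law on \<open>N\<^sup>0\<close> is determined by the integrals of
  bounded continuous functionals, which makes weak limits unique (\<open>prob_N0_eqI\<close>).
\<close>

section \<open>Counting measures and translations\<close>

lemma count_meas_sets[measurable_cong, simp]: "\<phi> \<in> count_meas \<Longrightarrow> sets \<phi> = sets borel"
  by (simp add: count_meas_def)

lemma count_meas_space[simp]: "\<phi> \<in> count_meas \<Longrightarrow> space \<phi> = UNIV"
  using sets_eq_imp_space_eq[of \<phi> borel] by simp

lemma count_meas_natE:
  assumes "\<phi> \<in> count_meas" "B \<in> sets borel" "bounded B"
  obtains k :: nat where "emeasure \<phi> B = of_nat k"
  using assms unfolding count_meas_def by blast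

lemma count_meas_finite:
  assumes "\<phi> \<in> count_meas" "B \<in> sets borel" "bounded B"
  shows "emeasure \<phi> B < \<infinity>"
  using count_meas_natE[OF assms] by (metis of_nat_less_top infinity_ennreal_def)

lemma count_meas_ge_1:
  assumes "\<phi> \<in> count_meas" "B \<in> sets borel" "bounded B" "emeasure \<phi> B \<noteq> 0"
  shows "emeasure \<phi> B \<ge> 1"
proof -
  obtain k :: nat where k: "emeasure \<phi> B = of_nat k"
    by (rule count_meas_natE[OF assms(1-3)])
  with assms(4) have "1 \<le> k" by (cases k) auto
  then have "of_nat 1 \<le> (of_nat k :: ennreal)" by (rule of_nat_mono)
  then show ?thesis by (simp add: k)
qed

lemma UN_ball_real: "(\<Union>n::nat. ball (0::'a::euclidean_space) (real n)) = UNIV"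
  using reals_Archimedean2 by auto

lemma count_meas_sigma_finite:
  assumes "\<phi> \<in> count_meas"
  shows "sigma_finite_measure \<phi>"
proof
  show "\<exists>A. countable A \<and> A \<subseteq> sets \<phi> \<and> \<Union>A = space \<phi> \<and> (\<forall>a\<in>A. emeasure \<phi> a \<noteq> \<infinity>)"
  proof (intro exI[of _ "range (\<lambda>n. ball 0 (real n))"] conjI)
    show "\<forall>a\<in>range (\<lambda>n. ball 0 (real n)). emeasure \<phi> a \<noteq> \<infinity>"
      using count_meas_finite[OF assms, of "ball 0 (real n)" for n] by (auto simp: less_top)
  qed (auto simp: assms UN_ball_real)
qed

text \<open>Masses of bounded sets are integers, so the masses of balls shrinking to a point of the support
  are at least one, and so is their limit.\<close>
lemma points_eq_msupport:
  assumes \<phi>: "\<phi> \<in> count_meas"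
  shows "points \<phi> = msupport \<phi>"
proof
  show "points \<phi> \<subseteq> msupport \<phi>"
  proof (unfold points_def msupport_def, safe)
    fix x and U :: "'a set" assume x: "0 < emeasure \<phi> {x}" and U: "open U" "x \<in> U"
    have "emeasure \<phi> {x} \<le> emeasure \<phi> U"
      using U by (intro emeasure_mono) (simp_all add: \<phi>)
    with x show "0 < emeasure \<phi> U" by (rule less_le_trans)
  qed
  show "msupport \<phi> \<subseteq> points \<phi>"
  proof
    fix x assume x: "x \<in> msupport \<phi>"
    define A where "A n = ball x (1 / real (Suc n))" for n
    have pos: "emeasure \<phi> (A n) > 0" for n
      using x by (auto simp: msupport_def A_def)
    have ge: "emeasure \<phi> (A n) \<ge> 1" for n
      using pos[of n] by (intro count_meas_ge_1 \<phi>) (auto simp: A_def)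
    have "decseq A"
      by (auto simp: A_def decseq_def intro!: subset_ball divide_left_mono)
    then have "(\<lambda>n. emeasure \<phi> (A n)) \<longlonglongrightarrow> emeasure \<phi> (\<Inter>n. A n)"
      using count_meas_finite[OF \<phi>, of "ball x r" for r]
      by (intro Lim_emeasure_decseq) (auto simp: \<phi> less_top A_def[abs_def])
    then have "emeasure \<phi> (\<Inter>n. A n) \<ge> 1"
      by (rule LIMSEQ_le_const) (use ge in auto)
    also have "(\<Inter>n. A n) = {x}"
    proof (intro antisym subsetI)
      fix y assume y: "y \<in> (\<Inter>n. A n)"
      show "y \<in> {x}"
      proof (rule ccontr)
        assume "y \<notin> {x}"
        then obtain n where "inverse (real (Suc n)) < dist x y"
          using reals_Archimedean[of "dist x y"] by auto
        moreover have "y \<in> A n" using y by auto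
        ultimately show False by (simp add: A_def field_simps)
      qed
    qed (auto simp: A_def)
    finally show "x \<in> points \<phi>"
      by (simp add: points_def) (meson less_le_trans zero_less_one)
  qed
qed

text \<open>A bounded set contains only finitely many atoms because each has mass at least one; a
  countable union of balls covers the space.\<close>
lemma countable_points:
  assumes \<phi>: "\<phi> \<in> count_meas"
  shows "countable (points \<phi>)"
proof -
  have "finite (points \<phi> \<inter> ball 0 (real n))" for n
  proof (rule ccontr)
    let ?B = "ball 0 (real n) :: 'a set"
    assume inf: "infinite (points \<phi> \<inter> ?B)"
    obtain k :: nat where k: "emeasure \<phi> ?B = of_nat k"
      by (rule count_meas_natE[OF \<phi>, of ?B]) auto
    obtain F where F: "F \<subseteq> points \<phi> \<inter> ?B" "finite F" "card F = Suc k"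
      using infinite_arbitrarily_large[OF inf, of "Suc k"] by auto
    have "of_nat (Suc k) = (\<Sum>x\<in>F. 1 :: ennreal)"
      by (simp add: F)
    also have "\<dots> \<le> (\<Sum>x\<in>F. emeasure \<phi> {x})"
      using F by (intro sum_mono count_meas_ge_1 \<phi>) (auto simp: points_def)
    also have "\<dots> = emeasure \<phi> F"
      by (rule emeasure_eq_sum_singleton[symmetric]) (auto simp: F \<phi>)
    also have "\<dots> \<le> emeasure \<phi> ?B"
      using F by (intro emeasure_mono) (auto simp: \<phi>)
    also have "\<dots> = of_nat k" by (rule k)
    finally have "Suc k \<le> k" by (subst (asm) of_nat_le_iff)
    then show False by simp
  qed
  then have "countable (\<Union>n. points \<phi> \<inter> ball 0 (real n))"
    by (intro countable_UN) (auto intro: countable_finite)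
  also have "(\<Union>n. points \<phi> \<inter> ball 0 (real n)) = points \<phi>"
    using UN_ball_real by blast
  finally show ?thesis .
qed

lemma countable_borel: "countable X \<Longrightarrow> X \<in> sets (borel :: 'a::t1_space measure)"
  by (rule sets.countable) auto

text \<open>Outside its atoms, which form the closed support, a counting measure vanishes locally, hence
  globally by the Lindelof property.\<close>
lemma count_meas_outside_points:
  assumes \<phi>: "\<phi> \<in> count_meas"
  shows "emeasure \<phi> (- points \<phi>) = 0"
proof -
  define \<U> where "\<U> = {U. open U \<and> emeasure \<phi> U = 0}"
  obtain \<V> where \<V>: "\<V> \<subseteq> \<U>" "countable \<V>" "\<Union>\<V> = \<Union>\<U>"
    by (rule Lindelof[of \<U>]) (auto simp: \<U>_def)
  have "- points \<phi> = \<Union>\<U>"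
    unfolding points_eq_msupport[OF \<phi>] by (auto simp: msupport_def \<U>_def)
  also have "\<dots> = (\<Union>V\<in>\<V>. V)" by (simp add: \<V>)
  finally have eq: "- points \<phi> = (\<Union>V\<in>\<V>. V)" .
  have "(\<Union>V\<in>\<V>. V) \<in> null_sets \<phi>"
    using \<V> by (intro null_sets_UN') (auto simp: \<U>_def null_sets_def \<phi>)
  then show ?thesis by (simp add: eq null_sets_def)
qed

lemma AE_in_points: "\<phi> \<in> count_meas \<Longrightarrow> AE x in \<phi>. x \<in> points \<phi>"
  using count_meas_outside_points[of \<phi>] countable_borel[OF countable_points[of \<phi>]]
  by (intro AE_I[of _ _ "- points \<phi>"]) auto

lemma AE_count_meas_iff:
  assumes \<phi>: "\<phi> \<in> count_meas"
  shows "(AE x in \<phi>. P x) \<longleftrightarrow> (\<forall>x\<in>points \<phi>. P x)"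
proof
  assume "AE x in \<phi>. P x"
  then obtain N where N: "{x \<in> space \<phi>. \<not> P x} \<subseteq> N" "emeasure \<phi> N = 0" "N \<in> sets \<phi>"
    by (auto elim: AE_E)
  show "\<forall>x\<in>points \<phi>. P x"
  proof (rule ccontr)
    assume "\<not> (\<forall>x\<in>points \<phi>. P x)"
    then obtain x where x: "x \<in> points \<phi>" "x \<in> N" using N(1) \<phi> by auto
    then have "emeasure \<phi> {x} \<le> emeasure \<phi> N" by (intro emeasure_mono N) auto
    then show False using N(2) x(1) by (auto simp: points_def)
  qed
next
  assume "\<forall>x\<in>points \<phi>. P x"
  then show "AE x in \<phi>. P x"
    using AE_in_points[OF \<phi>] by auto
qed

lemma emeasure_atoms:
  assumes \<phi>: "\<phi> \<in> count_meas" and B: "B \<in> sets borel"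
  shows "emeasure \<phi> B = (\<integral>\<^sup>+x\<in>B. emeasure \<phi> {x} \<partial>count_space (points \<phi>))"
proof -
  note [simp] = \<phi>
  have "emeasure \<phi> B = emeasure \<phi> (B \<inter> points \<phi>)"
    using AE_in_points[OF \<phi>] B countable_borel[OF countable_points[OF \<phi>]]
    by (intro emeasure_eq_AE) auto
  also have "\<dots> = (\<integral>\<^sup>+x. emeasure \<phi> {x} \<partial>count_space (B \<inter> points \<phi>))"
    by (rule emeasure_countable_singleton) (auto intro: countable_subset[OF _ countable_points[OF \<phi>]])
  also have "\<dots> = (\<integral>\<^sup>+x\<in>B. emeasure \<phi> {x} \<partial>count_space (points \<phi>))"
    by (subst (1 2) nn_integral_count_space_indicator)
      (auto intro!: nn_integral_cong simp: indicator_def)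
  finally show ?thesis .
qed

lemma nn_integral_dirac_sum:
  assumes "u \<in> borel_measurable borel"
  shows "(\<integral>\<^sup>+x. u x \<partial>dirac_sum S m) = (\<integral>\<^sup>+x. m x * u x \<partial>count_space S)"
  unfolding dirac_sum_def point_measure_def using assms
  by (subst nn_integral_distr) (auto simp: nn_integral_density)

lemma sets_dirac_sum[measurable_cong, simp]: "sets (dirac_sum S m) = sets borel"
  by (simp add: dirac_sum_def)

lemma emeasure_dirac_sum:
  assumes "B \<in> sets borel"
  shows "emeasure (dirac_sum S m) B = (\<integral>\<^sup>+x\<in>B. m x \<partial>count_space S)"
  using nn_integral_dirac_sum[of "indicator B" S m] assms by simp

lemma emeasure_dirac_sum_singleton:
  "y \<in> S \<Longrightarrow> emeasure (dirac_sum S m) {y} = m y"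
proof -
  assume y: "y \<in> S"
  have "emeasure (dirac_sum S m) {y} = (\<integral>\<^sup>+x\<in>{y}. m x \<partial>count_space S)"
    by (rule emeasure_dirac_sum) simp
  also have "\<dots> = (\<Sum>x\<in>{y}. m x * indicator {y} x)"
    using y by (intro nn_integral_count_space') auto
  finally show ?thesis by simp
qed

lemma emeasure_point_simple:
  assumes "\<phi> \<in> count_meas" "simple_meas \<phi>" "x \<in> points \<phi>"
  shows "emeasure \<phi> {x} = 1"
proof (rule antisym)
  show "emeasure \<phi> {x} \<le> 1" using assms(2) by (simp add: simple_meas_def)
  show "1 \<le> emeasure \<phi> {x}"
    using assms(3) by (intro count_meas_ge_1[OF assms(1)]) (simp_all add: points_def)
qed

text \<open>A simple configuration is the counting measure on its points, so that weighting the points by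
  \<open>m\<close> amounts to integrating against the density \<open>m\<close>.\<close>
lemma nn_integral_dirac_sum_simple:
  assumes \<phi>: "\<phi> \<in> count_meas" "simple_meas \<phi>"
    and u: "u \<in> borel_measurable borel" and m: "m \<in> borel_measurable borel"
  shows "(\<integral>\<^sup>+x. u x \<partial>dirac_sum (msupport \<phi>) m) = (\<integral>\<^sup>+x. m x * u x \<partial>\<phi>)"
proof -
  note one = emeasure_point_simple[OF \<phi>]
  have "\<phi> = dirac_sum (points \<phi>) (\<lambda>_. 1)"
  proof (rule measure_eqI)
    fix B assume "B \<in> sets \<phi>"
    then have B: "B \<in> sets borel" by (simp add: \<phi>)
    show "emeasure \<phi> B = emeasure (dirac_sum (points \<phi>) (\<lambda>_. 1)) B"
      unfolding emeasure_dirac_sum[OF B]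
      by (subst emeasure_atoms[OF \<phi>(1) B]) (auto simp: one intro!: nn_integral_cong)
  qed (simp add: \<phi>)
  then have "(\<integral>\<^sup>+x. m x * u x \<partial>\<phi>) = (\<integral>\<^sup>+x. m x * u x \<partial>dirac_sum (points \<phi>) (\<lambda>_. 1))"
    by simp
  also have "\<dots> = (\<integral>\<^sup>+x. m x * u x \<partial>count_space (points \<phi>))"
    using u m by (subst nn_integral_dirac_sum) auto
  also have "\<dots> = (\<integral>\<^sup>+x. u x \<partial>dirac_sum (msupport \<phi>) m)"
    using u by (simp add: nn_integral_dirac_sum points_eq_msupport[OF \<phi>(1)])
  finally show ?thesis by simp
qed

lemma sets_translate[measurable_cong, simp]: "sets (translate t \<phi>) = sets borel"
  by (simp add: translate_def)

lemma emeasure_translate: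
  assumes "sets \<phi> = sets borel" "B \<in> sets borel"
  shows "emeasure (translate t \<phi>) B = emeasure \<phi> {x. x - t \<in> B}"
  using assms sets_eq_imp_space_eq[OF assms(1)] unfolding translate_def
  by (subst emeasure_distr) (auto simp: vimage_def measurable_cong_sets[OF assms(1) refl])

lemma nn_integral_translate:
  assumes "sets \<phi> = sets borel" "u \<in> borel_measurable borel"
  shows "(\<integral>\<^sup>+x. u x \<partial>translate t \<phi>) = (\<integral>\<^sup>+x. u (x - t) \<partial>\<phi>)"
  unfolding translate_def using assms
  by (subst nn_integral_distr) (auto simp: measurable_cong_sets[OF assms(1) refl])

lemma translate_translate:
  assumes "sets \<phi> = sets borel"
  shows "translate s (translate t \<phi>) = translate (s + t) \<phi>"
  unfolding translate_def
  by (subst distr_distr)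
    (auto simp: o_def measurable_cong_sets[OF assms refl] algebra_simps)

lemma translate_0:
  assumes "sets \<phi> = sets borel"
  shows "translate 0 \<phi> = \<phi>"
  unfolding translate_def using distr_id2[OF assms[symmetric]] by simp

lemma emeasure_translate_singleton:
  assumes "sets \<phi> = sets borel"
  shows "emeasure (translate t \<phi>) {x} = emeasure \<phi> {x + t}"
proof -
  have "{y. y - t \<in> {x}} = {x + t}" by (auto simp: algebra_simps)
  then show ?thesis using emeasure_translate[OF assms, of "{x}" t] by auto
qed

lemma points_translate:
  assumes "sets \<phi> = sets borel"
  shows "x \<in> points (translate t \<phi>) \<longleftrightarrow> x + t \<in> points \<phi>"
  by (simp add: points_def emeasure_translate_singleton[OF assms])

lemma translate_in_count_meas:
  assumes "\<phi> \<in> count_meas"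
  shows "translate t \<phi> \<in> count_meas"
  unfolding count_meas_def
proof (safe)
  fix B :: "'a set" assume B: "B \<in> sets borel" "bounded B"
  have eq: "{x. x - t \<in> B} = (+) t ` B"
    by (auto simp: image_iff algebra_simps intro!: bexI[of _ "_ - t"])
  have "{x. x - t \<in> B} \<in> sets borel"
    using measurable_sets[of "\<lambda>x. x - t" borel borel B] B by (simp add: vimage_def)
  moreover have "bounded {x. x - t \<in> B}"
    unfolding eq using B by (intro bounded_translation)
  ultimately show "\<exists>k::nat. emeasure (translate t \<phi>) B = of_nat k"
    using assms unfolding emeasure_translate[OF count_meas_sets[OF assms] B(1)] count_meas_def
    by blast
qed auto

lemma simple_translate:
  assumes "sets \<phi> = sets borel"
  shows "simple_meas (translate t \<phi>) \<longleftrightarrow> simple_meas \<phi>"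
  unfolding simple_meas_def emeasure_translate_singleton[OF assms]
  by (metis diff_add_cancel)

lemma translate_in_count_meas0:
  assumes "\<phi> \<in> count_meas"
  shows "translate x \<phi> \<in> count_meas0 \<longleftrightarrow> x \<in> points \<phi>"
  using assms by (auto simp: count_meas0_def translate_in_count_meas points_translate)

section \<open>The vague topology and its Borel sets\<close>

definition compact_supp :: "('a::euclidean_space \<Rightarrow> real) \<Rightarrow> bool" where
  "compact_supp g \<longleftrightarrow> continuous_on UNIV g \<and> (\<exists>K. compact K \<and> (\<forall>x. x \<notin> K \<longrightarrow> g x = 0))"

definition vague_subbase :: "'a::euclidean_space measure set set" where
  "vague_subbase = {{\<phi> \<in> count_meas. (\<integral>x. g x \<partial>\<phi>) \<in> U} | g U. compact_supp g \<and> open U}"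

lemma vague_topology_eq: "vague_topology = topology_generated_by vague_subbase"
  unfolding vague_topology_def vague_subbase_def compact_supp_def by (simp add: conj_assoc)

lemma compact_supp_0: "compact_supp (\<lambda>_. 0)"
  by (auto simp: compact_supp_def intro!: exI[of _ "{}"])

lemma Union_vague_subbase: "\<Union>vague_subbase = count_meas"
proof
  have "count_meas \<in> vague_subbase"
    unfolding vague_subbase_def
    by (intro CollectI exI[of _ "\<lambda>_. 0"] exI[of _ UNIV]) (auto simp: compact_supp_0)
  then show "count_meas \<subseteq> \<Union>vague_subbase" by blast
qed (auto simp: vague_subbase_def)

lemma topspace_vague[simp]: "topspace vague_topology = count_meas"
  by (simp add: vague_topology_eq Union_vague_subbase)

lemma openin_vague_subset: "openin vague_topology U \<Longrightarrow> U \<subseteq> count_meas"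
  using openin_subset by fastforce

lemma space_N_space[simp]: "space N_space = count_meas"
  unfolding N_space_def by (intro space_measure_of) (auto dest: openin_vague_subset)

lemma compact_supp_measurable: "compact_supp g \<Longrightarrow> g \<in> borel_measurable borel"
  by (auto simp: compact_supp_def intro: borel_measurable_continuous_onI)

lemma compact_supp_integrable:
  assumes g: "compact_supp g" and \<phi>: "\<phi> \<in> count_meas"
  shows "integrable \<phi> g"
proof -
  obtain K where K: "compact K" "\<And>x. x \<notin> K \<Longrightarrow> g x = 0"
    using g by (auto simp: compact_supp_def)
  have "compact (g ` K)"
    using g K by (intro compact_continuous_image)
      (auto simp: compact_supp_def intro: continuous_on_subset)
  then obtain b where b: "\<And>x. x \<in> K \<Longrightarrow> norm (g x) \<le> b"
    using compact_imp_bounded[of "g ` K"] by (auto simp: bounded_iff)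
  have KB: "K \<in> sets borel" using K by (simp add: borel_compact)
  show ?thesis
  proof (rule integrableI_bounded_set[where A=K and B=b])
    show "g \<in> borel_measurable \<phi>"
      using compact_supp_measurable[OF g] by (simp add: measurable_cong_sets[OF count_meas_sets[OF \<phi>] refl])
    show "emeasure \<phi> K < \<infinity>"
      by (rule count_meas_finite[OF \<phi> KB compact_imp_bounded[OF K(1)]])
  qed (use K b KB \<phi> in auto)
qed

text \<open>Urysohn functions of an open set, used both on \<open>\<real>\<^sup>d\<close>, to recover the mass of open sets from
  the integrals of test functions, and on \<open>\<real>\<close>, to approximate subbasic open sets by bounded continuous
  functionals.\<close>
lemma open_indicator_limit:
  fixes U :: "'b::metric_space set"
  assumes "open U"
  obtains u :: "nat \<Rightarrow> 'b \<Rightarrow> real" where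
    "\<And>n. continuous_on UNIV (u n)" "\<And>n x. 0 \<le> u n x" "\<And>n x. u n x \<le> 1"
    "\<And>n x. x \<notin> U \<Longrightarrow> u n x = 0" "\<And>x. (\<lambda>n. u n x) \<longlonglongrightarrow> indicator U x"
proof (cases "U = UNIV")
  case True
  then show ?thesis by (intro that[of "\<lambda>_ _. 1"]) auto
next
  case False
  define u where "u n x = min 1 (real n * infdist x (- U))" for n x
  have ne: "- U \<noteq> {}" and cl: "closed (- U)" using False assms by auto
  show ?thesis
  proof (rule that[of u])
    show "continuous_on UNIV (u n)" for n
      unfolding u_def by (intro continuous_intros)
    show "0 \<le> u n x" "u n x \<le> 1" for n x
      by (auto simp: u_def infdist_nonneg)
    show "u n x = 0" if "x \<notin> U" for n x
      using that by (simp add: u_def)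
    show "(\<lambda>n. u n x) \<longlonglongrightarrow> indicator U x" for x
    proof (cases "x \<in> U")
      case True
      then have pos: "infdist x (- U) > 0"
        using infdist_pos_not_in_closed[OF cl ne] by auto
      obtain N :: nat where N: "1 / infdist x (- U) < real N"
        using reals_Archimedean2 by blast
      have "u n x = 1" if "n \<ge> N" for n
      proof -
        have "1 / infdist x (- U) \<le> real n" using N that by linarith
        then show ?thesis using pos by (simp add: u_def field_simps)
      qed
      then have "\<forall>\<^sub>F n in sequentially. u n x = 1"
        by (auto simp: eventually_sequentially)
      then show ?thesis using True by (simp add: tendsto_eventually)
    qed (simp add: u_def)
  qed
qed

text \<open>The closure of a bounded open set is compact, which makes its Urysohn functions admissible test
  functions for the vague topology.\<close>
lemma measure_open_limit:
  fixes U :: "'a::euclidean_space set"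
  assumes U: "open U" "bounded U"
  obtains g where "\<And>n::nat. compact_supp (g n)"
    "\<And>\<phi>. \<phi> \<in> count_meas \<Longrightarrow> (\<lambda>n. \<integral>x. g n x \<partial>\<phi>) \<longlonglongrightarrow> measure \<phi> U"
proof -
  obtain u :: "nat \<Rightarrow> 'a \<Rightarrow> real" where u: "\<And>n. continuous_on UNIV (u n)" "\<And>n x. 0 \<le> u n x"
    "\<And>n x. u n x \<le> 1" "\<And>n x. x \<notin> U \<Longrightarrow> u n x = 0" "\<And>x. (\<lambda>n. u n x) \<longlonglongrightarrow> indicator U x"
    by (rule open_indicator_limit[OF U(1)]) blast
  show ?thesis
  proof (rule that[of u])
    show c: "compact_supp (u n)" for n
      unfolding compact_supp_def
    proof (intro conjI exI[of _ "closure U"] allI impI u(1))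
      show "compact (closure U)" using U by (simp add: compact_closure)
      show "x \<notin> closure U \<Longrightarrow> u n x = 0" for x using u(4) closure_subset by blast
    qed
    fix \<phi> :: "'a measure" assume \<phi>: "\<phi> \<in> count_meas"
    have "(\<lambda>n. \<integral>x. u n x \<partial>\<phi>) \<longlonglongrightarrow> (\<integral>x. indicator U x \<partial>\<phi>)"
    proof (rule integral_dominated_convergence)
      show "integrable \<phi> (indicator U :: 'a \<Rightarrow> real)"
        using U \<phi> count_meas_finite[OF \<phi>, of U] by (subst integrable_indicator_iff) auto
      show "indicator U \<in> borel_measurable \<phi>" "u n \<in> borel_measurable \<phi>" for n
        using U \<phi> compact_supp_measurable[OF c[of n]]
        by (auto simp: measurable_cong_sets[OF count_meas_sets[OF \<phi>] refl])
      show "AE x in \<phi>. (\<lambda>n. u n x) \<longlonglongrightarrow> indicator U x" using u(5) by simp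
      show "AE x in \<phi>. norm (u n x) \<le> indicator U x" for n
        using u(2,3)[of n] u(4)[of _ n] by (auto simp: indicator_def)
    qed
    then show "(\<lambda>n. \<integral>x. u n x \<partial>\<phi>) \<longlonglongrightarrow> measure \<phi> U"
      using \<phi> U by simp
  qed
qed

text \<open>The \<open>\<sigma>\<close>-field generated by the subbase. It is the Borel \<open>\<sigma>\<close>-field because the vague topology
  has a countable network of sets prescribing the masses of finitely many sets.\<close>
definition N_sub :: "'a::euclidean_space measure measure" where
  "N_sub = sigma count_meas vague_subbase"

lemma vague_subbase_Pow: "vague_subbase \<subseteq> Pow count_meas"
  by (auto simp: vague_subbase_def)

lemma space_N_sub[simp]: "space N_sub = count_meas"
  unfolding N_sub_def using vague_subbase_Pow by (rule space_measure_of)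

lemma sets_N_sub: "sets N_sub = sigma_sets count_meas vague_subbase"
  unfolding N_sub_def using vague_subbase_Pow by (rule sets_measure_of)

lemma measurable_test_integral:
  assumes g: "compact_supp g"
  shows "(\<lambda>\<phi>. \<integral>x. g x \<partial>\<phi>) \<in> borel_measurable N_sub"
proof (rule borel_measurableI)
  fix U :: "real set" assume "open U"
  then have "{\<phi> \<in> count_meas. (\<integral>x. g x \<partial>\<phi>) \<in> U} \<in> vague_subbase"
    using g by (auto simp: vague_subbase_def)
  then have "{\<phi> \<in> count_meas. (\<integral>x. g x \<partial>\<phi>) \<in> U} \<in> sets N_sub"
    unfolding sets_N_sub by (rule sigma_sets.Basic)
  also have "{\<phi> \<in> count_meas. (\<integral>x. g x \<partial>\<phi>) \<in> U} = (\<lambda>\<phi>. \<integral>x. g x \<partial>\<phi>) -` U \<inter> space N_sub"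
    by auto
  finally show "(\<lambda>\<phi>. \<integral>x. g x \<partial>\<phi>) -` U \<inter> space N_sub \<in> sets N_sub" .
qed

lemma measurable_mass_open_N_sub:
  fixes U :: "'a::euclidean_space set"
  assumes U: "open U" "bounded U"
  shows "(\<lambda>\<phi>. emeasure \<phi> U) \<in> borel_measurable N_sub"
proof -
  obtain g where g: "\<And>n::nat. compact_supp (g n)"
    "\<And>\<phi>. \<phi> \<in> count_meas \<Longrightarrow> (\<lambda>n. \<integral>x. g n x \<partial>\<phi>) \<longlonglongrightarrow> measure \<phi> U"
    by (rule measure_open_limit[OF U]) blast
  have "(\<lambda>\<phi>. measure \<phi> U) \<in> borel_measurable N_sub"
    by (rule borel_measurable_LIMSEQ_real[of _ "\<lambda>n \<phi>. \<integral>x. g n x \<partial>\<phi>"])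
      (use g measurable_test_integral in auto)
  then have "(\<lambda>\<phi>. ennreal (measure \<phi> U)) \<in> borel_measurable N_sub" by simp
  then show ?thesis
  proof (rule measurable_cong[THEN iffD1, rotated])
    fix \<phi> :: "'a measure" assume "\<phi> \<in> space N_sub"
    then have "emeasure \<phi> U < \<infinity>" using U by (intro count_meas_finite) auto
    then show "ennreal (measure \<phi> U) = emeasure \<phi> U"
      by (intro emeasure_eq_ennreal_measure[symmetric]) auto
  qed
qed

text \<open>Dynkin's argument needs finite masses, hence the restriction to balls.\<close>
lemma measurable_mass_N_sub:
  fixes B :: "'a::euclidean_space set"
  assumes B: "B \<in> sets borel"
  shows "(\<lambda>\<phi>. emeasure \<phi> B) \<in> borel_measurable N_sub"
proof -
  have loc: "(\<lambda>\<phi>. emeasure \<phi> (B \<inter> ball 0 (real n))) \<in> borel_measurable N_sub" for n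
  proof -
    let ?D = "ball 0 (real n) :: 'a set"
    have "Int_stable {S :: 'a set. open S}" by (auto simp: Int_stable_def)
    moreover have "{S :: 'a set. open S} \<subseteq> Pow UNIV" by simp
    moreover have "B \<in> sigma_sets UNIV {S. open S}" using B by (simp add: borel_def)
    ultimately show ?thesis
    proof (induction rule: sigma_sets_induct_disjoint)
      case (basic A)
      then show ?case by (intro measurable_mass_open_N_sub) (auto simp: bounded_Int)
    next
      case empty
      then show ?case by simp
    next
      case (compl A)
      have A: "A \<in> sets borel" using compl(1) by (simp add: borel_def)
      have "(\<lambda>\<phi>. emeasure \<phi> ?D - emeasure \<phi> (A \<inter> ?D)) \<in> borel_measurable N_sub"
        by (intro borel_measurable_minus_ennreal compl(2) measurable_mass_open_N_sub) auto
      then show ?case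
      proof (rule measurable_cong[THEN iffD1, rotated])
        fix \<phi> :: "'a measure" assume "\<phi> \<in> space N_sub"
        then have \<phi>: "\<phi> \<in> count_meas" by simp
        have "emeasure \<phi> (?D - A \<inter> ?D) = emeasure \<phi> ?D - emeasure \<phi> (A \<inter> ?D)"
          using A count_meas_finite[OF \<phi>, of "A \<inter> ?D"] \<phi>
          by (intro emeasure_Diff) (auto simp: bounded_Int)
        also have "?D - A \<inter> ?D = (UNIV - A) \<inter> ?D" by auto
        finally show "emeasure \<phi> ?D - emeasure \<phi> (A \<inter> ?D) = emeasure \<phi> ((UNIV - A) \<inter> ?D)" by simp
      qed
    next
      case (union A)
      have A: "A i \<in> sets borel" for i using union(2) by (auto simp: borel_def)
      have "(\<lambda>\<phi>. \<Sum>i. emeasure \<phi> (A i \<inter> ?D)) \<in> borel_measurable N_sub"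
        using union(3) by measurable
      then show ?case
      proof (rule measurable_cong[THEN iffD1, rotated])
        fix \<phi> :: "'a measure" assume "\<phi> \<in> space N_sub"
        then have \<phi>: "\<phi> \<in> count_meas" by simp
        have "(\<Sum>i. emeasure \<phi> (A i \<inter> ?D)) = emeasure \<phi> (\<Union>i. A i \<inter> ?D)"
          using union(1) A \<phi> by (intro suminf_emeasure) (auto simp: disjoint_family_on_def)
        also have "(\<Union>i. A i \<inter> ?D) = \<Union>(range A) \<inter> ?D" by auto
        finally show "(\<Sum>i. emeasure \<phi> (A i \<inter> ?D)) = emeasure \<phi> (\<Union>(range A) \<inter> ?D)" .
      qed
    qed
  qed
  have "(\<lambda>\<phi>. SUP n. emeasure \<phi> (B \<inter> ball 0 (real n))) \<in> borel_measurable N_sub"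
    using loc by measurable
  then show ?thesis
  proof (rule measurable_cong[THEN iffD1, rotated])
    fix \<phi> :: "'a measure" assume "\<phi> \<in> space N_sub"
    then have \<phi>: "\<phi> \<in> count_meas" by simp
    have "(SUP n. emeasure \<phi> (B \<inter> ball 0 (real n))) = emeasure \<phi> (\<Union>n. B \<inter> ball 0 (real n))"
      using \<phi> B by (intro SUP_emeasure_incseq) (auto simp: incseq_def)
    also have "(\<Union>n. B \<inter> ball 0 (real n)) = B" using UN_ball_real by blast
    finally show "(SUP n. emeasure \<phi> (B \<inter> ball 0 (real n))) = emeasure \<phi> B" .
  qed
qed

definition mass_cell :: "('a set \<times> nat) list \<Rightarrow> 'a::euclidean_space measure set" where
  "mass_cell l = {\<phi> \<in> count_meas. \<forall>(B, k)\<in>set l. emeasure \<phi> B = of_nat k}"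

lemma mass_cell_N_sub:
  assumes "fst ` set l \<subseteq> sets borel"
  shows "mass_cell l \<in> sets N_sub"
proof -
  have "{\<phi> \<in> space N_sub. \<forall>p\<in>set l. emeasure \<phi> (fst p) = of_nat (snd p)} \<in> sets N_sub"
    using assms measurable_mass_N_sub
    by (intro sets.sets_Collect_finite_All ballI borel_measurable_eq measurable_mass_N_sub) auto
  then show ?thesis by (simp add: mass_cell_def case_prod_beta)
qed

text \<open>Prescribing the masses of the cells of a fine partition determines the integral of a uniformly
  continuous \<open>g\<close> up to the oscillation of \<open>g\<close> times the total mass of the cells. The total mass is
  controlled by the configuration \<open>\<phi>\<^sub>0\<close> alone, uniformly in the partition, which makes the choice of the
  mesh possible.\<close>
lemma mass_cell_test_integral:
  fixes g :: "'a::euclidean_space \<Rightarrow> real"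
  assumes \<B>: "topological_basis \<B>"
    and g: "compact_supp g" and U: "open U"
    and \<phi>0: "\<phi>0 \<in> count_meas" "(\<integral>x. g x \<partial>\<phi>0) \<in> U"
  shows "\<exists>l. set l \<subseteq> {b - \<Union>F | b F. b \<in> \<B> \<and> bounded b \<and> F \<subseteq> \<B> \<and> finite F} \<times> UNIV \<and>
    \<phi>0 \<in> mass_cell l \<and> mass_cell l \<subseteq> {\<phi> \<in> count_meas. (\<integral>x. g x \<partial>\<phi>) \<in> U}"
proof -
  obtain \<epsilon> where \<epsilon>: "\<epsilon> > 0" "ball (\<integral>x. g x \<partial>\<phi>0) \<epsilon> \<subseteq> U"
    using U \<phi>0(2) by (auto simp: open_contains_ball)
  obtain K where K: "compact K" "\<And>x. x \<notin> K \<Longrightarrow> g x = 0"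
    using g by (auto simp: compact_supp_def)
  obtain R where R: "K \<subseteq> cball 0 R"
    using compact_imp_bounded[OF K(1)] by (auto simp: bounded_iff subset_eq)
  let ?T = "cball 0 (R + 1) :: 'a set"
  obtain C :: nat where C: "emeasure \<phi>0 ?T = of_nat C"
    by (rule count_meas_natE[OF \<phi>0(1), of ?T]) auto
  \<comment> \<open>Both integrals will differ from a common Riemann sum by at most \<open>\<eta> * C\<close>.\<close>
  define \<eta> where "\<eta> = \<epsilon> / (2 * real C + 2)"
  have \<eta>: "\<eta> > 0" "2 * \<eta> * real C < \<epsilon>"
    using \<epsilon> by (auto simp: \<eta>_def field_simps)
  have "uniformly_continuous_on ?T g"
    using g by (intro compact_uniformly_continuous)
      (auto simp: compact_supp_def intro: continuous_on_subset)
  then obtain \<delta> where \<delta>: "\<delta> > 0" "\<And>x y. x \<in> ?T \<Longrightarrow> y \<in> ?T \<Longrightarrow> dist y x < \<delta> \<Longrightarrow> dist (g y) (g x) < \<eta>"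
    using \<eta>(1) unfolding uniformly_continuous_on_def by metis
  define r where "r = min (\<delta> / 2) 1"
  have r: "r > 0" "r \<le> 1" "2 * r \<le> \<delta>" using \<delta>(1) by (auto simp: r_def)
  have "\<exists>b\<in>\<B>. x \<in> b \<and> b \<subseteq> ball x r" for x
  proof -
    have "x \<in> ball x r" using r by simp
    then obtain b where "b \<in> \<B>" "x \<in> b" "b \<subseteq> ball x r"
      using topological_basisE[OF \<B> open_ball] by metis
    then show ?thesis by blast
  qed
  then obtain b where b: "\<And>x. b x \<in> \<B>" "\<And>x. x \<in> b x" "\<And>x. b x \<subseteq> ball x r" by metis
  have "\<And>x. x \<in> K \<Longrightarrow> open (b x)" using b(1) topological_basis_open[OF \<B>] by auto
  moreover have "K \<subseteq> (\<Union>x\<in>K. b x)" using b by auto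
  ultimately obtain X where X: "X \<subseteq> K" "finite X" "K \<subseteq> (\<Union>x\<in>X. b x)"
    by (rule compactE_image[OF K(1)])
  obtain xs where xs: "set xs = X" using finite_list[OF X(2)] by auto
  define m where "m = length xs"
  \<comment> \<open>The differences make the cover of \<open>K\<close> disjoint, and they stay in the countable family of the claim.\<close>
  define d where "d i = b (xs ! i) - \<Union>((\<lambda>j. b (xs ! j)) ` {..<i})" for i
  have xsK: "xs ! i \<in> K" if "i < m" for i using that xs X(1) by (auto simp: m_def)
  have dB: "d i \<in> sets borel" for i
    using topological_basis_open[OF \<B> b(1)]
    by (auto simp: d_def intro!: sets.Diff sets.finite_UN borel_open)
  have dT: "d i \<subseteq> ?T" if "i < m" for i
  proof
    fix x assume "x \<in> d i"
    then have "x \<in> b (xs ! i)" by (simp add: d_def)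
    then have "x \<in> ball (xs ! i) r" using b(3) by blast
    moreover have "xs ! i \<in> cball 0 R" using xsK[OF that] R by auto
    ultimately show "x \<in> ?T" using r norm_triangle_sub[of x "xs ! i"]
      by (auto simp: dist_norm norm_minus_commute)
  qed
  have dbdd: "bounded (d i)" if "i < m" for i
    using dT[OF that] bounded_cball bounded_subset by blast
  have disj: "i = j" if "x \<in> d i" "x \<in> d j" for x i j
    using that by (cases i j rule: linorder_cases) (auto simp: d_def)
  have Kd: "\<exists>i<m. x \<in> d i" if "x \<in> K" for x
  proof -
    have ex: "\<exists>i. i < m \<and> x \<in> b (xs ! i)"
    proof -
      obtain z where "z \<in> set xs" "x \<in> b z" using \<open>x \<in> K\<close> X(3) xs by blast
      then show ?thesis by (metis in_set_conv_nth m_def)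
    qed
    define i where "i = (LEAST i. i < m \<and> x \<in> b (xs ! i))"
    have "i < m \<and> x \<in> b (xs ! i)" unfolding i_def by (rule LeastI_ex[OF ex])
    moreover have "x \<notin> b (xs ! j)" if "j < i" for j
      using not_less_Least[of j "\<lambda>i. i < m \<and> x \<in> b (xs ! i)"] that \<open>i < m \<and> _\<close>
      unfolding i_def[symmetric] by auto
    ultimately show ?thesis by (auto simp: d_def)
  qed
  define y where "y i = (SOME y. y \<in> d i)" for i
  have osc: "\<bar>g x - g (y i)\<bar> \<le> \<eta>" if "i < m" "x \<in> d i" for i x
  proof -
    have yi: "y i \<in> d i" unfolding y_def using that by (auto intro: someI)
    have "dist (y i) x < \<delta>"
    proof -
      have "x \<in> b (xs ! i)" "y i \<in> b (xs ! i)"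
        using that yi by (simp_all add: d_def)
      then have "x \<in> ball (xs ! i) r" "y i \<in> ball (xs ! i) r"
        using b(3) by blast+
      then have "dist (xs ! i) x < r" "dist (xs ! i) (y i) < r" by auto
      then show ?thesis using r dist_triangle3[of "y i" x "xs ! i"] by linarith
    qed
    then have "dist (g (y i)) (g x) < \<eta>"
      using that yi dT[OF that(1)] by (intro \<delta>(2)) blast+
    then show ?thesis by (simp add: dist_real_def abs_minus_commute)
  qed
  define s where "s x = (\<Sum>i<m. g (y i) * indicator (d i) x)" for x
  have bound: "\<bar>g x - s x\<bar> \<le> (\<Sum>i<m. \<eta> * indicator (d i) x)" for x
  proof (cases "\<exists>i<m. x \<in> d i")
    case True
    then obtain i where i: "i < m" "x \<in> d i" by auto
    have col: "(\<Sum>j<m. c j * indicator (d j) x) = c i" for c :: "nat \<Rightarrow> real"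
    proof -
      have "(\<Sum>j<m. c j * indicator (d j) x) = (\<Sum>j\<in>{i}. c j * indicator (d j) x)"
        using i disj by (intro sum.mono_neutral_right) (auto simp: indicator_def)
      then show ?thesis using i by simp
    qed
    show ?thesis using osc[OF i] by (simp add: s_def col)
  next
    case False
    then have "g x = 0" using Kd K(2) by blast
    moreover have "s x = 0" using False by (auto simp: s_def intro!: sum.neutral)
    ultimately show ?thesis using \<eta>(1) by (auto intro!: sum_nonneg)
  qed
  have est: "\<bar>(\<integral>x. g x \<partial>\<phi>) - (\<Sum>i<m. g (y i) * measure \<phi> (d i))\<bar> \<le> \<eta> * (\<Sum>i<m. measure \<phi> (d i))"
    if \<phi>: "\<phi> \<in> count_meas" for \<phi>
  proof -
    have ind: "integrable \<phi> (indicator (d i) :: 'a \<Rightarrow> real)" if "i < m" for i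
      using count_meas_finite[OF \<phi> dB dbdd[OF that]] dB[of i] \<phi>
      by (subst integrable_indicator_iff) auto
    have ints: "integrable \<phi> s"
      unfolding s_def using ind by (intro Bochner_Integration.integrable_sum) auto
    have eqs: "(\<integral>x. s x \<partial>\<phi>) = (\<Sum>i<m. g (y i) * measure \<phi> (d i))"
      unfolding s_def using ind \<phi> by (subst Bochner_Integration.integral_sum) auto
    have "\<bar>(\<integral>x. g x \<partial>\<phi>) - (\<integral>x. s x \<partial>\<phi>)\<bar> = \<bar>\<integral>x. g x - s x \<partial>\<phi>\<bar>"
      using compact_supp_integrable[OF g \<phi>] ints by simp
    also have "\<dots> \<le> (\<integral>x. \<bar>g x - s x\<bar> \<partial>\<phi>)" by (rule integral_abs_bound)
    also have "\<dots> \<le> (\<integral>x. (\<Sum>i<m. \<eta> * indicator (d i) x) \<partial>\<phi>)"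
      using compact_supp_integrable[OF g \<phi>] ints ind bound
      by (intro integral_mono Bochner_Integration.integrable_sum) auto
    also have "\<dots> = (\<Sum>i<m. \<eta> * measure \<phi> (d i))"
      using ind \<phi> by (subst Bochner_Integration.integral_sum) auto
    finally show ?thesis by (simp add: eqs sum_distrib_left)
  qed
  define c where "c i = (SOME k. emeasure \<phi>0 (d i) = of_nat k)" for i
  have c: "emeasure \<phi>0 (d i) = of_nat (c i)" if "i < m" for i
    unfolding c_def
    by (rule someI_ex) (use count_meas_natE[OF \<phi>0(1) dB dbdd[OF that]] in blast)
  define l where "l = map (\<lambda>i. (d i, c i)) [0..<m]"
  have cells: "measure \<phi> (d i) = real (c i)" if "\<phi> \<in> mass_cell l" "i < m" for \<phi> i
  proof -
    have "emeasure \<phi> (d i) = of_nat (c i)" using that by (auto simp: mass_cell_def l_def)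
    then show ?thesis by (simp add: measure_def)
  qed
  have \<phi>0l: "\<phi>0 \<in> mass_cell l"
    using c \<phi>0(1) by (auto simp: mass_cell_def l_def)
  have "(\<Sum>i<m. c i) \<le> C"
  proof -
    have "of_nat (\<Sum>i<m. c i) = (\<Sum>i<m. emeasure \<phi>0 (d i))" using c by simp
    also have "\<dots> = emeasure \<phi>0 (\<Union>i<m. d i)"
      using disj dB \<phi>0(1) by (intro sum_emeasure) (auto simp: disjoint_family_on_def)
    also have "\<dots> \<le> emeasure \<phi>0 ?T"
      using dT \<phi>0(1) by (intro emeasure_mono) auto
    finally show ?thesis unfolding C by (subst (asm) of_nat_le_iff)
  qed
  then have cC: "(\<Sum>i<m. real (c i)) \<le> real C"
    by (metis of_nat_le_iff of_nat_sum)
  show ?thesis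
  proof (intro exI[of _ l] conjI)
    show "\<phi>0 \<in> mass_cell l" by (rule \<phi>0l)
    show "set l \<subseteq> {b - \<Union>F | b F. b \<in> \<B> \<and> bounded b \<and> F \<subseteq> \<B> \<and> finite F} \<times> UNIV"
    proof
      fix p assume "p \<in> set l"
      then obtain i where i: "i < m" "p = (d i, c i)" by (auto simp: l_def)
      have "bounded (b (xs ! i))" using b(3) bounded_ball bounded_subset by blast
      then have "d i \<in> {b - \<Union>F | b F. b \<in> \<B> \<and> bounded b \<and> F \<subseteq> \<B> \<and> finite F}"
        unfolding d_def using b(1)
        by (intro CollectI exI[of _ "b (xs ! i)"] exI[of _ "(\<lambda>j. b (xs ! j)) ` {..<i}"]) auto
      then show "p \<in> {b - \<Union>F | b F. b \<in> \<B> \<and> bounded b \<and> F \<subseteq> \<B> \<and> finite F} \<times> UNIV"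
        by (simp add: i)
    qed
    show "mass_cell l \<subseteq> {\<phi> \<in> count_meas. (\<integral>x. g x \<partial>\<phi>) \<in> U}"
    proof
      fix \<phi> assume \<phi>l: "\<phi> \<in> mass_cell l"
      then have \<phi>: "\<phi> \<in> count_meas" by (simp add: mass_cell_def)
      define a where "a = (\<Sum>i<m. g (y i) * real (c i))"
      have "\<bar>(\<integral>x. g x \<partial>\<phi>) - a\<bar> \<le> \<eta> * (\<Sum>i<m. real (c i))"
        using est[OF \<phi>] by (simp add: cells[OF \<phi>l] a_def)
      moreover have "\<bar>(\<integral>x. g x \<partial>\<phi>0) - a\<bar> \<le> \<eta> * (\<Sum>i<m. real (c i))"
        using est[OF \<phi>0(1)] by (simp add: cells[OF \<phi>0l] a_def)
      moreover have "\<eta> * (\<Sum>i<m. real (c i)) \<le> \<eta> * real C"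
        using cC \<eta>(1) by (intro mult_left_mono) auto
      ultimately have "\<bar>(\<integral>x. g x \<partial>\<phi>) - (\<integral>x. g x \<partial>\<phi>0)\<bar> < \<epsilon>"
        using \<eta>(2) by linarith
      then have "(\<integral>x. g x \<partial>\<phi>) \<in> ball (\<integral>x. g x \<partial>\<phi>0) \<epsilon>"
        by (simp add: dist_real_def abs_minus_commute)
      then show "\<phi> \<in> {\<phi> \<in> count_meas. (\<integral>x. g x \<partial>\<phi>) \<in> U}" using \<epsilon>(2) \<phi> by auto
    qed
  qed
qed

text \<open>Intersections of cells are cells, obtained by concatenating the two prescriptions, so it is enough
  to treat subbasic open sets. Countability comes from a countable basis of \<open>\<real>\<^sup>d\<close> and the fact that
  prescribed masses are natural numbers.\<close>
lemma countable_vague_network: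
  obtains \<V> :: "'a::euclidean_space measure set set" where
    "countable \<V>"
    "\<And>V. V \<in> \<V> \<Longrightarrow> \<exists>l. V = mass_cell l \<and> (\<forall>(B, k)\<in>set l. B \<in> sets borel \<and> bounded B)"
    "\<And>W \<phi>. openin vague_topology W \<Longrightarrow> \<phi> \<in> W \<Longrightarrow> \<exists>V\<in>\<V>. \<phi> \<in> V \<and> V \<subseteq> W"
proof -
  obtain \<B> :: "'a set set" where \<B>: "countable \<B>" "topological_basis \<B>"
    using ex_countable_basis by auto
  define \<R> where "\<R> = {b - \<Union>F | b F. b \<in> \<B> \<and> bounded b \<and> F \<subseteq> \<B> \<and> finite F}"
  have "\<R> \<subseteq> (\<lambda>(b, F). b - \<Union>F) ` (\<B> \<times> {F. finite F \<and> F \<subseteq> \<B>})"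
    by (auto simp: \<R>_def)
  then have cR: "countable \<R>"
    by (rule countable_subset) (intro countable_image countable_SIGMA \<B> countable_Collect_finite_subset)
  have Rb: "B \<in> sets borel \<and> bounded B" if R: "B \<in> \<R>" for B
  proof -
    obtain b F where F: "B = b - \<Union>F" "b \<in> \<B>" "bounded b" "F \<subseteq> \<B>" "finite F"
      using R unfolding \<R>_def by blast
    have "\<And>X. X \<in> \<B> \<Longrightarrow> X \<in> sets borel" using topological_basis_open[OF \<B>(2)] by auto
    then show ?thesis using F
      by (auto intro!: sets.Diff sets.finite_Union intro: bounded_subset)
  qed
  define \<V> where "\<V> = mass_cell ` lists (\<R> \<times> (UNIV :: nat set))"
  show ?thesis
  proof (rule that[of \<V>])
    show "countable \<V>" unfolding \<V>_def using cR by (intro countable_image countable_lists) auto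
    show "\<exists>l. V = mass_cell l \<and> (\<forall>(B, k)\<in>set l. B \<in> sets borel \<and> bounded B)" if "V \<in> \<V>" for V
      using that Rb by (fastforce simp: \<V>_def in_lists_conv_set)
    fix W and \<phi> :: "'a measure" assume W: "openin vague_topology W" "\<phi> \<in> W"
    have "generate_topology_on vague_subbase W"
      using W(1) by (simp add: vague_topology_eq openin_topology_generated_by_iff)
    then have "\<phi> \<in> W \<Longrightarrow> \<exists>l\<in>lists (\<R> \<times> UNIV). \<phi> \<in> mass_cell l \<and> mass_cell l \<subseteq> W"
    proof induction
      case (Int A B)
      then obtain l1 l2 where l: "l1 \<in> lists (\<R> \<times> UNIV)" "\<phi> \<in> mass_cell l1" "mass_cell l1 \<subseteq> A"
        "l2 \<in> lists (\<R> \<times> UNIV)" "\<phi> \<in> mass_cell l2" "mass_cell l2 \<subseteq> B" by blast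
      have "mass_cell (l1 @ l2) = mass_cell l1 \<inter> mass_cell l2" by (auto simp: mass_cell_def)
      then show ?case using l by (intro bexI[of _ "l1 @ l2"]) auto
    next
      case (UN K)
      then show ?case by blast
    next
      case (Basis S)
      then obtain g U where gU: "compact_supp g" "open U" "S = {\<phi> \<in> count_meas. (\<integral>x. g x \<partial>\<phi>) \<in> U}"
        by (auto simp: vague_subbase_def)
      then have "\<phi> \<in> count_meas" "(\<integral>x. g x \<partial>\<phi>) \<in> U" using Basis by auto
      from mass_cell_test_integral[OF \<B>(2) gU(1,2) this] gU(3) show ?case
        unfolding \<R>_def by (auto simp: lists_eq_set)
    qed simp
    then show "\<exists>V\<in>\<V>. \<phi> \<in> V \<and> V \<subseteq> W" using W(2) by (auto simp: \<V>_def)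
  qed
qed

lemma sets_N_space: "sets (N_space :: 'a::euclidean_space measure measure) = sigma_sets count_meas vague_subbase"
proof
  let ?O = "{U :: 'a measure set. openin vague_topology U}"
  have Pow: "?O \<subseteq> Pow count_meas" by (auto dest: openin_vague_subset)
  then have N: "sets N_space = sigma_sets count_meas ?O" by (simp add: N_space_def)
  show "sigma_sets count_meas vague_subbase \<subseteq> sets (N_space :: 'a measure measure)"
    unfolding N
    by (intro sigma_sets_mono')
      (auto simp: vague_topology_eq openin_topology_generated_by_iff intro: generate_topology_on.Basis)
  obtain \<V> :: "'a measure set set" where \<V>: "countable \<V>"
    "\<And>V. V \<in> \<V> \<Longrightarrow> \<exists>l. V = mass_cell l \<and> (\<forall>(B, k)\<in>set l. B \<in> sets borel \<and> bounded B)"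
    "\<And>W \<phi>. openin vague_topology W \<Longrightarrow> \<phi> \<in> W \<Longrightarrow> \<exists>V\<in>\<V>. \<phi> \<in> V \<and> V \<subseteq> W"
    by (rule countable_vague_network) blast
  have "W \<in> sets N_sub" if W: "openin vague_topology W" for W :: "'a measure set"
  proof -
    have "W = \<Union>{V \<in> \<V>. V \<subseteq> W}" using \<V>(3)[OF W] by blast
    moreover have "\<Union>{V \<in> \<V>. V \<subseteq> W} \<in> sets N_sub"
    proof (intro sets.countable_Union)
      show "countable {V \<in> \<V>. V \<subseteq> W}" using \<V>(1) by (rule countable_subset[rotated]) auto
      show "{V \<in> \<V>. V \<subseteq> W} \<subseteq> sets N_sub"
        using \<V>(2) by (fastforce intro: mass_cell_N_sub)
    qed
    ultimately show ?thesis by simp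
  qed
  then have "?O \<subseteq> sigma_sets count_meas vague_subbase" by (auto simp: sets_N_sub)
  then show "sets (N_space :: 'a measure measure) \<subseteq> sigma_sets count_meas vague_subbase"
    unfolding N by (rule sigma_sets_mono)
qed

lemma N_space_measurable_iff: "measurable N_space K = measurable N_sub K"
  by (rule measurable_cong_sets) (simp_all add: sets_N_space sets_N_sub)

lemma measurable_mass[measurable]:
  "B \<in> sets borel \<Longrightarrow> (\<lambda>\<phi>. emeasure \<phi> B) \<in> borel_measurable N_space"
  by (simp add: N_space_measurable_iff measurable_mass_N_sub)

lemma mass_cell_sets:
  assumes "fst ` set l \<subseteq> sets borel"
  shows "mass_cell l \<in> sets N_space"
  using mass_cell_N_sub[OF assms] by (simp add: sets_N_space sets_N_sub)

text \<open>A vague open set is a countable union of members of the network, and those are described by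
  masses of bounded Borel sets.\<close>
lemma measurable_N_spaceI:
  fixes h :: "'w \<Rightarrow> 'a::euclidean_space measure"
  assumes h: "\<And>\<omega>. \<omega> \<in> space M \<Longrightarrow> h \<omega> \<in> count_meas"
    and B: "\<And>B. B \<in> sets borel \<Longrightarrow> bounded B \<Longrightarrow> (\<lambda>\<omega>. emeasure (h \<omega>) B) \<in> borel_measurable M"
  shows "h \<in> measurable M N_space"
proof -
  obtain \<V> :: "'a measure set set" where \<V>: "countable \<V>"
    "\<And>V. V \<in> \<V> \<Longrightarrow> \<exists>l. V = mass_cell l \<and> (\<forall>(B, k)\<in>set l. B \<in> sets borel \<and> bounded B)"
    "\<And>W \<phi>. openin vague_topology W \<Longrightarrow> \<phi> \<in> W \<Longrightarrow> \<exists>V\<in>\<V>. \<phi> \<in> V \<and> V \<subseteq> W"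
    by (rule countable_vague_network) blast
  have pre: "h -` V \<inter> space M \<in> sets M" if V: "V \<in> \<V>" for V
  proof -
    obtain l where l: "V = mass_cell l" "\<forall>(B, k)\<in>set l. B \<in> sets borel \<and> bounded B"
      using \<V>(2)[OF V] by blast
    have "{\<omega> \<in> space M. \<forall>p\<in>set l. emeasure (h \<omega>) (fst p) = of_nat (snd p)} \<in> sets M"
      using l(2) by (intro sets.sets_Collect_finite_All ballI borel_measurable_eq B) auto
    also have "{\<omega> \<in> space M. \<forall>p\<in>set l. emeasure (h \<omega>) (fst p) = of_nat (snd p)} = h -` V \<inter> space M"
      using h by (auto simp: l(1) mass_cell_def)
    finally show ?thesis .
  qed
  show ?thesis
    unfolding N_space_def
  proof (rule measurable_measure_of)
    show "{U. openin vague_topology U} \<subseteq> Pow (count_meas :: 'a measure set)"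
      by (auto dest: openin_vague_subset)
    show "h \<in> space M \<rightarrow> count_meas" using h by auto
    fix W :: "'a measure set" assume "W \<in> {U. openin vague_topology U}"
    then have W: "openin vague_topology W" by simp
    have "h -` W \<inter> space M = (\<Union>V\<in>{V \<in> \<V>. V \<subseteq> W}. h -` V \<inter> space M)"
      using \<V>(3)[OF W] by blast
    also have "\<dots> \<in> sets M"
      using \<V>(1) pre by (intro sets.countable_UN') (auto intro: countable_subset)
    finally show "h -` W \<inter> space M \<in> sets M" .
  qed
qed

lemma test_integrals_separate:
  fixes \<phi> \<psi> :: "'a::euclidean_space measure"
  assumes "\<phi> \<in> count_meas" "\<psi> \<in> count_meas"
    and eq: "\<And>g. compact_supp g \<Longrightarrow> (\<integral>x. g x \<partial>\<phi>) = (\<integral>x. g x \<partial>\<psi>)"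
  shows "\<phi> = \<psi>"
proof (rule measure_eqI_generator_eq)
  let ?E = "{U :: 'a set. open U \<and> bounded U}"
  show "Int_stable ?E" by (auto simp: Int_stable_def)
  show "?E \<subseteq> Pow UNIV" by simp
  show "emeasure \<phi> U = emeasure \<psi> U" if "U \<in> ?E" for U
  proof -
    have U: "open U" "bounded U" using that by auto
    obtain g where g: "\<And>n::nat. compact_supp (g n)"
      "\<And>\<phi>. \<phi> \<in> count_meas \<Longrightarrow> (\<lambda>n. \<integral>x. g n x \<partial>\<phi>) \<longlonglongrightarrow> measure \<phi> U"
      by (rule measure_open_limit[OF U]) blast
    have "measure \<phi> U = measure \<psi> U"
      using g(2)[OF assms(1)] g(2)[OF assms(2)] eq[OF g(1)] LIMSEQ_unique by fastforce
    then show ?thesis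
      using count_meas_finite[OF assms(1), of U] count_meas_finite[OF assms(2), of U] U
      by (simp add: emeasure_eq_ennreal_measure)
  qed
  have "W \<in> sigma_sets UNIV ?E" if "open W" for W
  proof -
    have "W = (\<Union>n. W \<inter> ball 0 (real n))" using UN_ball_real by blast
    moreover have "(\<Union>n. W \<inter> ball 0 (real n)) \<in> sigma_sets UNIV ?E"
      using that by (intro sigma_sets.Union sigma_sets.Basic) (auto simp: bounded_Int)
    ultimately show ?thesis by simp
  qed
  then have "sigma_sets UNIV {S :: 'a set. open S} = sigma_sets UNIV ?E"
    by (intro antisym sigma_sets_mono) (auto intro: sigma_sets.Basic)
  then have "sets borel = sigma_sets UNIV ?E" by (simp add: borel_def)
  then show "sets \<phi> = sigma_sets UNIV ?E" "sets \<psi> = sigma_sets UNIV ?E" using assms by auto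
  show "range (\<lambda>n. ball 0 (real n)) \<subseteq> ?E" by auto
  show "(\<Union>n. ball 0 (real n)) = (UNIV :: 'a set)" by (rule UN_ball_real)
  show "emeasure \<phi> (ball 0 (real n)) \<noteq> \<infinity>" for n
    using count_meas_finite[OF assms(1), of "ball 0 (real n)"] by auto
qed

text \<open>The network separates configurations, so equality of two random configurations is an event.\<close>
lemma sets_Collect_N_space_eq:
  fixes S T :: "'w \<Rightarrow> 'a::euclidean_space measure"
  assumes S: "S \<in> measurable M N_space" and T: "T \<in> measurable M N_space"
  shows "{\<omega> \<in> space M. S \<omega> = T \<omega>} \<in> sets M"
proof -
  obtain \<V> :: "'a measure set set" where \<V>: "countable \<V>"
    "\<And>V. V \<in> \<V> \<Longrightarrow> \<exists>l. V = mass_cell l \<and> (\<forall>(B, k)\<in>set l. B \<in> sets borel \<and> bounded B)"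
    "\<And>W \<phi>. openin vague_topology W \<Longrightarrow> \<phi> \<in> W \<Longrightarrow> \<exists>V\<in>\<V>. \<phi> \<in> V \<and> V \<subseteq> W"
    by (rule countable_vague_network) blast
  have VN: "V \<in> sets N_space" if "V \<in> \<V>" for V
    using \<V>(2)[OF that] by (fastforce intro: mass_cell_sets)
  have sep: "\<phi> = \<psi>" if \<phi>: "\<phi> \<in> count_meas" "\<psi> \<in> count_meas" "\<And>V. V \<in> \<V> \<Longrightarrow> \<phi> \<in> V \<Longrightarrow> \<psi> \<in> V"
    for \<phi> \<psi> :: "'a measure"
  proof (rule test_integrals_separate[OF \<phi>(1,2)], rule ccontr)
    fix g assume g: "compact_supp g" and ne: "(\<integral>x. g x \<partial>\<phi>) \<noteq> (\<integral>x. g x \<partial>\<psi>)"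
    let ?W = "{\<phi> \<in> count_meas. (\<integral>x. g x \<partial>\<phi>) \<in> - {\<integral>x. g x \<partial>\<psi>}}"
    have "openin vague_topology ?W"
      unfolding vague_topology_eq
    proof (rule topology_generated_by_Basis)
      show "?W \<in> vague_subbase"
        unfolding vague_subbase_def using g
        by (intro CollectI exI[of _ g] exI[of _ "- {\<integral>x. g x \<partial>\<psi>}"])
          (simp add: open_Compl)
    qed
    moreover have "\<phi> \<in> ?W" using ne \<phi>(1) by simp
    ultimately obtain V where "V \<in> \<V>" "\<phi> \<in> V" "V \<subseteq> ?W" using \<V>(3) by blast
    then show False using \<phi>(3) by blast
  qed
  have ST: "S \<omega> \<in> count_meas" "T \<omega> \<in> count_meas" if "\<omega> \<in> space M" for \<omega>
    using that measurable_space[OF S] measurable_space[OF T] by auto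
  have "{\<omega> \<in> space M. S \<omega> = T \<omega>} = {\<omega> \<in> space M. \<forall>V\<in>\<V>. S \<omega> \<in> V \<longrightarrow> T \<omega> \<in> V}"
  proof (intro Collect_cong conj_cong refl iffI ballI impI)
    fix \<omega> assume "\<omega> \<in> space M" "\<forall>V\<in>\<V>. S \<omega> \<in> V \<longrightarrow> T \<omega> \<in> V"
    then show "S \<omega> = T \<omega>" by (intro sep ST) blast+
  qed simp
  also have "\<dots> \<in> sets M"
  proof (intro sets.sets_Collect_countable_All' sets.sets_Collect_imp \<V>(1))
    fix V assume "V \<in> \<V>"
    from measurable_sets[OF S VN[OF this]] measurable_sets[OF T VN[OF this]]
    show "{\<omega> \<in> space M. S \<omega> \<in> V} \<in> sets M" "{\<omega> \<in> space M. T \<omega> \<in> V} \<in> sets M"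
      by (simp_all add: vimage_def Int_def conj_commute)
  qed
  finally show ?thesis .
qed

section \<open>Weak limits in the space of laws\<close>

lemma openin_vague_sets: "openin vague_topology W \<Longrightarrow> W \<in> sets N_space"
  unfolding N_space_def by (subst sets_measure_of) (auto dest: openin_vague_subset)

lemma space_N0_space[simp]: "space N0_space = count_meas0"
  by (auto simp: N0_space_def space_restrict_space count_meas0_def)

lemma continuous_N0_measurable:
  assumes "continuous_map (subtopology vague_topology count_meas0) euclideanreal h"
  shows "h \<in> borel_measurable N0_space"
proof (rule borel_measurableI)
  fix U :: "real set" assume "open U"
  then have "openin (subtopology vague_topology count_meas0)
      {x \<in> topspace (subtopology vague_topology count_meas0). h x \<in> U}"
    by (intro openin_continuous_map_preimage[OF assms]) auto
  then obtain T where T: "openin vague_topology T"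
    "{x \<in> topspace (subtopology vague_topology count_meas0). h x \<in> U} = T \<inter> count_meas0"
    by (auto simp: openin_subtopology)
  have "h -` U \<inter> space N0_space = count_meas0 \<inter> T"
    using T(2) by (auto simp: count_meas0_def)
  then show "h -` U \<inter> space N0_space \<in> sets N0_space"
    using openin_vague_sets[OF T(1)] by (auto simp: N0_space_def sets_restrict_space)
qed

abbreviation weak_test :: "('a::euclidean_space measure \<Rightarrow> real) \<Rightarrow> bool" where
  "weak_test h \<equiv> continuous_map (subtopology vague_topology count_meas0) euclideanreal h \<and>
     bounded (h ` count_meas0)"

text \<open>The sets of laws for which convergence implies eventual membership are closed under unions and
  finite intersections, so the defining subbase suffices.\<close>
lemma weak_limit_iff:
  assumes R: "\<And>n. R n \<in> prob_N0"
  shows "limitin weak_topology_N0 R Q sequentially \<longleftrightarrow>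
    Q \<in> prob_N0 \<and> (\<forall>h. weak_test h \<longrightarrow> (\<lambda>n. \<integral>\<phi>. h \<phi> \<partial>R n) \<longlonglongrightarrow> (\<integral>\<phi>. h \<phi> \<partial>Q))"
    (is "_ \<longleftrightarrow> ?rhs")
proof -
  define \<S> where "\<S> = {{P \<in> prob_N0. (\<integral>\<phi>. h \<phi> \<partial>P) \<in> U} | (h :: 'a measure \<Rightarrow> real) U. weak_test h \<and> open U}"
  have top: "weak_topology_N0 = topology_generated_by \<S>"
    unfolding weak_topology_N0_def \<S>_def by (simp add: conj_assoc)
  have basis: "{P \<in> prob_N0. (\<integral>\<phi>. h \<phi> \<partial>P) \<in> U} \<in> \<S>" if "weak_test h" "open U" for h U
    unfolding \<S>_def using that by blast
  have "prob_N0 \<in> \<S>"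
    using basis[of "\<lambda>_. 0" UNIV] by (simp add: image_constant_conv)
  then have topsp: "\<Union>\<S> = prob_N0" by (auto simp: \<S>_def)
  show ?thesis
  proof
    assume lim: "limitin weak_topology_N0 R Q sequentially"
    then have Q: "Q \<in> prob_N0" by (simp add: limitin_def top topsp)
    have "(\<lambda>n. \<integral>\<phi>. h \<phi> \<partial>R n) \<longlonglongrightarrow> (\<integral>\<phi>. h \<phi> \<partial>Q)" if h: "weak_test h" for h
    proof (rule topological_tendstoI)
      fix U :: "real set" assume U: "open U" "(\<integral>\<phi>. h \<phi> \<partial>Q) \<in> U"
      have "openin weak_topology_N0 {P \<in> prob_N0. (\<integral>\<phi>. h \<phi> \<partial>P) \<in> U}"
        unfolding top by (rule topology_generated_by_Basis[OF basis[OF h U(1)]])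
      then have "\<forall>\<^sub>F n in sequentially. R n \<in> {P \<in> prob_N0. (\<integral>\<phi>. h \<phi> \<partial>P) \<in> U}"
        using lim U(2) Q unfolding limitin_def by blast
      then show "\<forall>\<^sub>F n in sequentially. (\<integral>\<phi>. h \<phi> \<partial>R n) \<in> U"
        by (rule eventually_mono) simp
    qed
    with Q show ?rhs by blast
  next
    assume rhs: ?rhs
    show "limitin weak_topology_N0 R Q sequentially"
      unfolding limitin_def
    proof (intro conjI allI impI; (elim conjE)?)
      show "Q \<in> topspace weak_topology_N0" using rhs by (simp add: top topsp)
      fix W assume W: "openin weak_topology_N0 W" and QW: "Q \<in> W"
      have "generate_topology_on \<S> W"
        using W by (simp add: top openin_topology_generated_by_iff)
      then have "Q \<in> W \<Longrightarrow> \<forall>\<^sub>F n in sequentially. R n \<in> W"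
      proof induction
        case (Int A B)
        then show ?case by (auto intro: eventually_conj)
      next
        case (UN K)
        then obtain k where k: "k \<in> K" "\<forall>\<^sub>F n in sequentially. R n \<in> k" by blast
        from k(2) show ?case by (rule eventually_mono) (use k(1) in blast)
      next
        case (Basis S)
        then obtain h U where hU: "weak_test h" "open U" "S = {P \<in> prob_N0. (\<integral>\<phi>. h \<phi> \<partial>P) \<in> U}"
          by (auto simp: \<S>_def)
        then have "\<forall>\<^sub>F n in sequentially. (\<integral>\<phi>. h \<phi> \<partial>R n) \<in> U"
          using rhs Basis(2) by (intro topological_tendstoD[of _ "\<integral>\<phi>. h \<phi> \<partial>Q"]) auto
        then show ?case by (rule eventually_mono) (simp add: hU R)
      qed simp
      then show "\<forall>\<^sub>F n in sequentially. R n \<in> W" using QW by blast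
    qed
  qed
qed

lemma continuous_test_integral:
  assumes "compact_supp g"
  shows "continuous_map vague_topology euclideanreal (\<lambda>\<phi>. \<integral>x. g x \<partial>\<phi>)"
  unfolding continuous_map_def
proof (intro conjI allI impI)
  fix U :: "real set" assume "openin euclideanreal U"
  then have "{\<phi> \<in> count_meas. (\<integral>x. g x \<partial>\<phi>) \<in> U} \<in> vague_subbase"
    using assms by (auto simp: vague_subbase_def)
  then have "openin vague_topology {\<phi> \<in> count_meas. (\<integral>x. g x \<partial>\<phi>) \<in> U}"
    unfolding vague_topology_eq by (rule topology_generated_by_Basis)
  then show "openin vague_topology {\<phi> \<in> topspace vague_topology. (\<integral>x. g x \<partial>\<phi>) \<in> U}"
    by simp
qed simp

text \<open>The indicator of a finite intersection of subbasic open sets is a limit of products of bounded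
  continuous functionals, and such intersections form a generating \<open>\<pi>\<close>-system.\<close>
lemma prob_N0_eqI:
  fixes P Q :: "'a::euclidean_space measure measure"
  assumes P: "P \<in> prob_N0" and Q: "Q \<in> prob_N0"
    and eq: "\<And>h. weak_test h \<Longrightarrow> (\<integral>\<phi>. h \<phi> \<partial>P) = (\<integral>\<phi>. h \<phi> \<partial>Q)"
  shows "P = Q"
proof -
  interpret P: prob_space P using P by (simp add: prob_N0_def)
  interpret Q: prob_space Q using Q by (simp add: prob_N0_def)
  have setsP: "sets P = sets N0_space" and setsQ: "sets Q = sets N0_space"
    using P Q by (simp_all add: prob_N0_def)
  have spP: "space P = count_meas0" and spQ: "space Q = count_meas0"
    using sets_eq_imp_space_eq[OF setsP] sets_eq_imp_space_eq[OF setsQ] by simp_all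
  have incl: "(\<lambda>\<phi>. \<phi>) \<in> measurable R N_space" if "sets R = sets N0_space"
    for R :: "'a measure measure"
    unfolding measurable_cong_sets[OF that refl] N0_space_def
    by (intro measurable_restrict_space1 measurable_ident_sets) simp
  define E where "E = {\<Inter>F | F. F \<subseteq> vague_subbase \<and> finite F \<and> F \<noteq> ({} :: 'a measure set set)}"
  have EN: "X \<in> sets N_space" if "X \<in> E" for X
  proof -
    obtain F where F: "X = \<Inter>F" "F \<subseteq> vague_subbase" "finite F" "F \<noteq> {}"
      using \<open>X \<in> E\<close> unfolding E_def by blast
    have "(\<Inter>W\<in>F. W) \<in> sets N_space"
      using F(2-4) by (intro sets.finite_INT) (auto simp: sets_N_space intro: sigma_sets.Basic)
    then show ?thesis by (simp add: F(1))
  qed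
  have "distr P N_space (\<lambda>\<phi>. \<phi>) = distr Q N_space (\<lambda>\<phi>. \<phi>)"
  proof (rule measure_eqI_generator_eq)
    show "Int_stable E"
    proof (rule Int_stableI)
      fix A B assume "A \<in> E" "B \<in> E"
      then obtain F G where "A = \<Inter>F" "F \<subseteq> vague_subbase" "finite F" "F \<noteq> {}"
        "B = \<Inter>G" "G \<subseteq> vague_subbase" "finite G" "G \<noteq> {}" unfolding E_def by blast
      then show "A \<inter> B \<in> E" unfolding E_def
        by (intro CollectI exI[of _ "F \<union> G"]) auto
    qed
    show "E \<subseteq> Pow count_meas" using sets.sets_into_space[OF EN] by auto
    have sub: "vague_subbase \<subseteq> E"
      unfolding E_def by (intro subsetI CollectI exI[of _ "{_}"]) auto
    have "sigma_sets count_meas E = sets N_space"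
    proof
      show "sigma_sets count_meas E \<subseteq> sets N_space"
        using EN sets.sigma_sets_subset[of E N_space] by auto
      show "sets N_space \<subseteq> sigma_sets count_meas E"
        unfolding sets_N_space using sub by (rule sigma_sets_mono')
    qed
    then show "sets (distr P N_space (\<lambda>\<phi>. \<phi>)) = sigma_sets count_meas E"
      "sets (distr Q N_space (\<lambda>\<phi>. \<phi>)) = sigma_sets count_meas E" by simp_all
    have "count_meas \<in> vague_subbase"
      unfolding vague_subbase_def
      by (intro CollectI exI[of _ "\<lambda>_. 0"] exI[of _ UNIV]) (auto simp: compact_supp_0)
    then show "range (\<lambda>_ :: nat. count_meas) \<subseteq> E" "(\<Union>i :: nat. count_meas) = (count_meas :: 'a measure set)"
      using sub by auto
    show "emeasure (distr P N_space (\<lambda>\<phi>. \<phi>)) count_meas \<noteq> \<infinity>"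
      using prob_space.prob_space_distr[OF P.prob_space_axioms incl[OF setsP]]
      by (simp add: prob_space.emeasure_space_1 finite_measure.emeasure_finite prob_space_def)
  next
    fix X assume XE: "X \<in> E"
    then obtain F where F: "X = \<Inter>F" "F \<subseteq> vague_subbase" "finite F" "F \<noteq> {}"
      unfolding E_def by blast
    have "\<forall>W\<in>F. \<exists>p. compact_supp (fst p) \<and> open (snd p) \<and>
        W = {\<phi> \<in> count_meas. (\<integral>x. fst p x \<partial>\<phi>) \<in> snd p}"
    proof
      fix W assume "W \<in> F"
      then have "W \<in> vague_subbase" using F(2) by blast
      then obtain g U where "W = {\<phi> \<in> count_meas. (\<integral>x. g x \<partial>\<phi>) \<in> U}" "compact_supp g" "open U"
        unfolding vague_subbase_def by blast
      then show "\<exists>p. compact_supp (fst p) \<and> open (snd p) \<and>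
          W = {\<phi> \<in> count_meas. (\<integral>x. fst p x \<partial>\<phi>) \<in> snd p}"
        by (intro exI[of _ "(g, U)"]) simp
    qed
    from bchoice[OF this] obtain p where p: "\<forall>W\<in>F. compact_supp (fst (p W)) \<and> open (snd (p W)) \<and>
        W = {\<phi> \<in> count_meas. (\<integral>x. fst (p W) x \<partial>\<phi>) \<in> snd (p W)}" by blast
    define g U where "g W = fst (p W)" and "U W = snd (p W)" for W
    have gU: "\<And>W. W \<in> F \<Longrightarrow> compact_supp (g W)" "\<And>W. W \<in> F \<Longrightarrow> open (U W)"
      "\<And>W. W \<in> F \<Longrightarrow> W = {\<phi> \<in> count_meas. (\<integral>x. g W x \<partial>\<phi>) \<in> U W}"
      unfolding g_def U_def using p by blast+
    have "\<exists>u :: nat \<Rightarrow> real \<Rightarrow> real. (\<forall>n. continuous_on UNIV (u n)) \<and> (\<forall>n x. 0 \<le> u n x \<and> u n x \<le> 1) \<and>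
        (\<forall>x. (\<lambda>n. u n x) \<longlonglongrightarrow> indicator (U W) x)" if W: "W \<in> F" for W
    proof -
      obtain u :: "nat \<Rightarrow> real \<Rightarrow> real" where u: "\<And>n. continuous_on UNIV (u n)" "\<And>n x. 0 \<le> u n x"
        "\<And>n x. u n x \<le> 1" "\<And>n x. x \<notin> U W \<Longrightarrow> u n x = 0" "\<And>x. (\<lambda>n. u n x) \<longlonglongrightarrow> indicator (U W) x"
        by (rule open_indicator_limit[OF gU(2)[OF W]]) blast
      show ?thesis by (intro exI[of _ u]) (simp add: u)
    qed
    then obtain u :: "'a measure set \<Rightarrow> nat \<Rightarrow> real \<Rightarrow> real" where
      u: "\<And>W n. W \<in> F \<Longrightarrow> continuous_on UNIV (u W n)" "\<And>W n x. W \<in> F \<Longrightarrow> 0 \<le> u W n x"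
        "\<And>W n x. W \<in> F \<Longrightarrow> u W n x \<le> 1"
        "\<And>W x. W \<in> F \<Longrightarrow> (\<lambda>n. u W n x) \<longlonglongrightarrow> indicator (U W) x" by metis
    define h where "h n \<phi> = (\<Prod>W\<in>F. u W n (\<integral>x. g W x \<partial>\<phi>))" for n \<phi>
    have h01: "0 \<le> h n \<phi>" "h n \<phi> \<le> 1" for n \<phi>
      using u by (auto simp: h_def intro!: prod_nonneg prod_le_1)
    have cont: "continuous_map (subtopology vague_topology count_meas0) euclideanreal (h n)" for n
      unfolding h_def
    proof (rule continuous_map_prod[OF F(3)])
      fix W assume W: "W \<in> F"
      have "continuous_map vague_topology euclideanreal (u W n \<circ> (\<lambda>\<phi>. \<integral>x. g W x \<partial>\<phi>))"
        by (rule continuous_map_compose[OF continuous_test_integral[OF gU(1)[OF W]]])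
          (simp add: u(1)[OF W])
      then show "continuous_map (subtopology vague_topology count_meas0) euclideanreal
          (\<lambda>\<phi>. u W n (\<integral>x. g W x \<partial>\<phi>))"
        by (intro continuous_map_from_subtopology) (simp add: o_def)
    qed
    have test: "weak_test (h n)" for n
      using cont h01[of n] by (auto simp: bounded_iff intro!: exI[of _ 1])
    have lim: "(\<lambda>n. h n \<phi>) \<longlonglongrightarrow> indicator X \<phi>" if \<phi>: "\<phi> \<in> count_meas" for \<phi>
    proof -
      have "(\<lambda>n. h n \<phi>) \<longlonglongrightarrow> (\<Prod>W\<in>F. indicator (U W) (\<integral>x. g W x \<partial>\<phi>))"
        unfolding h_def by (intro tendsto_prod u(4))
      also have "(\<Prod>W\<in>F. indicator (U W) (\<integral>x. g W x \<partial>\<phi>)) = (\<Prod>W\<in>F. indicator W \<phi> :: real)"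
      proof (rule prod.cong[OF refl])
        fix W assume W: "W \<in> F"
        have "\<phi> \<in> W \<longleftrightarrow> (\<integral>x. g W x \<partial>\<phi>) \<in> U W"
          by (subst gU(3)[OF W]) (simp add: \<phi>)
        then show "indicator (U W) (\<integral>x. g W x \<partial>\<phi>) = (indicator W \<phi> :: real)"
          by (simp add: indicator_def)
      qed
      also have "\<dots> = indicator X \<phi>"
        unfolding F(1) using F(3) by (auto simp: indicator_def prod_zero_iff)
      finally show ?thesis .
    qed
    have conv: "(\<lambda>n. \<integral>\<phi>. h n \<phi> \<partial>R) \<longlonglongrightarrow> measure (distr R N_space (\<lambda>\<phi>. \<phi>)) X"
      if R: "prob_space R" "sets R = sets N0_space" for R
    proof -
      interpret R: prob_space R by fact
      have spR: "space R = count_meas0" using sets_eq_imp_space_eq[OF R(2)] by simp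
      have X: "X \<in> sets N_space" by (rule EN[OF XE])
      have XR: "X \<inter> space R \<in> sets R"
        using measurable_sets[OF incl[OF R(2)] X] by simp
      have "(\<lambda>n. \<integral>\<phi>. h n \<phi> \<partial>R) \<longlonglongrightarrow> (\<integral>\<phi>. indicator (X \<inter> space R) \<phi> \<partial>R)"
      proof (rule integral_dominated_convergence)
        show "h n \<in> borel_measurable R" for n
          using continuous_N0_measurable[OF cont] by (simp add: measurable_cong_sets[OF R(2) refl])
        show "indicator (X \<inter> space R) \<in> borel_measurable R" using XR by simp
        show "integrable R (\<lambda>_. 1 :: real)" by simp
        show "AE \<phi> in R. (\<lambda>n. h n \<phi>) \<longlonglongrightarrow> indicator (X \<inter> space R) \<phi>"
        proof (rule AE_I2)
          fix \<phi> assume \<phi>: "\<phi> \<in> space R"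
          then have "indicator (X \<inter> space R) \<phi> = (indicator X \<phi> :: real)"
            by (simp add: indicator_def)
          then show "(\<lambda>n. h n \<phi>) \<longlonglongrightarrow> indicator (X \<inter> space R) \<phi>"
            using lim[of \<phi>] \<phi> by (simp only: spR) (simp add: count_meas0_def)
        qed
        show "AE \<phi> in R. norm (h n \<phi>) \<le> 1" for n using h01 by auto
      qed
      also have "(\<integral>\<phi>. indicator (X \<inter> space R) \<phi> \<partial>R) = measure R (X \<inter> space R)"
        using XR by simp
      also have "\<dots> = measure (distr R N_space (\<lambda>\<phi>. \<phi>)) X"
        using incl[OF R(2)] X by (simp add: measure_distr)
      finally show ?thesis .
    qed
    have "measure (distr P N_space (\<lambda>\<phi>. \<phi>)) X = measure (distr Q N_space (\<lambda>\<phi>. \<phi>)) X"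
      using conv[OF P.prob_space_axioms setsP] conv[OF Q.prob_space_axioms setsQ]
      unfolding eq[OF test] by (rule LIMSEQ_unique)
    then show "emeasure (distr P N_space (\<lambda>\<phi>. \<phi>)) X = emeasure (distr Q N_space (\<lambda>\<phi>. \<phi>)) X"
      using P.prob_space_distr[OF incl[OF setsP]] Q.prob_space_distr[OF incl[OF setsQ]]
      by (simp add: finite_measure.emeasure_eq_measure prob_space_def)
  qed
  note push = this
  show ?thesis
  proof (rule measure_eqI)
    fix B assume "B \<in> sets P"
    then obtain A where A: "A \<in> sets N_space" "B = count_meas0 \<inter> A"
      by (auto simp: setsP N0_space_def sets_restrict_space)
    have "emeasure (distr P N_space (\<lambda>\<phi>. \<phi>)) A = emeasure (distr Q N_space (\<lambda>\<phi>. \<phi>)) A"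
      by (simp add: push)
    then show "emeasure P B = emeasure Q B"
      using A incl[OF setsP] incl[OF setsQ] by (simp add: emeasure_distr spP spQ Int_commute)
  qed (simp add: setsP setsQ)
qed

lemma ennreal_times_divide_cancel: "c \<noteq> 0 \<Longrightarrow> c \<noteq> \<infinity> \<Longrightarrow> c * (x / c) = (x :: ennreal)"
  by (simp add: ennreal_times_divide mult.commute[of c] ennreal_mult_divide_eq)

section \<open>Integrals against random configurations\<close>

text \<open>A random configuration is a kernel of locally finite measures. Restricting it to balls and
  normalising by \<open>1 + \<phi>(ball)\<close> gives subprobability kernels.\<close>
lemma measurable_nn_integral_kernel:
  fixes \<kappa> :: "'w \<Rightarrow> 'a::euclidean_space measure"
  assumes \<kappa>: "\<kappa> \<in> measurable M N_space" and u: "(\<lambda>(\<omega>, x). u \<omega> x) \<in> borel_measurable (M \<Otimes>\<^sub>M borel)"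
  shows "(\<lambda>\<omega>. \<integral>\<^sup>+x. u \<omega> x \<partial>\<kappa> \<omega>) \<in> borel_measurable M"
proof -
  have \<kappa>c: "\<kappa> \<omega> \<in> count_meas" if "\<omega> \<in> space M" for \<omega>
    using measurable_space[OF \<kappa> that] by simp
  have bm: "borel_measurable (\<kappa> \<omega>) = borel_measurable borel" if "\<omega> \<in> space M" for \<omega>
    by (rule measurable_cong_sets[OF count_meas_sets[OF \<kappa>c[OF that]] refl])
  have mass: "(\<lambda>\<omega>. emeasure (\<kappa> \<omega>) B) \<in> borel_measurable M" if "B \<in> sets borel" for B
    using measurable_compose[OF \<kappa> measurable_mass[OF that]] .
  have uw: "u \<omega> \<in> borel_measurable borel" if "\<omega> \<in> space M" for \<omega>
    using measurable_compose[OF measurable_Pair1'[OF that] u] by simp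
  have loc: "(\<lambda>\<omega>. \<integral>\<^sup>+x. u \<omega> x * indicator (ball 0 (real n)) x \<partial>\<kappa> \<omega>) \<in> borel_measurable M" for n
  proof -
    let ?D = "ball 0 (real n) :: 'a set"
    define c where "c \<omega> = 1 + emeasure (\<kappa> \<omega>) ?D" for \<omega>
    have cm: "c \<in> borel_measurable M" unfolding c_def using mass by simp
    have c: "c \<omega> \<noteq> 0" "c \<omega> \<noteq> \<infinity>" if "\<omega> \<in> space M" for \<omega>
      using count_meas_finite[OF \<kappa>c[OF that], of ?D] by (auto simp: c_def)
    define L where "L \<omega> = density (\<kappa> \<omega>) (\<lambda>x. indicator ?D x / c \<omega>)" for \<omega>
    have Lint: "(\<integral>\<^sup>+x. v x \<partial>L \<omega>) = (\<integral>\<^sup>+x. v x * indicator ?D x \<partial>\<kappa> \<omega>) / c \<omega>"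
      if "\<omega> \<in> space M" "v \<in> borel_measurable borel" for \<omega> v
    proof -
      have wm: "(\<lambda>x. indicator ?D x / c \<omega>) \<in> borel_measurable borel"
        by (intro borel_measurable_divide_ennreal borel_measurable_indicator borel_measurable_const) simp
      have "(\<integral>\<^sup>+x. v x \<partial>L \<omega>) = (\<integral>\<^sup>+x. indicator ?D x / c \<omega> * v x \<partial>\<kappa> \<omega>)"
        unfolding L_def using that(2) wm by (subst nn_integral_density) (simp_all add: bm that(1))
      also have "\<dots> = (\<integral>\<^sup>+x. v x * indicator ?D x / c \<omega> \<partial>\<kappa> \<omega>)"
        by (simp add: divide_ennreal_def mult_ac)
      also have "\<dots> = (\<integral>\<^sup>+x. v x * indicator ?D x \<partial>\<kappa> \<omega>) / c \<omega>"
        using that(2) unfolding bm[OF that(1), symmetric]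
        by (intro nn_integral_divide borel_measurable_times_ennreal borel_measurable_indicator)
          (simp_all add: \<kappa>c that(1))
      finally show ?thesis .
    qed
    have Lem: "emeasure (L \<omega>) A = emeasure (\<kappa> \<omega>) (A \<inter> ?D) / c \<omega>"
      if "\<omega> \<in> space M" "A \<in> sets borel" for \<omega> A
    proof -
      have "emeasure (L \<omega>) A = (\<integral>\<^sup>+x. indicator A x \<partial>L \<omega>)"
        using that \<kappa>c by (intro nn_integral_indicator[symmetric]) (simp add: L_def)
      also have "\<dots> = (\<integral>\<^sup>+x. indicator A x * indicator ?D x \<partial>\<kappa> \<omega>) / c \<omega>"
        using that by (intro Lint) auto
      also have "(\<lambda>x. indicator A x * indicator ?D x :: ennreal) = indicator (A \<inter> ?D)"
        by (auto simp: indicator_def)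
      finally show ?thesis using that \<kappa>c by simp
    qed
    have "L \<in> measurable M (subprob_algebra borel)"
    proof (rule measurable_subprob_algebra)
      fix \<omega> assume \<omega>: "\<omega> \<in> space M"
      show "sets (L \<omega>) = sets borel" using \<kappa>c[OF \<omega>] by (simp add: L_def)
      show "subprob_space (L \<omega>)"
      proof (rule subprob_spaceI)
        have sp: "space (L \<omega>) = UNIV" using \<kappa>c[OF \<omega>] by (simp add: L_def)
        have "emeasure (L \<omega>) UNIV = emeasure (\<kappa> \<omega>) ?D / c \<omega>"
          using Lem[OF \<omega>, of UNIV] by simp
        also have "\<dots> \<le> c \<omega> / c \<omega>" by (intro divide_right_mono_ennreal) (simp add: c_def)
        also have "\<dots> = 1" using c[OF \<omega>] by (intro ennreal_divide_self) (auto simp: less_top)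
        finally show "emeasure (L \<omega>) (space (L \<omega>)) \<le> 1" by (simp add: sp)
        show "space (L \<omega>) \<noteq> {}" by (simp add: sp)
      qed
    next
      fix A :: "'a set" assume A: "A \<in> sets borel"
      have "(\<lambda>\<omega>. emeasure (\<kappa> \<omega>) (A \<inter> ?D) / c \<omega>) \<in> borel_measurable M"
        using cm mass[of "A \<inter> ?D"] A by (intro borel_measurable_divide_ennreal) auto
      then show "(\<lambda>\<omega>. emeasure (L \<omega>) A) \<in> borel_measurable M"
        by (rule measurable_cong[THEN iffD1, rotated]) (simp add: Lem A)
    qed
    then have "(\<lambda>\<omega>. \<integral>\<^sup>+x. u \<omega> x \<partial>L \<omega>) \<in> borel_measurable M"
      by (rule nn_integral_measurable_subprob_algebra2[OF u])
    then have "(\<lambda>\<omega>. c \<omega> * (\<integral>\<^sup>+x. u \<omega> x \<partial>L \<omega>)) \<in> borel_measurable M"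
      using cm by simp
    then show ?thesis
    proof (rule measurable_cong[THEN iffD1, rotated])
      fix \<omega> assume \<omega>: "\<omega> \<in> space M"
      show "c \<omega> * (\<integral>\<^sup>+x. u \<omega> x \<partial>L \<omega>) = (\<integral>\<^sup>+x. u \<omega> x * indicator ?D x \<partial>\<kappa> \<omega>)"
        unfolding Lint[OF \<omega> uw[OF \<omega>]] using c[OF \<omega>]
        by (simp add: ennreal_times_divide_cancel)
    qed
  qed
  have "(\<lambda>\<omega>. SUP n. \<integral>\<^sup>+x. u \<omega> x * indicator (ball 0 (real n)) x \<partial>\<kappa> \<omega>) \<in> borel_measurable M"
    using loc by measurable
  then show ?thesis
  proof (rule measurable_cong[THEN iffD1, rotated])
    fix \<omega> assume \<omega>: "\<omega> \<in> space M"
    have "(\<lambda>x. u \<omega> x * indicator (ball 0 (real n)) x) \<in> borel_measurable (\<kappa> \<omega>)" for n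
      unfolding bm[OF \<omega>] using uw[OF \<omega>]
      by (intro borel_measurable_times_ennreal borel_measurable_indicator) auto
    then
    have "(SUP n. \<integral>\<^sup>+x. u \<omega> x * indicator (ball 0 (real n)) x \<partial>\<kappa> \<omega>)
        = (\<integral>\<^sup>+x. (SUP n. u \<omega> x * indicator (ball 0 (real n)) x) \<partial>\<kappa> \<omega>)"
      by (intro nn_integral_monotone_convergence_SUP[symmetric])
        (auto simp: incseq_def le_fun_def indicator_def)
    also have "(\<lambda>x. SUP n. u \<omega> x * indicator (ball 0 (real n)) x) = u \<omega>"
    proof
      fix x :: 'a
      obtain k where k: "x \<in> ball 0 (real k)" using UN_ball_real by blast
      show "(SUP n. u \<omega> x * indicator (ball 0 (real n)) x) = u \<omega> x"
      proof (rule antisym)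
        show "(SUP n. u \<omega> x * indicator (ball 0 (real n)) x) \<le> u \<omega> x"
          by (intro SUP_least) (auto simp: indicator_def)
        show "u \<omega> x \<le> (SUP n. u \<omega> x * indicator (ball 0 (real n)) x)"
          using k by (intro SUP_upper2[of k]) (auto simp: indicator_def)
      qed
    qed
    finally show "(SUP n. \<integral>\<^sup>+x. u \<omega> x * indicator (ball 0 (real n)) x \<partial>\<kappa> \<omega>) = (\<integral>\<^sup>+x. u \<omega> x \<partial>\<kappa> \<omega>)" .
  qed
qed

lemma measurable_translate[measurable (raw)]:
  fixes \<kappa> :: "'w \<Rightarrow> 'a::euclidean_space measure"
  assumes T: "T \<in> borel_measurable M" and \<kappa>: "\<kappa> \<in> measurable M N_space"
  shows "(\<lambda>\<omega>. translate (T \<omega>) (\<kappa> \<omega>)) \<in> measurable M N_space"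
proof (rule measurable_N_spaceI)
  have \<kappa>c: "\<kappa> \<omega> \<in> count_meas" if "\<omega> \<in> space M" for \<omega>
    using measurable_space[OF \<kappa> that] by simp
  then show "translate (T \<omega>) (\<kappa> \<omega>) \<in> count_meas" if "\<omega> \<in> space M" for \<omega>
    using that by (intro translate_in_count_meas)
  fix B :: "'a set" assume B[measurable]: "B \<in> sets borel"
  note T[measurable]
  have "(\<lambda>(\<omega>, x). indicator B (x - T \<omega>) :: ennreal) \<in> borel_measurable (M \<Otimes>\<^sub>M borel)"
    by measurable
  then have "(\<lambda>\<omega>. \<integral>\<^sup>+x. indicator B (x - T \<omega>) \<partial>\<kappa> \<omega>) \<in> borel_measurable M"
    by (rule measurable_nn_integral_kernel[OF \<kappa>])
  then show "(\<lambda>\<omega>. emeasure (translate (T \<omega>) (\<kappa> \<omega>)) B) \<in> borel_measurable M"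
  proof (rule measurable_cong[THEN iffD1, rotated])
    fix \<omega> assume \<omega>: "\<omega> \<in> space M"
    have "emeasure (translate (T \<omega>) (\<kappa> \<omega>)) B = (\<integral>\<^sup>+x. indicator B x \<partial>translate (T \<omega>) (\<kappa> \<omega>))"
      using B by simp
    also have "\<dots> = (\<integral>\<^sup>+x. indicator B (x - T \<omega>) \<partial>\<kappa> \<omega>)"
      using \<kappa>c[OF \<omega>] by (intro nn_integral_translate) auto
    finally show "(\<integral>\<^sup>+x. indicator B (x - T \<omega>) \<partial>\<kappa> \<omega>) = emeasure (translate (T \<omega>) (\<kappa> \<omega>)) B" by simp
  qed
qed

lemma sets_count_meas0[measurable]: "count_meas0 \<in> sets N_space"
proof -
  have "{\<phi> \<in> space N_space. 0 < emeasure \<phi> {0}} \<in> sets N_space" by measurable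
  then show ?thesis by (simp add: count_meas0_def points_def)
qed

text \<open>Simplicity is a condition on the points of the configuration only, and the number of points that
  violate it is the integral of a measurable function.\<close>
lemma sets_simple[measurable]:
  "{\<phi> \<in> (count_meas :: 'a::euclidean_space measure set). simple_meas \<phi>} \<in> sets N_space"
proof -
  let ?u = "\<lambda>(\<phi> :: 'a measure) x. indicator {1<..} (emeasure (translate x \<phi>) {0}) :: ennreal"
  have "(\<lambda>(\<phi>, x). ?u \<phi> x) \<in> borel_measurable (N_space \<Otimes>\<^sub>M borel)" by measurable
  then have "(\<lambda>\<phi>. \<integral>\<^sup>+x. ?u \<phi> x \<partial>\<phi>) \<in> borel_measurable N_space"
    by (intro measurable_nn_integral_kernel) auto
  then have "{\<phi> \<in> space N_space. (\<integral>\<^sup>+x. ?u \<phi> x \<partial>\<phi>) = 0} \<in> sets N_space" by measurable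
  also have "{\<phi> \<in> space N_space. (\<integral>\<^sup>+x. ?u \<phi> x \<partial>\<phi>) = 0} = {\<phi> \<in> count_meas. simple_meas \<phi>}"
  proof (intro Collect_cong conj_cong)
    fix \<phi> :: "'a measure" assume \<phi>: "\<phi> \<in> count_meas"
    have tr: "(\<lambda>x. x) \<in> borel_measurable \<phi>" "(\<lambda>_. \<phi>) \<in> measurable \<phi> N_space"
      using \<phi> by (auto simp: measurable_cong_sets[OF count_meas_sets[OF \<phi>] refl])
    have "?u \<phi> \<in> borel_measurable \<phi>"
      using measurable_compose[OF measurable_translate[OF tr] measurable_mass[of "{0}"]] by measurable
    then have "(\<integral>\<^sup>+x. ?u \<phi> x \<partial>\<phi>) = 0 \<longleftrightarrow> (AE x in \<phi>. ?u \<phi> x = 0)"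
      by (rule nn_integral_0_iff_AE)
    also have "\<dots> \<longleftrightarrow> (\<forall>x\<in>points \<phi>. emeasure \<phi> {x} \<le> 1)"
      unfolding AE_count_meas_iff[OF \<phi>]
      by (simp add: emeasure_translate_singleton[OF count_meas_sets[OF \<phi>]] indicator_eq_0_iff not_less)
    also have "\<dots> \<longleftrightarrow> simple_meas \<phi>"
      unfolding simple_meas_def points_def by (metis (mono_tags, lifting) linorder_not_less mem_Collect_eq not_gr_zero zero_le)
    finally show "(\<integral>\<^sup>+x. ?u \<phi> x \<partial>\<phi>) = 0 \<longleftrightarrow> simple_meas \<phi>" .
  qed simp
  finally show ?thesis .
qed

section \<open>Palm calculus\<close>

abbreviation unit_cube :: "'a::euclidean_space set" where
  "unit_cube \<equiv> cbox 0 One"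

lemma measurable_triple:
  assumes "(\<lambda>((\<omega>, t), s). u \<omega> t s) \<in> measurable ((A \<Otimes>\<^sub>M B) \<Otimes>\<^sub>M C) D"
    and "f \<in> measurable K A" "g \<in> measurable K B" "h \<in> measurable K C"
  shows "(\<lambda>x. u (f x) (g x) (h x)) \<in> measurable K D"
  using measurable_compose[OF measurable_Pair[OF measurable_Pair[OF assms(2,3)] assms(4)] assms(1)]
  by simp

lemma cbox_borel[measurable]: "cbox a b \<in> sets borel"
  by simp

lemma borel_measurable_pair_lborel:
  "borel_measurable (K \<Otimes>\<^sub>M (lborel :: 'a::euclidean_space measure)) = borel_measurable (K \<Otimes>\<^sub>M borel)"
  by (intro measurable_cong_sets sets_pair_measure_cong) auto

lemma borel_measurable_nn_integral_lborel:
  fixes u :: "'w \<Rightarrow> 'a::euclidean_space \<Rightarrow> ennreal"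
  assumes "(\<lambda>(\<omega>, s). u \<omega> s) \<in> borel_measurable (K \<Otimes>\<^sub>M borel)"
  shows "(\<lambda>\<omega>. \<integral>\<^sup>+s. u \<omega> s \<partial>lborel) \<in> borel_measurable K"
  by (rule sigma_finite_measure.borel_measurable_nn_integral[OF sigma_finite_lborel])
    (use assms in \<open>simp add: borel_measurable_pair_lborel\<close>)

lemma nn_integral_lborel_shift:
  fixes u :: "'a::euclidean_space \<Rightarrow> ennreal"
  assumes "u \<in> borel_measurable borel"
  shows "(\<integral>\<^sup>+s. u (t + s) \<partial>lborel) = (\<integral>\<^sup>+s. u s \<partial>lborel)"
proof -
  have "(\<integral>\<^sup>+s. u s \<partial>lborel) = (\<integral>\<^sup>+s. u s \<partial>distr lborel borel ((+) t))"
    by (simp add: lborel_distr_plus)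
  also have "\<dots> = (\<integral>\<^sup>+s. u (t + s) \<partial>lborel)"
    using assms by (intro nn_integral_distr) auto
  finally show ?thesis by simp
qed

lemma emeasure_unit_cube: "emeasure lborel (unit_cube :: 'a::euclidean_space set) = 1"
  by (simp add: emeasure_lborel_cbox_eq)

lemma nn_integral_unit_cube_shift:
  "(\<integral>\<^sup>+s. indicator unit_cube (t + s :: 'a::euclidean_space) \<partial>lborel) = 1"
  by (subst nn_integral_lborel_shift[of "indicator unit_cube"]) (simp_all add: emeasure_unit_cube)

locale stationary_process =
  fixes M :: "'w measure" and \<theta> :: "'a::euclidean_space \<Rightarrow> 'w \<Rightarrow> 'w" and \<Phi> :: "'w \<Rightarrow> 'a measure"
  assumes stationary: "stationary_point_process M \<theta> \<Phi>" and nondegenerate: "nondegenerate M \<Phi>"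
begin

lemma prob_M: "prob_space M"
  and flow_joint: "(\<lambda>(t, \<omega>). \<theta> t \<omega>) \<in> measurable (borel \<Otimes>\<^sub>M M) M"
  and flow_0: "\<omega> \<in> space M \<Longrightarrow> \<theta> 0 \<omega> = \<omega>"
  and flow_add: "\<omega> \<in> space M \<Longrightarrow> \<theta> s (\<theta> t \<omega>) = \<theta> (s + t) \<omega>"
  and flow_invariant: "distr M M (\<theta> t) = M"
  and \<Phi>_measurable[measurable]: "\<Phi> \<in> measurable M N_space"
  and \<Phi>_flow: "\<omega> \<in> space M \<Longrightarrow> \<Phi> (\<theta> t \<omega>) = translate t (\<Phi> \<omega>)"
  using stationary by (auto simp: stationary_point_process_def stationary_flow_def)

sublocale prob_space M by (rule prob_M)

lemma measurable_flow[measurable (raw)]: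
  assumes "T \<in> borel_measurable K" "W \<in> measurable K M"
  shows "(\<lambda>x. \<theta> (T x) (W x)) \<in> measurable K M"
  using measurable_compose[OF measurable_Pair[OF assms] flow_joint] by simp

lemma flow_measurable: "\<theta> t \<in> measurable M M"
  using measurable_flow[of "\<lambda>_. t" M "\<lambda>\<omega>. \<omega>"] by simp

lemma flow_space: "\<omega> \<in> space M \<Longrightarrow> \<theta> t \<omega> \<in> space M"
  using measurable_space[OF flow_measurable] .

lemma \<Phi>_count: "\<omega> \<in> space M \<Longrightarrow> \<Phi> \<omega> \<in> count_meas"
  using measurable_space[OF \<Phi>_measurable] by simp

lemma \<Phi>_sets[simp]: "\<omega> \<in> space M \<Longrightarrow> sets (\<Phi> \<omega>) = sets borel"
  using count_meas_sets[OF \<Phi>_count] .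

lemma borel_measurable_\<Phi>: "\<omega> \<in> space M \<Longrightarrow> borel_measurable (\<Phi> \<omega>) = borel_measurable borel"
  by (rule measurable_cong_sets) simp_all

lemma section_measurable:
  assumes "(\<lambda>(\<omega>, t). v \<omega> t) \<in> borel_measurable (M \<Otimes>\<^sub>M borel)" "\<omega> \<in> space M"
  shows "v \<omega> \<in> borel_measurable borel"
  using measurable_compose[OF measurable_Pair1'[OF assms(2)] assms(1)] by simp

lemma nn_integral_flow:
  assumes "H \<in> borel_measurable M"
  shows "(\<integral>\<^sup>+\<omega>. H (\<theta> s \<omega>) \<partial>M) = (\<integral>\<^sup>+\<omega>. H \<omega> \<partial>M)"
  using nn_integral_distr[OF flow_measurable[of s], of H] assms flow_invariant[of s] by simp

lemma \<Phi>_integral_measurable[measurable (raw)]: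
  assumes "W \<in> measurable K M" "(\<lambda>(\<omega>, t). v \<omega> t) \<in> borel_measurable (K \<Otimes>\<^sub>M borel)"
  shows "(\<lambda>\<omega>. \<integral>\<^sup>+t. v \<omega> t \<partial>\<Phi> (W \<omega>)) \<in> borel_measurable K"
  using assms by (intro measurable_nn_integral_kernel measurable_compose[OF _ \<Phi>_measurable])

text \<open>By the cocycle property of the flow, replacing \<open>\<omega>\<close> by \<open>\<theta> s \<omega>\<close> leaves the environments seen from the
  points unchanged and moves all locations by \<open>s\<close>.\<close>
lemma shift_invariance:
  assumes v: "(\<lambda>(\<omega>, t). v \<omega> t) \<in> borel_measurable (M \<Otimes>\<^sub>M borel)"
  shows "(\<integral>\<^sup>+\<omega>. \<integral>\<^sup>+t. v (\<theta> t \<omega>) (t + s) \<partial>\<Phi> \<omega> \<partial>M) = (\<integral>\<^sup>+\<omega>. \<integral>\<^sup>+t. v (\<theta> t \<omega>) t \<partial>\<Phi> \<omega> \<partial>M)"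
proof -
  note v[measurable]
  define H where "H \<omega> = (\<integral>\<^sup>+t. v (\<theta> t \<omega>) (t + s) \<partial>\<Phi> \<omega>)" for \<omega>
  have [measurable]: "H \<in> borel_measurable M" unfolding H_def by measurable
  have "(\<integral>\<^sup>+\<omega>. H \<omega> \<partial>M) = (\<integral>\<^sup>+\<omega>. H (\<theta> s \<omega>) \<partial>M)"
    by (simp add: nn_integral_flow)
  also have "\<dots> = (\<integral>\<^sup>+\<omega>. \<integral>\<^sup>+t. v (\<theta> t \<omega>) t \<partial>\<Phi> \<omega> \<partial>M)"
  proof (rule nn_integral_cong)
    fix \<omega> assume \<omega>[measurable]: "\<omega> \<in> space M"
    have "(\<lambda>t. v (\<theta> t (\<theta> s \<omega>)) (t + s)) \<in> borel_measurable borel"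
      using flow_space[OF \<omega>] by measurable
    then have "H (\<theta> s \<omega>) = (\<integral>\<^sup>+t. v (\<theta> (t - s) (\<theta> s \<omega>)) (t - s + s) \<partial>\<Phi> \<omega>)"
      unfolding H_def by (simp add: \<Phi>_flow \<omega> nn_integral_translate)
    then show "H (\<theta> s \<omega>) = (\<integral>\<^sup>+t. v (\<theta> t \<omega>) t \<partial>\<Phi> \<omega>)"
      by (simp add: flow_add \<omega>)
  qed
  finally show ?thesis by (simp add: H_def)
qed

lemma fubini_\<Phi>_lborel:
  fixes u :: "'w \<Rightarrow> 'a \<Rightarrow> 'a \<Rightarrow> ennreal"
  assumes u: "(\<lambda>((\<omega>, t), s). u \<omega> t s) \<in> borel_measurable ((M \<Otimes>\<^sub>M borel) \<Otimes>\<^sub>M borel)"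
    and \<omega>: "\<omega> \<in> space M"
  shows "(\<integral>\<^sup>+t. \<integral>\<^sup>+s. u \<omega> t s \<partial>lborel \<partial>\<Phi> \<omega>) = (\<integral>\<^sup>+s. \<integral>\<^sup>+t. u \<omega> t s \<partial>\<Phi> \<omega> \<partial>lborel)"
proof -
  interpret P: sigma_finite_measure "\<Phi> \<omega>" by (rule count_meas_sigma_finite[OF \<Phi>_count[OF \<omega>]])
  interpret PL: pair_sigma_finite "\<Phi> \<omega>" "lborel :: 'a measure" ..
  have "(\<lambda>x. u \<omega> (fst x) (snd x)) \<in> borel_measurable (borel \<Otimes>\<^sub>M borel)"
    using \<omega> by (intro measurable_triple[OF u]) auto
  then have "(\<lambda>(t, s). u \<omega> t s) \<in> borel_measurable (borel \<Otimes>\<^sub>M borel)"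
    by (simp add: case_prod_beta')
  moreover have "borel_measurable (\<Phi> \<omega> \<Otimes>\<^sub>M (lborel :: 'a measure)) =
      (borel_measurable (borel \<Otimes>\<^sub>M borel) :: ('a \<times> 'a \<Rightarrow> ennreal) set)"
    using \<omega> by (intro measurable_cong_sets sets_pair_measure_cong) auto
  ultimately show ?thesis
    by (intro PL.Fubini'[symmetric]) simp
qed

lemma fubini_campbell:
  fixes u :: "'w \<Rightarrow> 'a \<Rightarrow> 'a \<Rightarrow> ennreal"
  assumes u: "(\<lambda>((\<omega>, t), s). u \<omega> t s) \<in> borel_measurable ((M \<Otimes>\<^sub>M borel) \<Otimes>\<^sub>M borel)"
  shows "(\<integral>\<^sup>+\<omega>. \<integral>\<^sup>+t. \<integral>\<^sup>+s. u \<omega> t s \<partial>lborel \<partial>\<Phi> \<omega> \<partial>M) = (\<integral>\<^sup>+s. \<integral>\<^sup>+\<omega>. \<integral>\<^sup>+t. u \<omega> t s \<partial>\<Phi> \<omega> \<partial>M \<partial>lborel)"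
proof -
  interpret pair_sigma_finite M "lborel :: 'a measure" ..
  have um: "(\<lambda>(\<omega>, s). \<integral>\<^sup>+t. u \<omega> t s \<partial>\<Phi> \<omega>) \<in> borel_measurable (M \<Otimes>\<^sub>M lborel)"
    unfolding case_prod_beta' borel_measurable_pair_lborel
  proof (rule \<Phi>_integral_measurable)
    show "(\<lambda>(x, t). u (fst x) t (snd x)) \<in> borel_measurable ((M \<Otimes>\<^sub>M borel) \<Otimes>\<^sub>M borel)"
      unfolding case_prod_beta' by (intro measurable_triple[OF u]) measurable
  qed measurable
  have "(\<integral>\<^sup>+\<omega>. \<integral>\<^sup>+t. \<integral>\<^sup>+s. u \<omega> t s \<partial>lborel \<partial>\<Phi> \<omega> \<partial>M) = (\<integral>\<^sup>+\<omega>. \<integral>\<^sup>+s. \<integral>\<^sup>+t. u \<omega> t s \<partial>\<Phi> \<omega> \<partial>lborel \<partial>M)"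
    by (intro nn_integral_cong fubini_\<Phi>_lborel u)
  also have "\<dots> = (\<integral>\<^sup>+s. \<integral>\<^sup>+\<omega>. \<integral>\<^sup>+t. u \<omega> t s \<partial>\<Phi> \<omega> \<partial>M \<partial>lborel)"
    by (rule Fubini'[OF um, symmetric])
  finally show ?thesis .
qed

text \<open>Averaging the location over a unit cube with Lebesgue measure and moving the average from the
  weight to the function by shift invariance replaces the location of the point by an independent
  Lebesgue variable.\<close>
lemma campbell_unit_cube:
  assumes u: "(\<lambda>(\<omega>, t). u \<omega> t) \<in> borel_measurable (M \<Otimes>\<^sub>M borel)"
  shows "(\<integral>\<^sup>+\<omega>. \<integral>\<^sup>+t. u (\<theta> t \<omega>) t \<partial>\<Phi> \<omega> \<partial>M) =
    (\<integral>\<^sup>+\<omega>. \<integral>\<^sup>+t. indicator unit_cube t * (\<integral>\<^sup>+s. u (\<theta> t \<omega>) s \<partial>lborel) \<partial>\<Phi> \<omega> \<partial>M)"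
proof -
  note u[measurable]
  \<comment> \<open>The translation \<open>s\<close> is averaged over the reflected cube, since it ends up as \<open>s - t\<close> in the weight.\<close>
  let ?D = "cbox (- One) 0 :: 'a set"
  let ?I = "\<integral>\<^sup>+\<omega>. \<integral>\<^sup>+t. u (\<theta> t \<omega>) t \<partial>\<Phi> \<omega> \<partial>M"
  have D: "indicator ?D (- t) = (indicator unit_cube t :: ennreal)" for t
    by (auto simp: indicator_def mem_box)
  have D1: "emeasure lborel ?D = 1" by (simp add: emeasure_lborel_cbox_eq)
  have "?I = (\<integral>\<^sup>+s. indicator ?D s * ?I \<partial>lborel)"
    by (simp add: nn_integral_multc D1)
  also have "\<dots> = (\<integral>\<^sup>+s. indicator ?D s * (\<integral>\<^sup>+\<omega>. \<integral>\<^sup>+t. u (\<theta> t \<omega>) (t + s) \<partial>\<Phi> \<omega> \<partial>M) \<partial>lborel)"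
    by (simp add: shift_invariance[OF u])
  also have "\<dots> = (\<integral>\<^sup>+s. (\<integral>\<^sup>+\<omega>. \<integral>\<^sup>+t. indicator ?D s * u (\<theta> t \<omega>) (t + s) \<partial>\<Phi> \<omega> \<partial>M) \<partial>lborel)"
    by (intro nn_integral_cong, subst nn_integral_cmult[symmetric], measurable,
        intro nn_integral_cong nn_integral_cmult[symmetric], simp add: borel_measurable_\<Phi>)
  also have "\<dots> = (\<integral>\<^sup>+\<omega>. \<integral>\<^sup>+t. \<integral>\<^sup>+s. indicator ?D s * u (\<theta> t \<omega>) (t + s) \<partial>lborel \<partial>\<Phi> \<omega> \<partial>M)"
    by (rule fubini_campbell[symmetric], unfold case_prod_beta', measurable)
  also have "\<dots> = (\<integral>\<^sup>+\<omega>. \<integral>\<^sup>+t. \<integral>\<^sup>+s. indicator ?D (s - t) * u (\<theta> t \<omega>) s \<partial>lborel \<partial>\<Phi> \<omega> \<partial>M)"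
  proof (rule nn_integral_cong, rule nn_integral_cong)
    fix \<omega> and t :: 'a assume \<omega>[measurable]: "\<omega> \<in> space M"
    have "(\<lambda>s. indicator ?D (s - t) * u (\<theta> t \<omega>) s) \<in> borel_measurable borel"
      using flow_space[OF \<omega>] by measurable
    from nn_integral_lborel_shift[OF this, of t]
    show "(\<integral>\<^sup>+s. indicator ?D s * u (\<theta> t \<omega>) (t + s) \<partial>lborel) =
        (\<integral>\<^sup>+s. indicator ?D (s - t) * u (\<theta> t \<omega>) s \<partial>lborel)" by simp
  qed
  also have "\<dots> = (\<integral>\<^sup>+s. \<integral>\<^sup>+\<omega>. \<integral>\<^sup>+t. indicator ?D (s - t) * u (\<theta> t \<omega>) s \<partial>\<Phi> \<omega> \<partial>M \<partial>lborel)"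
    by (rule fubini_campbell, unfold case_prod_beta', measurable)
  also have "\<dots> = (\<integral>\<^sup>+s. \<integral>\<^sup>+\<omega>. \<integral>\<^sup>+t. indicator unit_cube t * u (\<theta> t \<omega>) s \<partial>\<Phi> \<omega> \<partial>M \<partial>lborel)"
  proof (rule nn_integral_cong)
    fix s :: 'a
    have "(\<lambda>(\<omega>, t). indicator ?D (- t) * u \<omega> s) \<in> borel_measurable (M \<Otimes>\<^sub>M borel)" by measurable
    from shift_invariance[OF this, of "- s"]
    show "(\<integral>\<^sup>+\<omega>. \<integral>\<^sup>+t. indicator ?D (s - t) * u (\<theta> t \<omega>) s \<partial>\<Phi> \<omega> \<partial>M) =
        (\<integral>\<^sup>+\<omega>. \<integral>\<^sup>+t. indicator unit_cube t * u (\<theta> t \<omega>) s \<partial>\<Phi> \<omega> \<partial>M)"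
      by (simp add: D)
  qed
  also have "\<dots> = (\<integral>\<^sup>+\<omega>. \<integral>\<^sup>+t. \<integral>\<^sup>+s. indicator unit_cube t * u (\<theta> t \<omega>) s \<partial>lborel \<partial>\<Phi> \<omega> \<partial>M)"
    by (rule fubini_campbell[symmetric], unfold case_prod_beta', measurable)
  also have "\<dots> = (\<integral>\<^sup>+\<omega>. \<integral>\<^sup>+t. indicator unit_cube t * (\<integral>\<^sup>+s. u (\<theta> t \<omega>) s \<partial>lborel) \<partial>\<Phi> \<omega> \<partial>M)"
    using flow_space section_measurable[OF u]
    by (intro nn_integral_cong nn_integral_cmult) auto
  finally show ?thesis .
qed


lemma intensity_pos: "intensity M \<Phi> \<noteq> 0" and intensity_finite: "intensity M \<Phi> \<noteq> \<infinity>"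
  using nondegenerate by (auto simp: nondegenerate_def)

definition cube_functional :: "('w \<Rightarrow> ennreal) \<Rightarrow> ennreal" where
  "cube_functional u = (\<integral>\<^sup>+\<omega>. \<integral>\<^sup>+t. indicator unit_cube t * u (\<theta> t \<omega>) \<partial>\<Phi> \<omega> \<partial>M)"

lemma cube_functional_cong: "(\<And>\<omega>. \<omega> \<in> space M \<Longrightarrow> u \<omega> = v \<omega>) \<Longrightarrow> cube_functional u = cube_functional v"
  unfolding cube_functional_def by (intro nn_integral_cong) (simp add: flow_space)

lemma section_flow_measurable[simp]:
  assumes [measurable]: "u \<in> borel_measurable M" and \<omega>[measurable]: "\<omega> \<in> space M"
  shows "(\<lambda>t. u (\<theta> t \<omega>)) \<in> borel_measurable (\<Phi> \<omega>)"
  unfolding borel_measurable_\<Phi>[OF \<omega>] by measurable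

lemma section_cube_measurable[simp]:
  fixes u :: "'w \<Rightarrow> ennreal"
  assumes [measurable]: "u \<in> borel_measurable M" and \<omega>[measurable]: "\<omega> \<in> space M"
  shows "(\<lambda>t. indicator unit_cube t * u (\<theta> t \<omega>)) \<in> borel_measurable (\<Phi> \<omega>)"
  using section_flow_measurable[OF assms] unfolding borel_measurable_\<Phi>[OF \<omega>]
  by (intro borel_measurable_times_ennreal borel_measurable_indicator) auto

lemma cube_functional_cmult:
  assumes [measurable]: "u \<in> borel_measurable M"
  shows "cube_functional (\<lambda>\<omega>. c * u \<omega>) = c * cube_functional u"
proof -
  have "cube_functional (\<lambda>\<omega>. c * u \<omega>) =
      (\<integral>\<^sup>+\<omega>. \<integral>\<^sup>+t. c * (indicator unit_cube t * u (\<theta> t \<omega>)) \<partial>\<Phi> \<omega> \<partial>M)"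
    unfolding cube_functional_def by (simp add: mult_ac)
  also have "\<dots> = (\<integral>\<^sup>+\<omega>. c * (\<integral>\<^sup>+t. indicator unit_cube t * u (\<theta> t \<omega>) \<partial>\<Phi> \<omega>) \<partial>M)"
    by (intro nn_integral_cong nn_integral_cmult) simp
  also have "\<dots> = c * cube_functional u"
    unfolding cube_functional_def by (intro nn_integral_cmult) measurable
  finally show ?thesis .
qed

lemma cube_functional_suminf:
  assumes [measurable]: "\<And>i. u i \<in> borel_measurable M"
  shows "cube_functional (\<lambda>\<omega>. \<Sum>i. u i \<omega>) = (\<Sum>i. cube_functional (u i))"
proof -
  have "cube_functional (\<lambda>\<omega>. \<Sum>i. u i \<omega>) =
      (\<integral>\<^sup>+\<omega>. \<integral>\<^sup>+t. (\<Sum>i. indicator unit_cube t * u i (\<theta> t \<omega>)) \<partial>\<Phi> \<omega> \<partial>M)"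
    unfolding cube_functional_def by (simp add: ennreal_suminf_cmult)
  also have "\<dots> = (\<integral>\<^sup>+\<omega>. (\<Sum>i. \<integral>\<^sup>+t. indicator unit_cube t * u i (\<theta> t \<omega>) \<partial>\<Phi> \<omega>) \<partial>M)"
    by (intro nn_integral_cong nn_integral_suminf) simp
  also have "\<dots> = (\<Sum>i. cube_functional (u i))"
    unfolding cube_functional_def by (intro nn_integral_suminf) measurable
  finally show ?thesis .
qed

lemma cube_functional_add:
  assumes [measurable]: "u \<in> borel_measurable M" "v \<in> borel_measurable M"
  shows "cube_functional (\<lambda>\<omega>. u \<omega> + v \<omega>) = cube_functional u + cube_functional v"
proof -
  have "cube_functional (\<lambda>\<omega>. u \<omega> + v \<omega>) =
      (\<integral>\<^sup>+\<omega>. \<integral>\<^sup>+t. (indicator unit_cube t * u (\<theta> t \<omega>) + indicator unit_cube t * v (\<theta> t \<omega>)) \<partial>\<Phi> \<omega> \<partial>M)"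
    unfolding cube_functional_def by (simp add: distrib_left)
  also have "\<dots> = (\<integral>\<^sup>+\<omega>. (\<integral>\<^sup>+t. indicator unit_cube t * u (\<theta> t \<omega>) \<partial>\<Phi> \<omega>) +
      (\<integral>\<^sup>+t. indicator unit_cube t * v (\<theta> t \<omega>) \<partial>\<Phi> \<omega>) \<partial>M)"
    by (intro nn_integral_cong nn_integral_add) simp_all
  also have "\<dots> = cube_functional u + cube_functional v"
    unfolding cube_functional_def by (intro nn_integral_add) measurable
  finally show ?thesis .
qed

lemma cube_functional_SUP:
  assumes [measurable]: "\<And>i. u i \<in> borel_measurable M" and inc: "incseq u"
  shows "cube_functional (\<lambda>\<omega>. SUP i. u i \<omega>) = (SUP i. cube_functional (u i))"
proof -
  have mono: "u i \<omega> \<le> u j \<omega>" if "i \<le> j" for i j \<omega>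
    using inc that by (auto simp: incseq_def le_fun_def)
  have "cube_functional (\<lambda>\<omega>. SUP i. u i \<omega>) =
      (\<integral>\<^sup>+\<omega>. \<integral>\<^sup>+t. (SUP i. indicator unit_cube t * u i (\<theta> t \<omega>)) \<partial>\<Phi> \<omega> \<partial>M)"
    unfolding cube_functional_def by (simp add: SUP_mult_left_ennreal)
  also have "\<dots> = (\<integral>\<^sup>+\<omega>. (SUP i. \<integral>\<^sup>+t. indicator unit_cube t * u i (\<theta> t \<omega>) \<partial>\<Phi> \<omega>) \<partial>M)"
    by (intro nn_integral_cong nn_integral_monotone_convergence_SUP)
      (auto simp: incseq_def le_fun_def intro!: mult_left_mono mono)
  also have "\<dots> = (SUP i. cube_functional (u i))"
    unfolding cube_functional_def
    by (intro nn_integral_monotone_convergence_SUP)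
      (auto simp: incseq_def le_fun_def intro!: nn_integral_mono mult_left_mono mono)
  finally show ?thesis .
qed

definition palm :: "'w measure" where
  "palm = measure_of (space M) (sets M) (\<lambda>A. cube_functional (indicator A) / intensity M \<Phi>)"

lemma sets_palm[measurable_cong, simp]: "sets palm = sets M"
  by (simp add: palm_def)

lemma space_palm[simp]: "space palm = space M"
  by (simp add: palm_def)

lemma emeasure_palm:
  assumes "A \<in> sets M"
  shows "emeasure palm A = cube_functional (indicator A) / intensity M \<Phi>"
  unfolding palm_def
proof (rule emeasure_measure_of_sigma)
  show "sigma_algebra (space M) (sets M)" by (rule sets.sigma_algebra_axioms)
  show "positive (sets M) (\<lambda>A. cube_functional (indicator A) / intensity M \<Phi>)"
    by (simp add: positive_def cube_functional_def)
  show "countably_additive (sets M) (\<lambda>A. cube_functional (indicator A) / intensity M \<Phi>)"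
  proof (rule countably_additiveI)
    fix A :: "nat \<Rightarrow> 'w set" assume A: "range A \<subseteq> sets M" "disjoint_family A"
    have "cube_functional (indicator (\<Union>(range A))) = cube_functional (\<lambda>\<omega>. \<Sum>i. indicator (A i) \<omega>)"
      by (intro cube_functional_cong suminf_indicator[symmetric] A)
    also have "\<dots> = (\<Sum>i. cube_functional (indicator (A i)))"
      using A by (intro cube_functional_suminf) auto
    finally show "(\<Sum>i. cube_functional (indicator (A i)) / intensity M \<Phi>) =
        cube_functional (indicator (\<Union>(range A))) / intensity M \<Phi>"
      by (simp add: divide_ennreal_def)
  qed
qed fact

lemma nn_integral_palm:
  assumes "u \<in> borel_measurable M"
  shows "(\<integral>\<^sup>+\<omega>. u \<omega> \<partial>palm) = cube_functional u / intensity M \<Phi>"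
  using assms
proof (induction rule: borel_measurable_induct)
  case (cong f g)
  have "(\<integral>\<^sup>+\<omega>. f \<omega> \<partial>palm) = (\<integral>\<^sup>+\<omega>. g \<omega> \<partial>palm)"
    using cong(3) by (intro nn_integral_cong) simp
  then show ?case using cong cube_functional_cong[of f g] by simp
next
  case (set A)
  then show ?case by (simp add: emeasure_palm)
next
  case (mult u c)
  then show ?case by (simp add: nn_integral_cmult cube_functional_cmult ennreal_times_divide)
next
  case (add u v)
  then show ?case
    by (simp add: nn_integral_add cube_functional_add divide_ennreal_def distrib_right)
next
  case (seq U)
  then have "(\<integral>\<^sup>+\<omega>. (SUP i. U i \<omega>) \<partial>palm) = (SUP i. cube_functional (U i) / intensity M \<Phi>)"
    by (simp add: nn_integral_monotone_convergence_SUP)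
  also have "\<dots> = cube_functional (\<lambda>\<omega>. SUP i. U i \<omega>) / intensity M \<Phi>"
    using seq by (simp add: cube_functional_SUP divide_ennreal_def SUP_mult_right_ennreal)
  finally show ?case by (simp add: SUP_apply[abs_def])
qed

text \<open>The refined Campbell formula: the averaged functional on the right-hand side of
  \<open>campbell_unit_cube\<close> is, up to the factor \<open>intensity M \<Phi>\<close>, integration against \<open>palm\<close>.\<close>
theorem campbell:
  assumes u[measurable]: "(\<lambda>(\<omega>, t). u \<omega> t) \<in> borel_measurable (M \<Otimes>\<^sub>M borel)"
  shows "(\<integral>\<^sup>+\<omega>. \<integral>\<^sup>+t. u (\<theta> t \<omega>) t \<partial>\<Phi> \<omega> \<partial>M) = intensity M \<Phi> * (\<integral>\<^sup>+\<omega>. \<integral>\<^sup>+s. u \<omega> s \<partial>lborel \<partial>palm)"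
proof -
  have "(\<integral>\<^sup>+\<omega>. \<integral>\<^sup>+s. u \<omega> s \<partial>lborel \<partial>palm) =
      cube_functional (\<lambda>\<omega>. \<integral>\<^sup>+s. u \<omega> s \<partial>lborel) / intensity M \<Phi>"
    by (intro nn_integral_palm borel_measurable_nn_integral_lborel u)
  then show ?thesis
    unfolding cube_functional_def campbell_unit_cube[OF u]
    using intensity_pos intensity_finite
    by (simp add: ennreal_times_divide_cancel)
qed

lemma prob_space_palm: "prob_space palm"
proof
  have "cube_functional (indicator (space M)) = intensity M \<Phi>"
    unfolding cube_functional_def intensity_def
  proof (rule nn_integral_cong)
    fix \<omega> assume \<omega>: "\<omega> \<in> space M"
    have "(\<integral>\<^sup>+t. indicator unit_cube t * indicator (space M) (\<theta> t \<omega>) \<partial>\<Phi> \<omega>) =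
        (\<integral>\<^sup>+t. indicator unit_cube t \<partial>\<Phi> \<omega>)"
      using flow_space[OF \<omega>] by (intro nn_integral_cong) simp
    then show "(\<integral>\<^sup>+t. indicator unit_cube t * indicator (space M) (\<theta> t \<omega>) \<partial>\<Phi> \<omega>) =
        emeasure (\<Phi> \<omega>) unit_cube" using \<omega> by simp
  qed
  then show "emeasure palm (space palm) = 1"
    using intensity_pos intensity_finite by (simp add: emeasure_palm less_top)
qed

end

text \<open>The formula for a single window, for instance the unit cube, determines the measure.\<close>
lemma palm_prob_eqI:
  fixes \<Psi> :: "'w \<Rightarrow> 'a::euclidean_space measure"
  assumes sets: "sets Q = sets M"
    and eq: "\<And>A B. A \<in> sets M \<Longrightarrow> B \<in> sets borel \<Longrightarrow> 0 < emeasure lborel B \<Longrightarrow> emeasure lborel B < \<infinity> \<Longrightarrow>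
      emeasure Q A = (\<integral>\<^sup>+\<omega>. (\<integral>\<^sup>+t\<in>B. indicator A (\<theta> t \<omega>) \<partial>\<Psi> \<omega>) \<partial>M) / (intensity M \<Psi> * emeasure lborel B)"
  shows "palm_prob M \<theta> \<Psi> = Q"
  unfolding palm_prob_def
proof (rule the_equality)
  fix Q' assume Q': "sets Q' = sets M \<and> (\<forall>A\<in>sets M. \<forall>B\<in>sets borel. 0 < emeasure lborel B \<and> emeasure lborel B < \<infinity> \<longrightarrow>
    emeasure Q' A = (\<integral>\<^sup>+\<omega>. (\<integral>\<^sup>+t\<in>B. indicator A (\<theta> t \<omega>) \<partial>\<Psi> \<omega>) \<partial>M) / (intensity M \<Psi> * emeasure lborel B))"
  show "Q' = Q"
  proof (rule measure_eqI)
    fix A assume "A \<in> sets Q'"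
    then have A: "A \<in> sets M" using Q' by simp
    have B: "(unit_cube :: 'a set) \<in> sets borel" "0 < emeasure lborel (unit_cube :: 'a set)"
      "emeasure lborel (unit_cube :: 'a set) < \<infinity>"
      unfolding emeasure_unit_cube by simp_all
    show "emeasure Q' A = emeasure Q A"
      using Q' A B by (subst eq[OF A B]) blast
  qed (simp add: Q' sets)
next
  show "sets Q = sets M \<and> (\<forall>A\<in>sets M. \<forall>B\<in>sets borel. 0 < emeasure lborel B \<and> emeasure lborel B < \<infinity> \<longrightarrow>
    emeasure Q A = (\<integral>\<^sup>+\<omega>. (\<integral>\<^sup>+t\<in>B. indicator A (\<theta> t \<omega>) \<partial>\<Psi> \<omega>) \<partial>M) / (intensity M \<Psi> * emeasure lborel B))"
    using sets eq by blast
qed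

context stationary_process
begin

lemma palm_prob_\<Phi>: "palm_prob M \<theta> \<Phi> = palm"
proof (rule palm_prob_eqI)
  fix A and B :: "'a set" assume [measurable]: "A \<in> sets M" "B \<in> sets borel"
    and B: "0 < emeasure lborel B" "emeasure lborel B < \<infinity>"
  have "(\<integral>\<^sup>+\<omega>. (\<integral>\<^sup>+t\<in>B. indicator A (\<theta> t \<omega>) \<partial>\<Phi> \<omega>) \<partial>M) =
      intensity M \<Phi> * (\<integral>\<^sup>+\<omega>. \<integral>\<^sup>+s. indicator A \<omega> * indicator B s \<partial>lborel \<partial>palm)"
    by (rule campbell) measurable
  also have "(\<integral>\<^sup>+\<omega>. \<integral>\<^sup>+s. indicator A \<omega> * indicator B s \<partial>lborel \<partial>palm) =
      (\<integral>\<^sup>+\<omega>. indicator A \<omega> * emeasure lborel B \<partial>palm)"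
    by (intro nn_integral_cong, subst nn_integral_cmult) auto
  also have "\<dots> = emeasure palm A * emeasure lborel B"
    by (subst nn_integral_multc) auto
  finally have eq: "(\<integral>\<^sup>+\<omega>. (\<integral>\<^sup>+t\<in>B. indicator A (\<theta> t \<omega>) \<partial>\<Phi> \<omega>) \<partial>M) =
      emeasure palm A * (intensity M \<Phi> * emeasure lborel B)"
    by (simp add: mult_ac)
  show "emeasure palm A = (\<integral>\<^sup>+\<omega>. (\<integral>\<^sup>+t\<in>B. indicator A (\<theta> t \<omega>) \<partial>\<Phi> \<omega>) \<partial>M) / (intensity M \<Phi> * emeasure lborel B)"
    unfolding eq using B intensity_pos intensity_finite
    by (intro ennreal_mult_divide_eq[symmetric]) (auto simp: ennreal_mult_eq_top_iff)
qed simp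

text \<open>The mass transport principle: the mean mass sent out by a typical point equals the mean mass
  that it receives. In the doubly indexed sum over points, the cube which restricts the location of the
  sender can be transferred to the receiver by the Campbell formula.\<close>
theorem mass_transport:
  assumes g[measurable]: "(\<lambda>(\<omega>, x). g \<omega> x) \<in> borel_measurable (M \<Otimes>\<^sub>M borel)"
  shows "(\<integral>\<^sup>+\<omega>. \<integral>\<^sup>+x. g \<omega> x \<partial>\<Phi> \<omega> \<partial>palm) = (\<integral>\<^sup>+\<omega>. \<integral>\<^sup>+x. g (\<theta> x \<omega>) (- x) \<partial>\<Phi> \<omega> \<partial>palm)"
proof -
  \<comment> \<open>The mass received at \<open>s\<close> from senders \<open>s + r\<close> in the unit cube, as a function of the environment at \<open>s\<close>.\<close>
  define u where "u \<omega> s = (\<integral>\<^sup>+r. indicator unit_cube (s + r) * g (\<theta> r \<omega>) (- r) \<partial>\<Phi> \<omega>)" for \<omega> s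
  have um[measurable]: "(\<lambda>(\<omega>, s). u \<omega> s) \<in> borel_measurable (M \<Otimes>\<^sub>M borel)"
    unfolding u_def by measurable
  have "intensity M \<Phi> * (\<integral>\<^sup>+\<omega>. \<integral>\<^sup>+x. g \<omega> x \<partial>\<Phi> \<omega> \<partial>palm) = cube_functional (\<lambda>\<omega>. \<integral>\<^sup>+x. g \<omega> x \<partial>\<Phi> \<omega>)"
    using intensity_pos intensity_finite
    by (subst nn_integral_palm) (measurable, simp add: ennreal_times_divide_cancel)
  also have "\<dots> = (\<integral>\<^sup>+\<omega>. \<integral>\<^sup>+t. \<integral>\<^sup>+s. indicator unit_cube t * g (\<theta> t \<omega>) (s - t) \<partial>\<Phi> \<omega> \<partial>\<Phi> \<omega> \<partial>M)"
    unfolding cube_functional_def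
  proof (rule nn_integral_cong, rule nn_integral_cong)
    fix \<omega> and t :: 'a assume \<omega>[measurable]: "\<omega> \<in> space M"
    have gm: "g (\<theta> t \<omega>) \<in> borel_measurable borel"
      by (rule section_measurable[OF g flow_space[OF \<omega>]])
    have "(\<integral>\<^sup>+x. g (\<theta> t \<omega>) x \<partial>\<Phi> (\<theta> t \<omega>)) = (\<integral>\<^sup>+s. g (\<theta> t \<omega>) (s - t) \<partial>\<Phi> \<omega>)"
      using gm by (simp add: \<Phi>_flow \<omega> nn_integral_translate)
    also have "indicator unit_cube t * \<dots> = (\<integral>\<^sup>+s. indicator unit_cube t * g (\<theta> t \<omega>) (s - t) \<partial>\<Phi> \<omega>)"
      using gm by (intro nn_integral_cmult[symmetric]) (simp add: borel_measurable_\<Phi> \<omega>)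
    finally show "indicator unit_cube t * (\<integral>\<^sup>+x. g (\<theta> t \<omega>) x \<partial>\<Phi> (\<theta> t \<omega>)) =
        (\<integral>\<^sup>+s. indicator unit_cube t * g (\<theta> t \<omega>) (s - t) \<partial>\<Phi> \<omega>)" .
  qed
  also have "\<dots> = (\<integral>\<^sup>+\<omega>. \<integral>\<^sup>+s. u (\<theta> s \<omega>) s \<partial>\<Phi> \<omega> \<partial>M)"
  proof (rule nn_integral_cong)
    fix \<omega> assume \<omega>[measurable]: "\<omega> \<in> space M"
    interpret P: sigma_finite_measure "\<Phi> \<omega>" by (rule count_meas_sigma_finite[OF \<Phi>_count[OF \<omega>]])
    interpret PP: pair_sigma_finite "\<Phi> \<omega>" "\<Phi> \<omega>" ..
    have "(\<lambda>(t, s). indicator unit_cube t * g (\<theta> t \<omega>) (s - t)) \<in> borel_measurable (borel \<Otimes>\<^sub>M borel)"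
      by measurable
    moreover have "borel_measurable (\<Phi> \<omega> \<Otimes>\<^sub>M \<Phi> \<omega>) =
        (borel_measurable (borel \<Otimes>\<^sub>M borel) :: ('a \<times> 'a \<Rightarrow> ennreal) set)"
      using \<omega> by (intro measurable_cong_sets sets_pair_measure_cong) auto
    ultimately have "(\<integral>\<^sup>+t. \<integral>\<^sup>+s. indicator unit_cube t * g (\<theta> t \<omega>) (s - t) \<partial>\<Phi> \<omega> \<partial>\<Phi> \<omega>) =
        (\<integral>\<^sup>+s. \<integral>\<^sup>+t. indicator unit_cube t * g (\<theta> t \<omega>) (s - t) \<partial>\<Phi> \<omega> \<partial>\<Phi> \<omega>)"
      by (intro PP.Fubini'[symmetric]) simp
    also have "\<dots> = (\<integral>\<^sup>+s. u (\<theta> s \<omega>) s \<partial>\<Phi> \<omega>)"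
    proof (rule nn_integral_cong)
      fix s :: 'a
      have "(\<lambda>r. indicator unit_cube (s + r) * g (\<theta> r (\<theta> s \<omega>)) (- r)) \<in> borel_measurable borel"
        using flow_space[OF \<omega>] by measurable
      then show "(\<integral>\<^sup>+t. indicator unit_cube t * g (\<theta> t \<omega>) (s - t) \<partial>\<Phi> \<omega>) = u (\<theta> s \<omega>) s"
        unfolding u_def by (simp add: \<Phi>_flow \<omega> nn_integral_translate flow_add)
    qed
    finally show "(\<integral>\<^sup>+t. \<integral>\<^sup>+s. indicator unit_cube t * g (\<theta> t \<omega>) (s - t) \<partial>\<Phi> \<omega> \<partial>\<Phi> \<omega>) =
        (\<integral>\<^sup>+s. u (\<theta> s \<omega>) s \<partial>\<Phi> \<omega>)" .
  qed
  also have "\<dots> = intensity M \<Phi> * (\<integral>\<^sup>+\<omega>. \<integral>\<^sup>+s. u \<omega> s \<partial>lborel \<partial>palm)"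
    by (rule campbell[OF um])
  also have "(\<integral>\<^sup>+\<omega>. \<integral>\<^sup>+s. u \<omega> s \<partial>lborel \<partial>palm) = (\<integral>\<^sup>+\<omega>. \<integral>\<^sup>+x. g (\<theta> x \<omega>) (- x) \<partial>\<Phi> \<omega> \<partial>palm)"
  proof (rule nn_integral_cong)
    fix \<omega> assume "\<omega> \<in> space palm"
    then have \<omega>[measurable]: "\<omega> \<in> space M" by simp
    have "(\<integral>\<^sup>+s. u \<omega> s \<partial>lborel) =
        (\<integral>\<^sup>+r. \<integral>\<^sup>+s. indicator unit_cube (s + r) * g (\<theta> r \<omega>) (- r) \<partial>lborel \<partial>\<Phi> \<omega>)"
      unfolding u_def by (rule fubini_\<Phi>_lborel[symmetric, OF _ \<omega>], unfold case_prod_beta', measurable)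
    also have "\<dots> = (\<integral>\<^sup>+r. g (\<theta> r \<omega>) (- r) \<partial>\<Phi> \<omega>)"
      by (intro nn_integral_cong, subst nn_integral_multc)
        (auto simp: add.commute nn_integral_unit_cube_shift)
    finally show "(\<integral>\<^sup>+s. u \<omega> s \<partial>lborel) = (\<integral>\<^sup>+x. g (\<theta> x \<omega>) (- x) \<partial>\<Phi> \<omega>)" .
  qed
  finally show ?thesis
    using intensity_pos intensity_finite by (simp add: ennreal_mult_cancel_left)
qed

text \<open>A property of the typical point holds for all points: under \<open>M\<close>, the mean number of exceptional
  points is computed by the Campbell formula, and under \<open>palm\<close>, the exceptional points are counted from the
  receiving end by letting every exceptional point receive mass one from every point.\<close>
lemma AE_points_of_AE_palm:
  assumes P: "{\<omega> \<in> space M. P \<omega>} \<in> sets M" and AE: "AE \<omega> in palm. P \<omega>"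
  shows "AE \<omega> in M. \<forall>x\<in>points (\<Phi> \<omega>). P (\<theta> x \<omega>)"
    and "AE \<omega> in palm. \<forall>x\<in>points (\<Phi> \<omega>). P (\<theta> x \<omega>)"
proof -
  define A where "A = {\<omega> \<in> space M. \<not> P \<omega>}"
  have A[measurable]: "A \<in> sets M"
    unfolding A_def using sets.sets_Collect_neg[OF P] .
  have A0: "AE \<omega> in palm. \<omega> \<notin> A" using AE by (auto simp: A_def)
  have pt: "(AE \<omega> in N. \<forall>x\<in>points (\<Phi> \<omega>). P (\<theta> x \<omega>))"
    if N: "sets N = sets M" and z: "(\<integral>\<^sup>+\<omega>. \<integral>\<^sup>+t. indicator A (\<theta> t \<omega>) \<partial>\<Phi> \<omega> \<partial>N) = 0" for N
  proof -
    have spN: "space N = space M" by (rule sets_eq_imp_space_eq[OF N])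
    have "(\<lambda>\<omega>. \<integral>\<^sup>+t. indicator A (\<theta> t \<omega>) \<partial>\<Phi> \<omega>) \<in> borel_measurable M" by measurable
    then have "AE \<omega> in N. (\<integral>\<^sup>+t. indicator A (\<theta> t \<omega>) \<partial>\<Phi> \<omega>) = 0"
      using z by (subst (asm) nn_integral_0_iff_AE) (auto simp: measurable_cong_sets[OF N refl])
    then show ?thesis
    proof (rule AE_mp, intro AE_I2 impI)
      fix \<omega> assume "\<omega> \<in> space N" and 0: "(\<integral>\<^sup>+t. indicator A (\<theta> t \<omega>) \<partial>\<Phi> \<omega>) = 0"
      then have \<omega>: "\<omega> \<in> space M" by (simp add: spN)
      have "AE t in \<Phi> \<omega>. indicator A (\<theta> t \<omega>) = (0::ennreal)"
        using 0 \<omega> by (subst (asm) nn_integral_0_iff_AE) auto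
      then show "\<forall>x\<in>points (\<Phi> \<omega>). P (\<theta> x \<omega>)"
        unfolding AE_count_meas_iff[OF \<Phi>_count[OF \<omega>]]
        using flow_space[OF \<omega>] by (auto simp: A_def indicator_def split: if_splits)
    qed
  qed
  have "(\<integral>\<^sup>+\<omega>. \<integral>\<^sup>+t. indicator A (\<theta> t \<omega>) \<partial>\<Phi> \<omega> \<partial>M) =
      intensity M \<Phi> * (\<integral>\<^sup>+\<omega>. \<integral>\<^sup>+(s::'a). indicator A \<omega> \<partial>lborel \<partial>palm)"
    by (rule campbell[of "\<lambda>\<omega> _. indicator A \<omega>"]) measurable
  also have "(\<integral>\<^sup>+\<omega>. \<integral>\<^sup>+(s::'a). indicator A \<omega> \<partial>lborel \<partial>palm) = (\<integral>\<^sup>+\<omega>. 0 \<partial>palm)"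
    using A0 by (intro nn_integral_cong_AE) (auto elim!: eventually_mono)
  finally show "AE \<omega> in M. \<forall>x\<in>points (\<Phi> \<omega>). P (\<theta> x \<omega>)" by (intro pt) auto
  have "(\<integral>\<^sup>+\<omega>. \<integral>\<^sup>+t. indicator A (\<theta> t \<omega>) \<partial>\<Phi> \<omega> \<partial>palm) =
      (\<integral>\<^sup>+\<omega>. \<integral>\<^sup>+t. indicator A (\<theta> (- t) (\<theta> t \<omega>)) \<partial>\<Phi> \<omega> \<partial>palm)"
    by (rule mass_transport) measurable
  also have "\<dots> = (\<integral>\<^sup>+\<omega>. 0 \<partial>palm)"
  proof (rule nn_integral_cong_AE, use A0 AE_space in eventually_elim)
    case (elim \<omega>)
    then show ?case by (simp add: flow_add flow_0)
  qed
  finally show "AE \<omega> in palm. \<forall>x\<in>points (\<Phi> \<omega>). P (\<theta> x \<omega>)" by (intro pt) auto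
qed

lemma AE_palm_invariant:
  assumes P: "{\<omega> \<in> space M. P \<omega>} \<in> sets M" and AE: "AE \<omega> in M. P \<omega>"
    and inv: "\<And>\<omega> t. \<omega> \<in> space M \<Longrightarrow> P \<omega> \<Longrightarrow> P (\<theta> t \<omega>)"
  shows "AE \<omega> in palm. P \<omega>"
proof -
  define A where "A = {\<omega> \<in> space M. \<not> P \<omega>}"
  have A[measurable]: "A \<in> sets M"
    unfolding A_def using sets.sets_Collect_neg[OF P] .
  have "cube_functional (indicator A) = (\<integral>\<^sup>+\<omega>. 0 \<partial>M)"
    unfolding cube_functional_def
  proof (rule nn_integral_cong_AE, use AE AE_space in eventually_elim)
    case (elim \<omega>)
    then have "indicator A (\<theta> t \<omega>) = (0::ennreal)" for t
      using inv by (auto simp: A_def indicator_def)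
    then show ?case by simp
  qed
  then have "A \<in> null_sets palm" by (simp add: null_sets_def emeasure_palm)
  then show ?thesis by (rule AE_I') (auto simp: A_def)
qed

lemma AE_palm_origin: "AE \<omega> in palm. \<Phi> \<omega> \<in> count_meas0"
proof -
  let ?A = "{\<omega> \<in> space M. \<Phi> \<omega> \<notin> count_meas0}"
  have A[measurable]: "?A \<in> sets M" by measurable
  have "cube_functional (indicator ?A) = (\<integral>\<^sup>+\<omega>. 0 \<partial>M)"
    unfolding cube_functional_def
  proof (rule nn_integral_cong)
    fix \<omega> assume \<omega>: "\<omega> \<in> space M"
    have "(\<integral>\<^sup>+t. indicator unit_cube t * indicator ?A (\<theta> t \<omega>) \<partial>\<Phi> \<omega>) = (\<integral>\<^sup>+t. 0 \<partial>\<Phi> \<omega>)"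
      using AE_in_points[OF \<Phi>_count[OF \<omega>]]
      by (intro nn_integral_cong_AE, eventually_elim)
        (simp add: \<Phi>_flow \<omega> translate_in_count_meas0 \<Phi>_count)
    then show "(\<integral>\<^sup>+t. indicator unit_cube t * indicator ?A (\<theta> t \<omega>) \<partial>\<Phi> \<omega>) = 0" by simp
  qed
  then have "?A \<in> null_sets palm" using A by (simp add: null_sets_def emeasure_palm)
  then show ?thesis by (rule AE_I') auto
qed

end

section \<open>Point-shifts\<close>

lemma shift_by_iterate_translate:
  assumes "sets \<phi> = sets borel"
  shows "(shift_by f ^^ n) (translate x \<phi>) = translate ((point_shift f \<phi> ^^ n) x) \<phi>"
  by (induction n) (simp_all add: shift_by_def point_shift_def translate_translate assms)

lemma point_shift_iterate_translate:
  assumes "sets \<phi> = sets borel"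
  shows "(point_shift f (translate y \<phi>) ^^ n) x = (point_shift f \<phi> ^^ n) (x + y) - y"
  by (induction n) (simp_all add: point_shift_def translate_translate assms)

lemma shift_by_iterate:
  assumes "sets \<phi> = sets borel"
  shows "(shift_by f ^^ n) \<phi> = translate ((point_shift f \<phi> ^^ n) 0) \<phi>"
  using shift_by_iterate_translate[OF assms, of n f 0] by (simp add: translate_0 assms)

definition image_preimage :: "('a::euclidean_space measure \<Rightarrow> 'a) \<Rightarrow> nat \<Rightarrow> 'a measure \<Rightarrow> 'a \<Rightarrow> 'a set" where
  "image_preimage f n \<phi> y = {x \<in> points \<phi>. (point_shift f \<phi> ^^ n) x = y}"

lemma image_mult_eq: "image_mult f n \<phi> y = emeasure \<phi> (image_preimage f n \<phi> y)"
  by (simp add: image_mult_def image_preimage_def)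

lemma image_preimage_sets[simp]:
  assumes "\<phi> \<in> count_meas"
  shows "image_preimage f n \<phi> y \<in> sets \<phi>"
proof -
  have "countable (image_preimage f n \<phi> y)"
    by (rule countable_subset[OF _ countable_points[OF assms]]) (auto simp: image_preimage_def)
  then show ?thesis using countable_borel assms by simp
qed

lemma image_mult_translate:
  assumes \<phi>: "\<phi> \<in> count_meas"
  shows "image_mult f n (translate y \<phi>) 0 = image_mult f n \<phi> y"
proof -
  have s: "sets \<phi> = sets borel" using \<phi> by simp
  have "image_preimage f n (translate y \<phi>) 0 \<in> sets borel"
    using image_preimage_sets[OF translate_in_count_meas[OF \<phi>], of f n y 0] by simp
  moreover have "{x. x - y \<in> image_preimage f n (translate y \<phi>) 0} = image_preimage f n \<phi> y"
    by (auto simp: image_preimage_def points_translate[OF s] point_shift_iterate_translate[OF s])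
  ultimately show ?thesis
    by (simp add: image_mult_eq emeasure_translate[OF s])
qed

lemma count_meas0_Int_space[simp]: "count_meas0 \<inter> count_meas \<in> sets N_space"
  using sets.Int[OF sets_count_meas0 sets.top] by simp

lemma N0_to_N: "(\<lambda>\<phi>. \<phi>) \<in> measurable N0_space N_space"
  unfolding N0_space_def by (intro measurable_restrict_space1 measurable_ident_sets) simp

lemma sets_N0_iff: "B \<in> sets N0_space \<longleftrightarrow> B \<subseteq> count_meas0 \<and> B \<in> sets N_space"
  unfolding N0_space_def by (rule sets_restrict_space_iff) simp

text \<open>The value outside \<open>N\<^sup>0\<close> is a default that makes the map total on \<open>N\<close>, where random translations
  take their values.\<close>
definition orbit :: "('a::euclidean_space measure \<Rightarrow> 'a) \<Rightarrow> nat \<Rightarrow> 'a measure \<Rightarrow> 'a" where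
  "orbit f n \<phi> = (if \<phi> \<in> count_meas0 then (point_shift f \<phi> ^^ n) 0 else 0)"

context
  fixes f :: "'a::euclidean_space measure \<Rightarrow> 'a"
  assumes pm: "point_map f"
begin

lemma point_map_mem:
  assumes "\<phi> \<in> count_meas0"
  shows "f \<phi> \<in> points \<phi>"
proof -
  have "\<phi> \<in> count_meas" using assms by (simp add: count_meas0_def)
  then have "points \<phi> = msupport \<phi>" by (rule points_eq_msupport)
  then show ?thesis using pm assms unfolding point_map_def by blast
qed

lemma shift_by_mem:
  assumes "\<phi> \<in> count_meas0"
  shows "shift_by f \<phi> \<in> count_meas0"
  using assms point_map_mem[OF assms] unfolding shift_by_def
  by (subst translate_in_count_meas0) (auto simp: count_meas0_def)

lemma shift_by_iterate_mem: "\<phi> \<in> count_meas0 \<Longrightarrow> (shift_by f ^^ n) \<phi> \<in> count_meas0"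
  by (induction n) (simp_all add: shift_by_mem)

lemma point_shift_iterate_mem:
  assumes "\<phi> \<in> count_meas" "x \<in> points \<phi>"
  shows "(point_shift f \<phi> ^^ n) x \<in> points \<phi>"
proof -
  have "translate x \<phi> \<in> count_meas0" using assms by (simp add: translate_in_count_meas0)
  then have "(shift_by f ^^ n) (translate x \<phi>) \<in> count_meas0" by (rule shift_by_iterate_mem)
  then show ?thesis
    using assms by (simp add: shift_by_iterate_translate translate_in_count_meas0)
qed

text \<open>If the environment seen from \<open>y\<close> is fixed by \<open>f\<close>, then \<open>p = f (translate y \<phi>)\<close> is a period of
  \<open>\<phi>\<close>, not necessarily zero. Hence \<open>y - p\<close> sees the same environment as \<open>y\<close> and is mapped to \<open>y\<close>.\<close>
lemma fixed_preimage:
  assumes \<phi>: "\<phi> \<in> count_meas" and y: "y \<in> points \<phi>"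
    and fix_y: "shift_by f (translate y \<phi>) = translate y \<phi>"
  defines "z \<equiv> y - f (translate y \<phi>)"
  shows "translate z \<phi> = translate y \<phi>" "z \<in> points \<phi>" "point_shift f \<phi> z = y"
proof -
  have s: "sets \<phi> = sets borel" using \<phi> by simp
  let ?p = "f (translate y \<phi>)"
  have "translate (?p + y) \<phi> = translate y \<phi>"
    using fix_y by (simp add: shift_by_def translate_translate s)
  then have "translate (- ?p) (translate (?p + y) \<phi>) = translate (- ?p) (translate y \<phi>)" by simp
  then show eq: "translate z \<phi> = translate y \<phi>"
    by (simp add: translate_translate s z_def)
  have "translate z \<phi> \<in> count_meas0"
    using y \<phi> by (simp add: eq translate_in_count_meas0)
  then show "z \<in> points \<phi>" using \<phi> by (simp add: translate_in_count_meas0)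
  show "point_shift f \<phi> z = y" unfolding point_shift_def eq by (simp add: z_def)
qed

text \<open>The preimage \<open>y - p\<close> has the same multiplicity as \<open>y\<close> since both see the same environment.\<close>
lemma fixed_image_mult_mono:
  assumes \<phi>: "\<phi> \<in> count_meas" and y: "y \<in> points \<phi>"
    and fix_y: "shift_by f (translate y \<phi>) = translate y \<phi>"
  shows "image_mult f n \<phi> y \<le> image_mult f (Suc n) \<phi> y"
proof -
  define z where "z = y - f (translate y \<phi>)"
  note z = fixed_preimage[OF \<phi> y fix_y, folded z_def]
  have "image_mult f n \<phi> y = image_mult f n \<phi> z"
    by (simp add: image_mult_translate[OF \<phi>, symmetric] z(1))
  also have "\<dots> \<le> image_mult f (Suc n) \<phi> y"
    unfolding image_mult_eq using \<phi> z(3)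
    by (intro emeasure_mono image_preimage_sets) (auto simp: image_preimage_def)
  finally show ?thesis .
qed

text \<open>A point \<open>w\<close> that is mapped to \<open>y\<close> and is not itself fixed competes with the fixed preimage of
  \<open>y\<close>, so that its mass is an increment of the mass of \<open>y\<close>.\<close>
lemma fixed_image_mult_increment:
  assumes \<phi>: "\<phi> \<in> count_meas" and w: "w \<in> points \<phi>" "point_shift f \<phi> w = y"
    and fix_y: "shift_by f (translate y \<phi>) = translate y \<phi>"
    and nfix: "shift_by f (translate w \<phi>) \<noteq> translate w \<phi>"
  shows "image_mult f n \<phi> y + image_mult f n \<phi> w \<le> image_mult f (Suc n) \<phi> y"
proof -
  have y: "y \<in> points \<phi>" using point_shift_iterate_mem[OF \<phi> w(1), of 1] w(2) by simp
  define z where "z = y - f (translate y \<phi>)"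
  note z = fixed_preimage[OF \<phi> y fix_y, folded z_def]
  have "z \<noteq> w" using nfix fix_y z(1) by auto
  have "image_mult f n \<phi> y = image_mult f n \<phi> z"
    by (simp add: image_mult_translate[OF \<phi>, symmetric] z(1))
  then have "image_mult f n \<phi> y + image_mult f n \<phi> w =
      emeasure \<phi> (image_preimage f n \<phi> z) + emeasure \<phi> (image_preimage f n \<phi> w)"
    by (simp add: image_mult_eq)
  also have "\<dots> = emeasure \<phi> (image_preimage f n \<phi> z \<union> image_preimage f n \<phi> w)"
    using \<open>z \<noteq> w\<close> \<phi> by (intro plus_emeasure image_preimage_sets) (auto simp: image_preimage_def)
  also have "\<dots> \<le> image_mult f (Suc n) \<phi> y"
    unfolding image_mult_eq using \<phi> z(3) w(2)
    by (intro emeasure_mono image_preimage_sets) (auto simp: image_preimage_def)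
  finally show ?thesis .
qed

lemma image_mult_converges_fixed:
  assumes \<phi>: "\<phi> \<in> count_meas" and y: "y \<in> points \<phi>"
    and fix_y: "shift_by f (translate y \<phi>) = translate y \<phi>"
  shows "(\<lambda>n. image_mult f n \<phi> y) \<longlonglongrightarrow> (SUP n. image_mult f n \<phi> y)"
  by (intro LIMSEQ_SUP incseq_SucI fixed_image_mult_mono assms)

text \<open>The trajectory of \<open>x\<close> reaches a point \<open>y\<close> with fixed environment from a last point \<open>w\<close> without. What is
  mapped to \<open>x\<close> is mapped to \<open>w\<close> some steps later, and the masses at \<open>w\<close> are dominated by the increments
  of the convergent masses at \<open>y\<close>.\<close>
lemma image_mult_vanishes:
  assumes \<phi>: "\<phi> \<in> count_meas" and x: "x \<in> points \<phi>"
    and hits: "\<exists>n. shift_by f ((shift_by f ^^ n) (translate x \<phi>)) = (shift_by f ^^ n) (translate x \<phi>)"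
    and nfix: "shift_by f (translate x \<phi>) \<noteq> translate x \<phi>"
    and fin: "\<And>y. y \<in> points \<phi> \<Longrightarrow> shift_by f (translate y \<phi>) = translate y \<phi> \<Longrightarrow>
      (SUP n. image_mult f n \<phi> y) < \<infinity>"
  shows "(\<lambda>n. image_mult f n \<phi> x) \<longlonglongrightarrow> 0"
proof -
  have s: "sets \<phi> = sets borel" using \<phi> by simp
  let ?P = "\<lambda>n. shift_by f ((shift_by f ^^ n) (translate x \<phi>)) = (shift_by f ^^ n) (translate x \<phi>)"
  \<comment> \<open>The trajectory first sees a fixed environment at step \<open>k = Suc j\<close>, and \<open>w\<close> is its last point before.\<close>
  define k where "k = (LEAST n. ?P n)"
  have k: "?P k" unfolding k_def by (rule LeastI_ex[OF hits])
  have "k \<noteq> 0" using k nfix by (auto intro: ccontr)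
  then obtain j where j: "k = Suc j" by (cases k) auto
  have nj: "\<not> ?P j" using not_less_Least[of j ?P] j by (simp add: k_def)
  define w where "w = (point_shift f \<phi> ^^ j) x"
  define y where "y = point_shift f \<phi> w"
  have w: "w \<in> points \<phi>" unfolding w_def by (rule point_shift_iterate_mem[OF \<phi> x])
  have y: "y \<in> points \<phi>" using point_shift_iterate_mem[OF \<phi> w, of 1] by (simp add: y_def)
  have fix_y: "shift_by f (translate y \<phi>) = translate y \<phi>"
    using k unfolding j shift_by_iterate_translate[OF s] by (simp add: y_def w_def)
  have nfix_w: "shift_by f (translate w \<phi>) \<noteq> translate w \<phi>"
    using nj unfolding shift_by_iterate_translate[OF s] by (simp add: w_def)
  let ?L = "SUP n. image_mult f n \<phi> y"
  have L: "?L \<noteq> top" using less_imp_neq[OF fin[OF y fix_y]] by (simp only: infinity_ennreal_def not_False_eq_True)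
  have fin_n: "image_mult f n \<phi> y \<noteq> top" for n
  proof -
    have "image_mult f n \<phi> y \<le> ?L" by (rule SUP_upper) simp
    also have "?L < top" using L by (rule less_top[THEN iffD1])
    finally show ?thesis by (simp add: less_top)
  qed
  have lim: "(\<lambda>n. image_mult f n \<phi> y) \<longlonglongrightarrow> ?L"
    by (rule image_mult_converges_fixed[OF \<phi> y fix_y])
  have "(\<lambda>n. image_mult f (Suc n) \<phi> y - image_mult f n \<phi> y) \<longlonglongrightarrow> ?L - ?L"
    by (intro tendsto_diff_ennreal LIMSEQ_Suc lim L)
  then have diff: "(\<lambda>n. image_mult f (Suc n) \<phi> y - image_mult f n \<phi> y) \<longlonglongrightarrow> 0"
    using L by (simp add: less_top)
  have le: "image_mult f n \<phi> w \<le> image_mult f (Suc n) \<phi> y - image_mult f n \<phi> y" for n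
  proof -
    have "image_mult f n \<phi> w = image_mult f n \<phi> y + image_mult f n \<phi> w - image_mult f n \<phi> y"
      using fin_n[of n] by simp
    also have "\<dots> \<le> image_mult f (Suc n) \<phi> y - image_mult f n \<phi> y"
      by (intro ennreal_minus_mono fixed_image_mult_increment[OF \<phi> w _ fix_y nfix_w]) (simp_all add: y_def)
    finally show ?thesis .
  qed
  have "(\<lambda>n. image_mult f n \<phi> w) \<longlonglongrightarrow> 0"
    by (rule tendsto_sandwich[OF _ _ tendsto_const diff]) (use le in auto)
  then have lim_w: "(\<lambda>n. image_mult f (n + j) \<phi> w) \<longlonglongrightarrow> 0" by (rule LIMSEQ_ignore_initial_segment)
  have "image_mult f n \<phi> x \<le> image_mult f (n + j) \<phi> w" for n
  proof -
    have "(point_shift f \<phi> ^^ (n + j)) v = (point_shift f \<phi> ^^ j) ((point_shift f \<phi> ^^ n) v)" for v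
      by (metis add.commute comp_apply funpow_add)
    then show ?thesis
      unfolding image_mult_eq using \<phi>
      by (intro emeasure_mono image_preimage_sets) (auto simp: image_preimage_def w_def)
  qed
  then show ?thesis
    by (intro tendsto_sandwich[OF _ _ tendsto_const lim_w] always_eventually allI) simp_all
qed

section \<open>Measurability of point-shifts\<close>

lemma f_measurable[measurable]: "f \<in> borel_measurable N0_space"
  using pm by (simp add: point_map_def)

lemma shift_by_measurable[measurable]: "shift_by f \<in> measurable N0_space N0_space"
proof -
  have "shift_by f \<in> measurable N0_space N_space"
    unfolding shift_by_def[abs_def] by (intro measurable_translate f_measurable N0_to_N)
  then have "shift_by f \<in> measurable N0_space (restrict_space N_space count_meas0)"
    using shift_by_mem by (intro measurable_restrict_space2) auto
  then show ?thesis by (simp add: N0_space_def)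
qed

lemma shift_by_iterate_measurable[measurable]: "shift_by f ^^ n \<in> measurable N0_space N0_space"
  by (induction n) (auto intro: measurable_comp)

lemma point_shift_iterate_measurable: "(\<lambda>\<phi>. (point_shift f \<phi> ^^ n) 0) \<in> borel_measurable N0_space"
proof (induction n)
  case (Suc n)
  have "(\<lambda>\<phi>. f ((shift_by f ^^ n) \<phi>) + (point_shift f \<phi> ^^ n) 0) \<in> borel_measurable N0_space"
    using Suc by (intro borel_measurable_add measurable_compose[OF shift_by_iterate_measurable f_measurable])
  then show ?case
    by (rule measurable_cong[THEN iffD1, rotated])
      (simp add: count_meas0_def shift_by_iterate, simp add: point_shift_def)
qed simp

lemma orbit_measurable[measurable]: "orbit f n \<in> borel_measurable N_space"
  unfolding orbit_def[abs_def]
  using point_shift_iterate_measurable[of n] unfolding N0_space_def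
  by (subst (asm) measurable_restrict_space_iff[where c=0]) auto

text \<open>By equivariance, a point \<open>x\<close> is mapped to the origin if and only if the \<open>n\<close>-th image of the origin in
  the environment of \<open>x\<close> is \<open>- x\<close>. This writes the multiplicity as an integral against the configuration
  of a function of the environment and the location.\<close>
lemma image_mult_kernel:
  assumes \<phi>: "\<phi> \<in> count_meas"
  shows "image_mult f n \<phi> 0 =
    (\<integral>\<^sup>+x. indicator count_meas0 (translate x \<phi>) * indicator {0} (orbit f n (translate x \<phi>) + x) \<partial>\<phi>)"
proof -
  have s: "sets \<phi> = sets borel" using \<phi> by simp
  have "(\<integral>\<^sup>+x. indicator count_meas0 (translate x \<phi>) * indicator {0} (orbit f n (translate x \<phi>) + x) \<partial>\<phi>) =
      (\<integral>\<^sup>+x. indicator (image_preimage f n \<phi> 0) x \<partial>\<phi>)"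
    by (intro nn_integral_cong)
      (auto simp: indicator_def translate_in_count_meas0[OF \<phi>] image_preimage_def orbit_def
        point_shift_iterate_translate[OF s])
  also have "\<dots> = image_mult f n \<phi> 0"
    unfolding image_mult_eq by (rule nn_integral_indicator[OF image_preimage_sets[OF \<phi>]])
  finally show ?thesis by simp
qed

lemma image_mult_measurable[measurable]: "(\<lambda>\<phi>. image_mult f n \<phi> 0) \<in> borel_measurable N_space"
proof -
  have "(\<lambda>\<phi>. \<integral>\<^sup>+x. indicator count_meas0 (translate x \<phi>) * indicator {0} (orbit f n (translate x \<phi>) + x) \<partial>\<phi>)
      \<in> borel_measurable N_space"
    by (rule measurable_nn_integral_kernel) (auto simp: case_prod_beta')
  then show ?thesis
    by (rule measurable_cong[THEN iffD1, rotated]) (simp add: image_mult_kernel)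
qed

lemma sets_fixed[measurable]: "{\<phi> \<in> count_meas0. shift_by f \<phi> = \<phi>} \<in> sets N0_space"
  using sets_Collect_N_space_eq[OF measurable_compose[OF shift_by_measurable N0_to_N] N0_to_N] by simp

end

section \<open>The limit of the image multiplicities\<close>

lemma sets_law_N0[simp]:
  "sets (law_N0 Q \<Phi>) = sets N0_space"
  unfolding law_N0_def N0_space_def by (intro sets_restrict_space_cong) simp

lemma emeasure_law_N0:
  assumes \<Phi>: "\<Phi> \<in> measurable Q N_space" and B: "B \<in> sets N0_space"
  shows "emeasure (law_N0 Q \<Phi>) B = emeasure Q {\<omega> \<in> space Q. \<Phi> \<omega> \<in> B}"
proof -
  have B': "B \<subseteq> count_meas0" "B \<in> sets N_space" using B by (simp_all add: sets_N0_iff)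
  have "emeasure (law_N0 Q \<Phi>) B = emeasure (distr Q N_space \<Phi>) B"
    unfolding law_N0_def using B' by (intro emeasure_restrict_space) auto
  also have "\<dots> = emeasure Q (\<Phi> -` B \<inter> space Q)"
    using \<Phi> B' by (simp add: emeasure_distr)
  finally show ?thesis by (simp add: vimage_def Int_def conj_commute)
qed

definition fixed_config :: "('a::euclidean_space measure \<Rightarrow> 'a) \<Rightarrow> 'a measure \<Rightarrow> bool" where
  "fixed_config f \<phi> \<longleftrightarrow> shift_by f \<phi> = \<phi>"

text \<open>The limit superior provides a version of the limit multiplicity \<open>m\<^sup>\<infinity>\<close> that is measurable and defined
  for every configuration.\<close>
definition mult_sup_lim :: "('a::euclidean_space measure \<Rightarrow> 'a) \<Rightarrow> 'a measure \<Rightarrow> ennreal" where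
  "mult_sup_lim f \<phi> = limsup (\<lambda>n. image_mult f n \<phi> 0)"

text \<open>If all points of a configuration see tame environments, then all multiplicities converge. Being a
  property of a single environment, tameness only has to be verified for the typical point.\<close>
definition tame :: "('a::euclidean_space measure \<Rightarrow> 'a) \<Rightarrow> 'a measure \<Rightarrow> bool" where
  "tame f \<phi> \<longleftrightarrow> \<phi> \<in> count_meas0 \<and> (\<exists>n. fixed_config f ((shift_by f ^^ n) \<phi>)) \<and>
     (fixed_config f \<phi> \<longrightarrow> (SUP n. image_mult f n \<phi> 0) < \<infinity>)"

lemma tame_limit:
  assumes pm: "point_map f" and \<phi>: "\<phi> \<in> count_meas"
    and tame: "\<And>x. x \<in> points \<phi> \<Longrightarrow> tame f (translate x \<phi>)" and x: "x \<in> points \<phi>"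
  shows "(\<lambda>n. image_mult f n \<phi> x) \<longlonglongrightarrow> mult_sup_lim f (translate x \<phi>)"
    and "mult_sup_lim f (translate x \<phi>) < \<infinity>"
    and "\<not> fixed_config f (translate x \<phi>) \<Longrightarrow> mult_sup_lim f (translate x \<phi>) = 0"
    and "fixed_config f (translate x \<phi>) \<Longrightarrow>
      mult_sup_lim f (translate x \<phi>) = (SUP n. image_mult f n (translate x \<phi>) 0)"
proof -
  have eq: "mult_sup_lim f (translate x \<phi>) = L" if "(\<lambda>n. image_mult f n \<phi> x) \<longlonglongrightarrow> L" for L
    unfolding mult_sup_lim_def image_mult_translate[OF \<phi>]
    using that by (intro lim_imp_Limsup) auto
  have fin: "(SUP n. image_mult f n \<phi> y) < \<infinity>"
    if "y \<in> points \<phi>" "shift_by f (translate y \<phi>) = translate y \<phi>" for y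
    using tame[OF that(1)] that(2) unfolding tame_def fixed_config_def image_mult_translate[OF \<phi>]
    by blast
  have lim_fix: "(\<lambda>n. image_mult f n \<phi> x) \<longlonglongrightarrow> (SUP n. image_mult f n \<phi> x)"
    if "fixed_config f (translate x \<phi>)"
    using that by (intro image_mult_converges_fixed[OF pm \<phi> x]) (simp add: fixed_config_def)
  have lim_nfix: "(\<lambda>n. image_mult f n \<phi> x) \<longlonglongrightarrow> 0" if "\<not> fixed_config f (translate x \<phi>)"
    using that tame[OF x] unfolding tame_def fixed_config_def
    by (intro image_mult_vanishes[OF pm \<phi> x] fin) blast+
  show "mult_sup_lim f (translate x \<phi>) = 0" if "\<not> fixed_config f (translate x \<phi>)"
    by (rule eq[OF lim_nfix[OF that]])
  show sup: "mult_sup_lim f (translate x \<phi>) = (SUP n. image_mult f n (translate x \<phi>) 0)"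
    if "fixed_config f (translate x \<phi>)"
    unfolding image_mult_translate[OF \<phi>] by (rule eq[OF lim_fix[OF that]])
  show "(\<lambda>n. image_mult f n \<phi> x) \<longlonglongrightarrow> mult_sup_lim f (translate x \<phi>)"
  proof (cases "fixed_config f (translate x \<phi>)")
    case True
    then show ?thesis using lim_fix eq[OF lim_fix] by simp
  next
    case False
    then show ?thesis using lim_nfix eq[OF lim_nfix] by simp
  qed
  show "mult_sup_lim f (translate x \<phi>) < \<infinity>"
  proof (cases "fixed_config f (translate x \<phi>)")
    case True
    then show ?thesis using eq[OF lim_fix] fin[OF x] by (simp only: fixed_config_def)
  next
    case False
    then show ?thesis using eq[OF lim_nfix] by simp
  qed
qed

lemma dirac_sum_cong:
  assumes "\<And>x. x \<in> S \<Longrightarrow> m x = m' x"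
  shows "dirac_sum S m = dirac_sum S m'"
  unfolding dirac_sum_def point_measure_def
  using assms by (intro arg_cong[where f="\<lambda>N. distr N borel (\<lambda>x. x)"] density_cong) auto

lemma image_limit_tame:
  assumes pm: "point_map f" and \<phi>: "\<phi> \<in> count_meas"
    and tame: "\<And>x. x \<in> points \<phi> \<Longrightarrow> tame f (translate x \<phi>)"
  shows "image_limit f \<phi> = dirac_sum (msupport \<phi>) (\<lambda>x. mult_sup_lim f (translate x \<phi>))"
proof -
  note pts = points_eq_msupport[OF \<phi>]
  have lim: "(\<lambda>n. emeasure (image_meas f n \<phi>) {x}) \<longlonglongrightarrow> mult_sup_lim f (translate x \<phi>)"
    if "x \<in> points \<phi>" for x
    using tame_limit(1)[OF pm \<phi> tame that] that
    by (simp add: image_meas_def emeasure_dirac_sum_singleton pts[symmetric])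
  have "\<forall>x\<in>points \<phi>. \<exists>l<\<infinity>. (\<lambda>n. emeasure (image_meas f n \<phi>) {x}) \<longlonglongrightarrow> l"
    using lim tame_limit(2)[OF pm \<phi> tame] by blast
  then have "image_limit f \<phi> =
      dirac_sum (msupport \<phi>) (\<lambda>x. lim (\<lambda>n. emeasure (image_meas f n \<phi>) {x}))"
    unfolding image_limit_def by (rule if_P)
  also have "\<dots> = dirac_sum (msupport \<phi>) (\<lambda>x. mult_sup_lim f (translate x \<phi>))"
    using limI[OF lim] by (intro dirac_sum_cong) (simp add: pts[symmetric])
  finally show ?thesis .
qed

locale periodic_point_shift = stationary_process M \<theta> \<Phi>
  for M :: "'w measure" and \<theta> :: "'a::euclidean_space \<Rightarrow> 'w \<Rightarrow> 'w" and \<Phi> :: "'w \<Rightarrow> 'a measure" +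
  fixes f :: "'a measure \<Rightarrow> 'a"
  assumes simple: "AE \<omega> in M. simple_meas (\<Phi> \<omega>)"
    and pm: "point_map f"
    and periodic: "one_periodic f (law_N0 palm \<Phi>)"
begin

sublocale palm: prob_space palm by (rule prob_space_palm)

definition P0 :: "'a measure measure" where
  "P0 = law_N0 palm \<Phi>"

lemma sets_P0[simp, measurable_cong]: "sets P0 = sets N0_space"
  by (simp add: P0_def)

lemma space_P0[simp]: "space P0 = count_meas0"
  using sets_eq_imp_space_eq[OF sets_P0] by simp

lemma measurable_P0: "measurable P0 K = measurable N0_space K"
  by (rule measurable_cong_sets) simp_all

lemma \<Phi>_palm: "\<Phi> \<in> measurable palm N_space"
  using \<Phi>_measurable by (simp add: measurable_cong_sets[OF sets_palm refl])

lemma AE_P0: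
  assumes "{\<phi> \<in> count_meas. P \<phi>} \<in> sets N_space"
  shows "(AE \<phi> in P0. P \<phi>) \<longleftrightarrow> (AE \<omega> in palm. P (\<Phi> \<omega>))"
proof -
  have "{\<phi> \<in> count_meas. \<phi> \<in> count_meas0 \<longrightarrow> P \<phi>} = (count_meas - count_meas0) \<union> {\<phi> \<in> count_meas. P \<phi>}"
    by (auto simp: count_meas0_def)
  also have "\<dots> \<in> sets N_space"
    using assms sets.Diff[OF sets.top sets_count_meas0] by auto
  finally have m: "{\<phi> \<in> space N_space. \<phi> \<in> count_meas0 \<longrightarrow> P \<phi>} \<in> sets N_space" by simp
  have "(AE \<phi> in P0. P \<phi>) \<longleftrightarrow> (AE \<phi> in distr palm N_space \<Phi>. \<phi> \<in> count_meas0 \<longrightarrow> P \<phi>)"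
    unfolding P0_def law_N0_def by (rule AE_restrict_space_iff) simp
  also have "\<dots> \<longleftrightarrow> (AE \<omega> in palm. \<Phi> \<omega> \<in> count_meas0 \<longrightarrow> P (\<Phi> \<omega>))"
    by (rule AE_distr_iff[OF \<Phi>_palm m])
  also have "\<dots> \<longleftrightarrow> (AE \<omega> in palm. P (\<Phi> \<omega>))"
    using AE_palm_origin by (auto elim: AE_mp)
  finally show ?thesis .
qed

lemma nn_integral_P0:
  assumes u: "u \<in> borel_measurable N0_space"
  shows "(\<integral>\<^sup>+\<phi>. u \<phi> \<partial>P0) = (\<integral>\<^sup>+\<omega>. u (\<Phi> \<omega>) * indicator count_meas0 (\<Phi> \<omega>) \<partial>palm)"
proof -
  have "(\<lambda>\<phi>. u \<phi> * indicator count_meas0 \<phi>) \<in> borel_measurable N_space"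
    using u unfolding N0_space_def by (simp add: borel_measurable_restrict_space_iff_ennreal)
  then show ?thesis
    unfolding P0_def law_N0_def
    by (subst nn_integral_restrict_space) (auto simp: nn_integral_distr[OF \<Phi>_palm])
qed

sublocale P0: prob_space P0
proof
  have "emeasure P0 count_meas0 = emeasure palm {\<omega> \<in> space palm. \<Phi> \<omega> \<in> count_meas0}"
    unfolding P0_def by (rule emeasure_law_N0[OF \<Phi>_palm]) (simp add: sets_N0_iff)
  also have "\<dots> = 1"
  proof (rule palm.emeasure_eq_1_AE)
    show "{\<omega> \<in> space palm. \<Phi> \<omega> \<in> count_meas0} \<in> palm.events"
      using measurable_sets[OF \<Phi>_palm sets_count_meas0] by (simp add: vimage_def Int_def conj_commute)
    show "AE \<omega> in palm. \<omega> \<in> {\<omega> \<in> space palm. \<Phi> \<omega> \<in> count_meas0}"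
      using AE_palm_origin AE_space by eventually_elim simp
  qed
  finally show "emeasure P0 (space P0) = 1" by simp
qed

lemma AE_palm_simple: "AE \<omega> in palm. simple_meas (\<Phi> \<omega>)"
proof (rule AE_palm_invariant[OF _ simple])
  have "\<Phi> -` {\<phi> \<in> count_meas. simple_meas \<phi>} \<inter> space M \<in> sets M"
    by (rule measurable_sets[OF \<Phi>_measurable sets_simple])
  also have "\<Phi> -` {\<phi> \<in> count_meas. simple_meas \<phi>} \<inter> space M = {\<omega> \<in> space M. simple_meas (\<Phi> \<omega>)}"
    using \<Phi>_count by auto
  finally show "{\<omega> \<in> space M. simple_meas (\<Phi> \<omega>)} \<in> sets M" .
  show "simple_meas (\<Phi> (\<theta> t \<omega>))" if "\<omega> \<in> space M" "simple_meas (\<Phi> \<omega>)" for \<omega> t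
    using that by (simp add: \<Phi>_flow simple_translate)
qed

text \<open>Every point sends the mass \<open>h\<close>, evaluated at the environment of its \<open>n\<close>-th image, to that image. By
  simplicity the image is a single atom of mass one, so \<open>h\<close> at the image is the total mass sent; the mass
  received is \<open>h\<close> times the multiplicity.\<close>
lemma shift_transport:
  fixes h :: "'a measure \<Rightarrow> ennreal"
  assumes h[measurable]: "h \<in> borel_measurable N0_space"
  shows "(\<integral>\<^sup>+\<phi>. h ((shift_by f ^^ n) \<phi>) \<partial>P0) = (\<integral>\<^sup>+\<phi>. h \<phi> * image_mult f n \<phi> 0 \<partial>P0)"
proof -
  define h' where "h' \<phi> = h \<phi> * indicator count_meas0 \<phi>" for \<phi>
  have h'm[measurable]: "h' \<in> borel_measurable N_space"
    using h unfolding N0_space_def h'_def[abs_def]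
    by (simp add: borel_measurable_restrict_space_iff_ennreal)
  note orbit_measurable[OF pm, measurable] image_mult_measurable[OF pm, measurable]
    shift_by_iterate_measurable[OF pm, measurable]
  define g where "g \<omega> x = indicator count_meas0 (\<Phi> \<omega>) *
    (indicator {0} (orbit f n (\<Phi> \<omega>) - x) * h' (translate x (\<Phi> \<omega>)))" for \<omega> and x :: 'a
  have gm: "(\<lambda>(\<omega>, x). g \<omega> x) \<in> borel_measurable (M \<Otimes>\<^sub>M borel)"
    unfolding g_def by measurable
  have "(\<integral>\<^sup>+\<phi>. h ((shift_by f ^^ n) \<phi>) \<partial>P0) =
      (\<integral>\<^sup>+\<omega>. h ((shift_by f ^^ n) (\<Phi> \<omega>)) * indicator count_meas0 (\<Phi> \<omega>) \<partial>palm)"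
    by (intro nn_integral_P0 measurable_compose[OF shift_by_iterate_measurable[OF pm] h])
  also have "\<dots> = (\<integral>\<^sup>+\<omega>. \<integral>\<^sup>+x. g \<omega> x \<partial>\<Phi> \<omega> \<partial>palm)"
  proof (rule nn_integral_cong_AE, use AE_palm_origin AE_palm_simple in eventually_elim)
    case (elim \<omega>)
    let ?\<phi> = "\<Phi> \<omega>"
    have \<phi>: "?\<phi> \<in> count_meas" "0 \<in> points ?\<phi>" using elim(1) by (auto simp: count_meas0_def)
    have s: "sets ?\<phi> = sets borel" using \<phi> by simp
    define y where "y = (point_shift f ?\<phi> ^^ n) 0"
    have y: "y \<in> points ?\<phi>" unfolding y_def by (rule point_shift_iterate_mem[OF pm \<phi>])
    have "orbit f n ?\<phi> = y" using elim(1) by (simp add: orbit_def y_def)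
    then have "(\<integral>\<^sup>+x. g \<omega> x \<partial>?\<phi>) = (\<integral>\<^sup>+x. h' (translate y ?\<phi>) * indicator {y} x \<partial>?\<phi>)"
      using elim(1) by (intro nn_integral_cong) (auto simp: g_def indicator_def)
    also have "\<dots> = h' (translate y ?\<phi>)"
      using emeasure_point_simple[OF \<phi>(1) elim(2) y] s by (simp add: nn_integral_cmult_indicator)
    also have "\<dots> = h ((shift_by f ^^ n) ?\<phi>)"
      using shift_by_iterate_mem[OF pm elim(1), of n]
      unfolding shift_by_iterate[OF s] by (simp add: h'_def y_def)
    finally show ?case using elim(1) by simp
  qed
  also have "\<dots> = (\<integral>\<^sup>+\<omega>. \<integral>\<^sup>+x. g (\<theta> x \<omega>) (- x) \<partial>\<Phi> \<omega> \<partial>palm)"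
    by (rule mass_transport[OF gm])
  also have "\<dots> = (\<integral>\<^sup>+\<omega>. h (\<Phi> \<omega>) * image_mult f n (\<Phi> \<omega>) 0 * indicator count_meas0 (\<Phi> \<omega>) \<partial>palm)"
  proof (rule nn_integral_cong_AE, use AE_palm_origin AE_space[of palm] in eventually_elim)
    case (elim \<omega>)
    let ?\<phi> = "\<Phi> \<omega>"
    have \<omega>: "\<omega> \<in> space M" using elim by simp
    have \<phi>: "?\<phi> \<in> count_meas" by (rule \<Phi>_count[OF \<omega>])
    have s: "sets ?\<phi> = sets borel" using \<phi> by simp
    let ?k = "\<lambda>x. indicator count_meas0 (translate x ?\<phi>) * indicator {0} (orbit f n (translate x ?\<phi>) + x) :: ennreal"
    have km: "?k \<in> borel_measurable ?\<phi>"
    proof -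
      have [measurable]: "(\<lambda>x. translate x ?\<phi>) \<in> measurable borel N_space"
        using \<phi> by (intro measurable_translate) auto
      show ?thesis unfolding borel_measurable_\<Phi>[OF \<omega>] by measurable
    qed
    have "(\<integral>\<^sup>+x. g (\<theta> x \<omega>) (- x) \<partial>?\<phi>) = (\<integral>\<^sup>+x. ?k x * h' ?\<phi> \<partial>?\<phi>)"
      by (intro nn_integral_cong)
        (simp add: g_def \<Phi>_flow \<omega> translate_translate s translate_0 mult.assoc)
    also have "\<dots> = image_mult f n ?\<phi> 0 * h' ?\<phi>"
      unfolding image_mult_kernel[OF pm \<phi>] by (rule nn_integral_multc[OF km])
    finally show ?case using elim(1) by (simp add: h'_def mult.commute)
  qed
  also have "\<dots> = (\<integral>\<^sup>+\<phi>. h \<phi> * image_mult f n \<phi> 0 \<partial>P0)"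
    by (intro nn_integral_P0[symmetric] borel_measurable_times_ennreal h
        measurable_compose[OF N0_to_N image_mult_measurable[OF pm]])
  finally show ?thesis .
qed

lemma image_mult_N0_measurable[measurable]: "(\<lambda>\<phi>. image_mult f n \<phi> 0) \<in> borel_measurable N0_space"
  by (rule measurable_compose[OF N0_to_N image_mult_measurable[OF pm]])

lemma mult_sup_lim_measurable[measurable]: "mult_sup_lim f \<in> borel_measurable N_space"
  unfolding mult_sup_lim_def[abs_def] using image_mult_measurable[OF pm] by measurable

lemma mult_sup_lim_N0_measurable[measurable]: "mult_sup_lim f \<in> borel_measurable N0_space"
  by (rule measurable_compose[OF N0_to_N mult_sup_lim_measurable])

lemma fixed_measurable[measurable]: "Measurable.pred N0_space (fixed_config f)"
  using sets_fixed[OF pm] by (simp add: pred_def fixed_config_def)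

lemma iterate_measurable[measurable]: "shift_by f ^^ n \<in> measurable N0_space N0_space"
  by (rule shift_by_iterate_measurable[OF pm])

lemma image_mult_mono_fixed:
  assumes "\<phi> \<in> count_meas0" "fixed_config f \<phi>"
  shows "image_mult f n \<phi> 0 \<le> image_mult f (Suc n) \<phi> 0"
  using fixed_image_mult_mono[OF pm, of \<phi> 0 n] assms
  by (simp add: count_meas0_def fixed_config_def translate_0)

lemma AE_hits_fixed: "AE \<phi> in P0. \<exists>n. fixed_config f ((shift_by f ^^ n) \<phi>)"
proof -
  have "AE \<phi> in P0. \<exists>K::nat. \<forall>n>K. (shift_by f ^^ n) \<phi> = (shift_by f ^^ K) \<phi>"
    using periodic unfolding one_periodic_def P0_def .
  then show ?thesis
  proof eventually_elim
    case (elim \<phi>)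
    then obtain K where "(shift_by f ^^ Suc K) \<phi> = (shift_by f ^^ K) \<phi>" by blast
    then show ?case by (auto simp: fixed_config_def)
  qed
qed

text \<open>On fixed environments the multiplicities increase, and their means are at most one by the
  transport identity with \<open>h = 1\<close>.\<close>
lemma AE_fixed_finite: "AE \<phi> in P0. fixed_config f \<phi> \<longrightarrow> (SUP n. image_mult f n \<phi> 0) < \<infinity>"
proof -
  let ?A = "{\<phi> \<in> count_meas0. fixed_config f \<phi>}"
  have A[measurable]: "?A \<in> sets N0_space"
    using fixed_measurable by (simp add: pred_def)
  have Am: "(\<lambda>\<phi>. indicator ?A \<phi> * image_mult f n \<phi> 0) \<in> borel_measurable P0" for n
    unfolding measurable_P0 by (intro borel_measurable_times_ennreal borel_measurable_indicator A image_mult_N0_measurable)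
  have "(\<integral>\<^sup>+\<phi>. (SUP n. indicator ?A \<phi> * image_mult f n \<phi> 0) \<partial>P0) =
      (SUP n. \<integral>\<^sup>+\<phi>. indicator ?A \<phi> * image_mult f n \<phi> 0 \<partial>P0)"
    by (intro nn_integral_monotone_convergence_SUP_AE Am AE_I2)
      (simp add: indicator_def image_mult_mono_fixed)
  also have "\<dots> \<le> 1"
  proof (rule SUP_least)
    fix n
    have "(\<integral>\<^sup>+\<phi>. indicator ?A \<phi> * image_mult f n \<phi> 0 \<partial>P0) \<le> (\<integral>\<^sup>+\<phi>. 1 * image_mult f n \<phi> 0 \<partial>P0)"
      by (intro nn_integral_mono) (auto simp: indicator_def)
    also have "\<dots> = (\<integral>\<^sup>+\<phi>. 1 \<partial>P0)"
      by (rule shift_transport[symmetric]) simp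
    also have "\<dots> = 1" using P0.emeasure_space_1 by simp
    finally show "(\<integral>\<^sup>+\<phi>. indicator ?A \<phi> * image_mult f n \<phi> 0 \<partial>P0) \<le> 1" .
  qed
  finally have "(\<integral>\<^sup>+\<phi>. (SUP n. indicator ?A \<phi> * image_mult f n \<phi> 0) \<partial>P0) \<noteq> \<infinity>"
    by (auto simp: top_unique)
  then have "AE \<phi> in P0. (SUP n. indicator ?A \<phi> * image_mult f n \<phi> 0) \<noteq> \<infinity>"
    by (intro nn_integral_noteq_infinite borel_measurable_SUP Am) simp_all
  then show ?thesis
    using AE_space
  proof eventually_elim
    case (elim \<phi>)
    show ?case
    proof
      assume "fixed_config f \<phi>"
      then have "(SUP n. indicator ?A \<phi> * image_mult f n \<phi> 0) = (SUP n. image_mult f n \<phi> 0)"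
        using elim(2) by simp
      then show "(SUP n. image_mult f n \<phi> 0) < \<infinity>"
        using elim(1) by (metis infinity_ennreal_def less_top)
    qed
  qed
qed

lemma sets_tame: "{\<phi> \<in> count_meas. tame f \<phi>} \<in> sets N_space"
proof -
  have "{\<phi> \<in> space N0_space. (\<exists>n. fixed_config f ((shift_by f ^^ n) \<phi>)) \<and>
     (fixed_config f \<phi> \<longrightarrow> (SUP n. image_mult f n \<phi> 0) < \<infinity>)} \<in> sets N0_space"
    by measurable
  also have "{\<phi> \<in> space N0_space. (\<exists>n. fixed_config f ((shift_by f ^^ n) \<phi>)) \<and>
     (fixed_config f \<phi> \<longrightarrow> (SUP n. image_mult f n \<phi> 0) < \<infinity>)} = {\<phi> \<in> count_meas. tame f \<phi>}"
    unfolding tame_def space_N0_space by (auto simp only: count_meas0_def)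
  finally show ?thesis by (simp add: sets_N0_iff)
qed

lemma AE_tame: "AE \<omega> in palm. tame f (\<Phi> \<omega>)"
proof -
  have "AE \<phi> in P0. tame f \<phi>"
    using AE_hits_fixed AE_fixed_finite AE_space
    by eventually_elim (unfold tame_def space_P0, blast)
  then show ?thesis by (simp add: AE_P0[OF sets_tame])
qed

lemma AE_points_tame:
  "AE \<omega> in M. \<forall>x\<in>points (\<Phi> \<omega>). tame f (translate x (\<Phi> \<omega>))"
  "AE \<omega> in palm. \<forall>x\<in>points (\<Phi> \<omega>). tame f (translate x (\<Phi> \<omega>))"
proof -
  have "\<Phi> -` {\<phi> \<in> count_meas. tame f \<phi>} \<inter> space M \<in> sets M"
    by (rule measurable_sets[OF \<Phi>_measurable sets_tame])
  also have "\<Phi> -` {\<phi> \<in> count_meas. tame f \<phi>} \<inter> space M = {\<omega> \<in> space M. tame f (\<Phi> \<omega>)}"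
    using \<Phi>_count by auto
  finally have m: "{\<omega> \<in> space M. tame f (\<Phi> \<omega>)} \<in> sets M" .
  show "AE \<omega> in M. \<forall>x\<in>points (\<Phi> \<omega>). tame f (translate x (\<Phi> \<omega>))"
    using AE_points_of_AE_palm(1)[OF m AE_tame] AE_space
    by eventually_elim (simp add: \<Phi>_flow)
  show "AE \<omega> in palm. \<forall>x\<in>points (\<Phi> \<omega>). tame f (translate x (\<Phi> \<omega>))"
    using AE_points_of_AE_palm(2)[OF m AE_tame] AE_space
    by eventually_elim (simp add: \<Phi>_flow)
qed

text \<open>Measurability allows passing from \<open>palm\<close> to its image law.\<close>
lemma sets_points_tame: "{\<phi> \<in> count_meas. \<forall>x\<in>points \<phi>. tame f (translate x \<phi>)} \<in> sets N_space"
proof -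
  let ?C = "{\<psi> \<in> count_meas. tame f \<psi>}"
  note sets_tame[measurable]
  have "(\<lambda>\<phi>. \<integral>\<^sup>+x. indicator (- ?C) (translate x \<phi>) \<partial>\<phi>) \<in> borel_measurable N_space"
  proof (rule measurable_nn_integral_kernel)
    have "(\<lambda>(\<phi>, x). 1 - indicator ?C (translate x \<phi>) :: ennreal) \<in> borel_measurable (N_space \<Otimes>\<^sub>M (borel :: 'a measure))"
      by measurable
    moreover have "indicator (- ?C) \<psi> = (1 - indicator ?C \<psi> :: ennreal)" for \<psi>
      by (simp add: indicator_def)
    ultimately show "(\<lambda>(\<phi>, x). indicator (- ?C) (translate x \<phi>) :: ennreal) \<in> borel_measurable (N_space \<Otimes>\<^sub>M borel)"
      by simp
  qed simp
  then have "{\<phi> \<in> space N_space. (\<integral>\<^sup>+x. indicator (- ?C) (translate x \<phi>) \<partial>\<phi>) = 0} \<in> sets N_space"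
    by measurable
  also have "{\<phi> \<in> space N_space. (\<integral>\<^sup>+x. indicator (- ?C) (translate x \<phi>) \<partial>\<phi>) = 0} =
      {\<phi> \<in> count_meas. \<forall>x\<in>points \<phi>. tame f (translate x \<phi>)}"
  proof (intro Collect_cong conj_cong)
    fix \<phi> :: "'a measure" assume \<phi>: "\<phi> \<in> count_meas"
    have tr: "(\<lambda>x. translate x \<phi>) \<in> measurable \<phi> N_space"
      using \<phi> by (intro measurable_translate) (auto simp: measurable_cong_sets[OF count_meas_sets[OF \<phi>] refl])
    have "(\<lambda>x. indicator (- ?C) (translate x \<phi>) :: ennreal) \<in> borel_measurable \<phi>"
    proof (rule measurable_cong[THEN iffD1])
      show "(\<lambda>x. 1 - indicator ?C (translate x \<phi>) :: ennreal) \<in> borel_measurable \<phi>"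
        using tr by measurable
    qed (simp add: indicator_def)
    then have "(\<integral>\<^sup>+x. indicator (- ?C) (translate x \<phi>) \<partial>\<phi>) = 0 \<longleftrightarrow>
        (AE x in \<phi>. indicator (- ?C) (translate x \<phi>) = (0 :: ennreal))"
      by (rule nn_integral_0_iff_AE)
    also have "\<dots> \<longleftrightarrow> (\<forall>x\<in>points \<phi>. tame f (translate x \<phi>))"
      unfolding AE_count_meas_iff[OF \<phi>]
      using translate_in_count_meas[OF \<phi>] by (simp add: indicator_eq_0_iff)
    finally show "(\<integral>\<^sup>+x. indicator (- ?C) (translate x \<phi>) \<partial>\<phi>) = 0 \<longleftrightarrow>
        (\<forall>x\<in>points \<phi>. tame f (translate x \<phi>))" .
  qed simp
  finally show ?thesis .
qed

lemma AE_limit: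
  "AE \<phi> in P0. mult_limit f \<phi> = mult_sup_lim f \<phi> \<and>
    mult_sup_lim f \<phi> = (if fixed_config f \<phi> then SUP n. image_mult f n \<phi> 0 else 0)"
proof -
  have "AE \<phi> in P0. \<forall>x\<in>points \<phi>. tame f (translate x \<phi>)"
    unfolding AE_P0[OF sets_points_tame] by (rule AE_points_tame(2))
  then show ?thesis using AE_space
  proof eventually_elim
    case (elim \<phi>)
    have \<phi>: "\<phi> \<in> count_meas" "0 \<in> points \<phi>" using elim(2) by (auto simp: count_meas0_def)
    have s: "sets \<phi> = sets borel" using \<phi> by simp
    have tame: "\<And>x. x \<in> points \<phi> \<Longrightarrow> tame f (translate x \<phi>)" using elim(1) by blast
    have "image_limit f \<phi> = dirac_sum (msupport \<phi>) (\<lambda>x. mult_sup_lim f (translate x \<phi>))"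
      by (rule image_limit_tame[OF pm \<phi>(1)]) (rule tame)
    then have "mult_limit f \<phi> = mult_sup_lim f \<phi>"
      unfolding mult_limit_def using \<phi> by (simp add: emeasure_dirac_sum_singleton points_eq_msupport[symmetric] translate_0 s)
    then show ?case
      using tame_limit(3,4)[OF pm \<phi>(1) tame \<phi>(2)] by (simp add: translate_0 s)
  qed
qed

section \<open>The limiting law\<close>

definition Q :: "'a measure measure" where
  "Q = density P0 (mult_sup_lim f)"

definition shift_limit :: "'a measure \<Rightarrow> 'a measure" where
  "shift_limit \<phi> = (shift_by f ^^ (LEAST n. fixed_config f ((shift_by f ^^ n) \<phi>))) \<phi>"

lemma sets_Q[simp, measurable_cong]: "sets Q = sets N0_space"
  by (simp add: Q_def)

lemma shift_limit_measurable[measurable]: "shift_limit \<in> measurable N0_space N0_space"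
  unfolding shift_limit_def[abs_def]
  by (rule measurable_compose_countable[OF iterate_measurable]) measurable

lemma fixed_iterate:
  "fixed_config f ((shift_by f ^^ n) \<phi>) \<Longrightarrow> (shift_by f ^^ (n + k)) \<phi> = (shift_by f ^^ n) \<phi>"
  by (induction k) (simp_all add: fixed_config_def)

lemma iterate_eq_shift_limit:
  assumes "fixed_config f ((shift_by f ^^ n) \<phi>)"
  shows "(shift_by f ^^ n) \<phi> = shift_limit \<phi>"
proof -
  let ?P = "\<lambda>n. fixed_config f ((shift_by f ^^ n) \<phi>)"
  have "?P (LEAST n. ?P n)" "(LEAST n. ?P n) \<le> n"
    using assms by (rule LeastI, rule Least_le)
  then show ?thesis
    unfolding shift_limit_def using fixed_iterate[of "LEAST n. ?P n" \<phi> "n - (LEAST n. ?P n)"] by simp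
qed

lemma fixed_shift_limit:
  assumes "\<exists>n. fixed_config f ((shift_by f ^^ n) \<phi>)"
  shows "fixed_config f (shift_limit \<phi>)"
  unfolding shift_limit_def by (rule LeastI_ex[OF assms])

text \<open>The density turns the multiplicities back into probabilities: on fixed configurations the
  multiplicities increase, and so do the events that the trajectory has been absorbed in a given set.\<close>
lemma Q_eq_distr: "Q = distr P0 N0_space shift_limit"
proof (rule measure_eqI)
  fix B assume "B \<in> sets Q"
  then have B[measurable]: "B \<in> sets N0_space" by simp
  let ?BA = "{\<phi> \<in> count_meas0. \<phi> \<in> B \<and> fixed_config f \<phi>}"
  have BA[measurable]: "?BA \<in> sets N0_space"
  proof -
    have "{\<phi> \<in> space N0_space. \<phi> \<in> B \<and> fixed_config f \<phi>} \<in> sets N0_space" by measurable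
    then show ?thesis by simp
  qed
  \<comment> \<open>The event that the trajectory has been absorbed in \<open>B\<close> by step \<open>n\<close>.\<close>
  define E where "E n = {\<phi> \<in> count_meas0. (shift_by f ^^ n) \<phi> \<in> ?BA}" for n
  have Em: "E n \<in> sets P0" for n
  proof -
    have "(shift_by f ^^ n) -` ?BA \<inter> space N0_space \<in> sets N0_space"
      by (rule measurable_sets[OF iterate_measurable BA])
    also have "(shift_by f ^^ n) -` ?BA \<inter> space N0_space = E n" by (auto simp: E_def)
    finally show ?thesis by simp
  qed
  have BAm: "(\<lambda>\<phi>. indicator ?BA \<phi> * image_mult f n \<phi> 0) \<in> borel_measurable P0" for n
    unfolding measurable_P0 by (intro borel_measurable_times_ennreal borel_measurable_indicator BA image_mult_N0_measurable)
  have "emeasure Q B = (\<integral>\<^sup>+\<phi>. mult_sup_lim f \<phi> * indicator B \<phi> \<partial>P0)"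
    unfolding Q_def by (rule emeasure_density) auto
  also have "\<dots> = (\<integral>\<^sup>+\<phi>. (SUP n. indicator ?BA \<phi> * image_mult f n \<phi> 0) \<partial>P0)"
    using AE_limit AE_space by (intro nn_integral_cong_AE, eventually_elim) (auto simp: indicator_def)
  also have "\<dots> = (SUP n. \<integral>\<^sup>+\<phi>. indicator ?BA \<phi> * image_mult f n \<phi> 0 \<partial>P0)"
    by (intro nn_integral_monotone_convergence_SUP_AE BAm AE_I2)
      (simp add: indicator_def image_mult_mono_fixed)
  also have "\<dots> = (SUP n. \<integral>\<^sup>+\<phi>. indicator ?BA ((shift_by f ^^ n) \<phi>) \<partial>P0)"
    by (subst shift_transport[symmetric]) auto
  also have "\<dots> = (SUP n. emeasure P0 (E n))"
  proof (rule SUP_cong[OF refl])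
    fix n
    have "(\<integral>\<^sup>+\<phi>. indicator ?BA ((shift_by f ^^ n) \<phi>) \<partial>P0) = (\<integral>\<^sup>+\<phi>. indicator (E n) \<phi> \<partial>P0)"
      by (intro nn_integral_cong) (auto simp: E_def indicator_def)
    then show "(\<integral>\<^sup>+\<phi>. indicator ?BA ((shift_by f ^^ n) \<phi>) \<partial>P0) = emeasure P0 (E n)"
      using Em by simp
  qed
  also have "\<dots> = emeasure P0 (\<Union>n. E n)"
  proof (rule SUP_emeasure_incseq)
    show "incseq E"
    proof (rule incseq_SucI, rule subsetI)
      fix n \<phi> assume "\<phi> \<in> E n"
      then show "\<phi> \<in> E (Suc n)" by (auto simp: E_def fixed_config_def)
    qed
  qed (use Em in auto)
  also have "\<dots> = emeasure P0 (shift_limit -` B \<inter> space P0)"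
  proof (rule emeasure_eq_AE)
    show "AE \<phi> in P0. \<phi> \<in> (\<Union>n. E n) \<longleftrightarrow> \<phi> \<in> shift_limit -` B \<inter> space P0"
      using AE_hits_fixed AE_space
    proof eventually_elim
      case (elim \<phi>)
      then have \<phi>: "\<phi> \<in> count_meas0" by simp
      obtain k where k: "fixed_config f ((shift_by f ^^ k) \<phi>)" using elim(1) by blast
      have "shift_limit \<phi> \<in> B" if "\<phi> \<in> E n" for n
        using that iterate_eq_shift_limit[of n \<phi>] by (auto simp: E_def)
      moreover have "\<phi> \<in> E k" if "shift_limit \<phi> \<in> B"
        using that k \<phi> shift_by_iterate_mem[OF pm \<phi>, of k]
        unfolding iterate_eq_shift_limit[OF k, symmetric] by (simp add: E_def)
      ultimately show ?case using \<phi> by auto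
    qed
  qed (use Em B measurable_sets[OF shift_limit_measurable B] in auto)
  also have "\<dots> = emeasure (distr P0 N0_space shift_limit) B"
    by (rule emeasure_distr[symmetric]) (use shift_limit_measurable in \<open>auto simp: measurable_cong_sets[OF sets_P0 refl]\<close>)
  finally show "emeasure Q B = emeasure (distr P0 N0_space shift_limit) B" .
qed simp

lemma Q_prob: "Q \<in> prob_N0"
  unfolding Q_eq_distr prob_N0_def
  using P0.prob_space_distr[of shift_limit N0_space] shift_limit_measurable
  by (simp add: measurable_P0)

lemma iterate_prob: "distr P0 N0_space (shift_by f ^^ n) \<in> prob_N0"
  unfolding prob_N0_def
  using P0.prob_space_distr[of "shift_by f ^^ n" N0_space] iterate_measurable
  by (simp add: measurable_P0)

text \<open>Almost every trajectory of environments is eventually constant, so that the expectations of all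
  bounded measurable functionals converge.\<close>
lemma has_f_probability_Q: "has_f_probability f P0 Q"
  unfolding has_f_probability_def
proof (subst weak_limit_iff[OF iterate_prob], intro conjI Q_prob allI impI)
  fix h :: "'a measure \<Rightarrow> real" assume h: "weak_test h"
  have hm: "h \<in> borel_measurable N0_space" using h by (intro continuous_N0_measurable) simp
  obtain b where b: "\<And>\<phi>. \<phi> \<in> count_meas0 \<Longrightarrow> norm (h \<phi>) \<le> b"
    using h unfolding bounded_iff by auto
  have "(\<lambda>n. \<integral>\<phi>. h ((shift_by f ^^ n) \<phi>) \<partial>P0) \<longlonglongrightarrow> (\<integral>\<phi>. h (shift_limit \<phi>) \<partial>P0)"
  proof (rule integral_dominated_convergence)
    show "(\<lambda>\<phi>. h (shift_limit \<phi>)) \<in> borel_measurable P0"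
      unfolding measurable_P0 by (rule measurable_compose[OF shift_limit_measurable hm])
    show "(\<lambda>\<phi>. h ((shift_by f ^^ n) \<phi>)) \<in> borel_measurable P0" for n
      unfolding measurable_P0 by (rule measurable_compose[OF iterate_measurable hm])
    show "integrable P0 (\<lambda>_. b)" by simp
    show "AE \<phi> in P0. (\<lambda>n. h ((shift_by f ^^ n) \<phi>)) \<longlonglongrightarrow> h (shift_limit \<phi>)"
      using AE_hits_fixed
    proof eventually_elim
      case (elim \<phi>)
      then obtain k where k: "fixed_config f ((shift_by f ^^ k) \<phi>)" by blast
      have "h ((shift_by f ^^ n) \<phi>) = h (shift_limit \<phi>)" if "n \<ge> k" for n
        using fixed_iterate[OF k, of "n - k"] that iterate_eq_shift_limit[OF k] by simp
      then have "\<forall>\<^sub>F n in sequentially. h ((shift_by f ^^ n) \<phi>) = h (shift_limit \<phi>)"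
        by (auto simp: eventually_sequentially)
      then show ?case by (rule tendsto_eventually)
    qed
    show "AE \<phi> in P0. norm (h ((shift_by f ^^ n) \<phi>)) \<le> b" for n
      using b shift_by_iterate_mem[OF pm] by (intro AE_I2) simp
  qed
  then show "(\<lambda>n. \<integral>\<phi>. h \<phi> \<partial>distr P0 N0_space (shift_by f ^^ n)) \<longlonglongrightarrow> (\<integral>\<phi>. h \<phi> \<partial>Q)"
    unfolding Q_eq_distr using iterate_measurable shift_limit_measurable hm
    by (simp add: integral_distr measurable_P0)
qed

lemma f_probability_eq: "f_probability f P0 = Q"
  unfolding f_probability_def
proof (rule the_equality, rule has_f_probability_Q)
  fix R assume "has_f_probability f P0 R"
  then have R: "R \<in> prob_N0" "\<And>h. weak_test h \<Longrightarrow>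
      (\<lambda>n. \<integral>\<phi>. h \<phi> \<partial>distr P0 N0_space (shift_by f ^^ n)) \<longlonglongrightarrow> (\<integral>\<phi>. h \<phi> \<partial>R)"
    unfolding has_f_probability_def weak_limit_iff[OF iterate_prob] by blast+
  have Q: "\<And>h. weak_test h \<Longrightarrow>
      (\<lambda>n. \<integral>\<phi>. h \<phi> \<partial>distr P0 N0_space (shift_by f ^^ n)) \<longlonglongrightarrow> (\<integral>\<phi>. h \<phi> \<partial>Q)"
    using has_f_probability_Q
    unfolding has_f_probability_def weak_limit_iff[OF iterate_prob] by blast
  show "R = Q"
    by (rule prob_N0_eqI[OF R(1) Q_prob LIMSEQ_unique[OF R(2) Q]])
qed

text \<open>Terminal environments are fixed by \<open>shift_by f\<close>.\<close>
lemma Q_invariant: "Q = distr Q N0_space (shift_by f)"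
proof -
  have m: "shift_by f \<in> measurable N0_space N0_space" by (rule shift_by_measurable[OF pm])
  have "distr Q N0_space (shift_by f) = distr P0 N0_space (shift_by f \<circ> shift_limit)"
    unfolding Q_eq_distr using m shift_limit_measurable
    by (intro distr_distr) (simp_all add: measurable_P0)
  also have "\<dots> = distr P0 N0_space shift_limit"
  proof (rule distr_cong_AE[OF refl refl])
    show "AE \<phi> in P0. (shift_by f \<circ> shift_limit) \<phi> = shift_limit \<phi>"
      using AE_hits_fixed by eventually_elim (use fixed_shift_limit in \<open>auto simp: fixed_config_def\<close>)
  qed (use m shift_limit_measurable in \<open>auto simp: measurable_P0 intro: measurable_comp\<close>)
  finally show ?thesis by (simp add: Q_eq_distr)
qed

lemma AE_RN_deriv_eq: "AE \<phi> in P0. RN_deriv P0 Q \<phi> = mult_limit f \<phi>"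
proof -
  have "AE \<phi> in P0. mult_sup_lim f \<phi> = RN_deriv P0 Q \<phi>"
    by (rule P0.RN_deriv_unique) (auto simp: Q_def measurable_P0)
  then show ?thesis using AE_limit by eventually_elim simp
qed

text \<open>Almost surely the limit measure is \<open>\<Phi>\<close> weighted by a function of the environment of each point, so
  that the Campbell formula of \<open>\<Phi>\<close> applies.\<close>
lemma palm_integral_density:
  assumes [measurable]: "A \<in> sets M" "B \<in> sets borel"
  shows "(\<integral>\<^sup>+\<omega>. (\<integral>\<^sup>+t. indicator A (\<theta> t \<omega>) * indicator B t \<partial>image_limit f (\<Phi> \<omega>)) \<partial>M) =
    intensity M \<Phi> * (emeasure lborel B * emeasure (density palm (\<lambda>\<omega>. mult_sup_lim f (\<Phi> \<omega>))) A)"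
proof -
  have "(\<integral>\<^sup>+\<omega>. (\<integral>\<^sup>+t. indicator A (\<theta> t \<omega>) * indicator B t \<partial>image_limit f (\<Phi> \<omega>)) \<partial>M) =
      (\<integral>\<^sup>+\<omega>. \<integral>\<^sup>+t. mult_sup_lim f (\<Phi> (\<theta> t \<omega>)) * indicator A (\<theta> t \<omega>) * indicator B t \<partial>\<Phi> \<omega> \<partial>M)"
  proof (rule nn_integral_cong_AE, use AE_points_tame(1) simple AE_space in eventually_elim)
    case (elim \<omega>)
    have \<omega>[measurable]: "\<omega> \<in> space M" using elim by simp
    have \<phi>: "\<Phi> \<omega> \<in> count_meas" by (rule \<Phi>_count[OF \<omega>])
    have lim: "image_limit f (\<Phi> \<omega>) =
        dirac_sum (msupport (\<Phi> \<omega>)) (\<lambda>x. mult_sup_lim f (translate x (\<Phi> \<omega>)))"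
      by (rule image_limit_tame[OF pm \<phi>]) (use elim(1) in blast)
    have "(\<lambda>t. indicator A (\<theta> t \<omega>) * indicator B t :: ennreal) \<in> borel_measurable borel"
      by measurable
    moreover have "(\<lambda>t. mult_sup_lim f (translate t (\<Phi> \<omega>))) \<in> borel_measurable borel"
      using \<phi> by (intro measurable_compose[OF measurable_translate mult_sup_lim_measurable]) auto
    ultimately have "(\<integral>\<^sup>+t. indicator A (\<theta> t \<omega>) * indicator B t \<partial>image_limit f (\<Phi> \<omega>)) =
        (\<integral>\<^sup>+t. mult_sup_lim f (translate t (\<Phi> \<omega>)) * (indicator A (\<theta> t \<omega>) * indicator B t) \<partial>\<Phi> \<omega>)"
      unfolding lim by (intro nn_integral_dirac_sum_simple \<phi> elim(2))
    then show ?case by (simp add: \<Phi>_flow \<omega> mult.assoc)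
  qed
  also have "\<dots> = intensity M \<Phi> *
      (\<integral>\<^sup>+\<omega>. \<integral>\<^sup>+s. mult_sup_lim f (\<Phi> \<omega>) * indicator A \<omega> * indicator B s \<partial>lborel \<partial>palm)"
    by (rule campbell) measurable
  also have "(\<integral>\<^sup>+\<omega>. \<integral>\<^sup>+s. mult_sup_lim f (\<Phi> \<omega>) * indicator A \<omega> * indicator B s \<partial>lborel \<partial>palm) =
      (\<integral>\<^sup>+\<omega>. mult_sup_lim f (\<Phi> \<omega>) * indicator A \<omega> * emeasure lborel B \<partial>palm)"
    by (intro nn_integral_cong, subst nn_integral_cmult) auto
  also have "\<dots> = emeasure (density palm (\<lambda>\<omega>. mult_sup_lim f (\<Phi> \<omega>))) A * emeasure lborel B"
    by (subst nn_integral_multc) (auto simp: emeasure_density)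
  finally show ?thesis by (simp add: mult.commute)
qed

lemma law_density: "law_N0 (density palm (\<lambda>\<omega>. mult_sup_lim f (\<Phi> \<omega>))) \<Phi> = Q"
proof (rule measure_eqI)
  let ?D = "density palm (\<lambda>\<omega>. mult_sup_lim f (\<Phi> \<omega>))"
  fix B assume "B \<in> sets (law_N0 ?D \<Phi>)"
  then have B[measurable]: "B \<in> sets N0_space" by simp
  have BN[measurable]: "B \<in> sets N_space" and B0: "B \<subseteq> count_meas0"
    using B by (simp_all add: sets_N0_iff)
  have "{\<omega> \<in> space M. \<Phi> \<omega> \<in> B} \<in> sets M" by measurable
  then have "emeasure (law_N0 ?D \<Phi>) B = (\<integral>\<^sup>+\<omega>. mult_sup_lim f (\<Phi> \<omega>) * indicator {\<omega> \<in> space M. \<Phi> \<omega> \<in> B} \<omega> \<partial>palm)"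
    using \<Phi>_palm by (subst emeasure_law_N0) (auto simp: emeasure_density)
  also have "\<dots> = (\<integral>\<^sup>+\<omega>. mult_sup_lim f (\<Phi> \<omega>) * indicator B (\<Phi> \<omega>) * indicator count_meas0 (\<Phi> \<omega>) \<partial>palm)"
    using B0 by (intro nn_integral_cong) (auto simp: indicator_def)
  also have "\<dots> = (\<integral>\<^sup>+\<phi>. mult_sup_lim f \<phi> * indicator B \<phi> \<partial>P0)"
    by (intro nn_integral_P0[symmetric]) measurable
  also have "\<dots> = emeasure Q B"
    unfolding Q_def by (rule emeasure_density[symmetric]) auto
  finally show "emeasure (law_N0 ?D \<Phi>) B = emeasure Q B" .
qed simp

text \<open>Weighting the points by \<open>m\<^sup>\<infinity>\<close> preserves the intensity because \<open>m\<^sup>\<infinity>\<close> has mean one under \<open>P0\<close>.\<close>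
lemma intensity_image_limit: "intensity M (\<lambda>\<omega>. image_limit f (\<Phi> \<omega>)) = intensity M \<Phi>"
proof -
  have sets_lim: "sets (image_limit f \<phi>) = sets borel" for \<phi>
    by (simp add: image_limit_def)
  have "intensity M (\<lambda>\<omega>. image_limit f (\<Phi> \<omega>)) =
      (\<integral>\<^sup>+\<omega>. (\<integral>\<^sup>+t. indicator (space M) (\<theta> t \<omega>) * indicator unit_cube t \<partial>image_limit f (\<Phi> \<omega>)) \<partial>M)"
    unfolding intensity_def
  proof (rule nn_integral_cong)
    fix \<omega> assume \<omega>: "\<omega> \<in> space M"
    have "(\<integral>\<^sup>+t. indicator (space M) (\<theta> t \<omega>) * indicator unit_cube t \<partial>image_limit f (\<Phi> \<omega>)) =
        (\<integral>\<^sup>+t. indicator unit_cube t \<partial>image_limit f (\<Phi> \<omega>))"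
      using flow_space[OF \<omega>] by (intro nn_integral_cong) simp
    then show "emeasure (image_limit f (\<Phi> \<omega>)) unit_cube =
        (\<integral>\<^sup>+t. indicator (space M) (\<theta> t \<omega>) * indicator unit_cube t \<partial>image_limit f (\<Phi> \<omega>))"
      by (simp add: sets_lim)
  qed
  also have "\<dots> = intensity M \<Phi> * (emeasure lborel (unit_cube :: 'a set) *
      emeasure (density palm (\<lambda>\<omega>. mult_sup_lim f (\<Phi> \<omega>))) (space M))"
    by (rule palm_integral_density) auto
  also have "emeasure (density palm (\<lambda>\<omega>. mult_sup_lim f (\<Phi> \<omega>))) (space M) =
      (\<integral>\<^sup>+\<omega>. mult_sup_lim f (\<Phi> \<omega>) * indicator (space M) \<omega> \<partial>palm)"
    by (rule emeasure_density) auto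
  also have "\<dots> = (\<integral>\<^sup>+\<omega>. mult_sup_lim f (\<Phi> \<omega>) * indicator count_meas0 (\<Phi> \<omega>) \<partial>palm)"
    using AE_palm_origin AE_space[of palm]
    by (intro nn_integral_cong_AE, eventually_elim) simp
  also have "\<dots> = (\<integral>\<^sup>+\<phi>. mult_sup_lim f \<phi> \<partial>P0)"
    by (rule nn_integral_P0[symmetric]) measurable
  also have "\<dots> = (\<integral>\<^sup>+\<phi>. mult_sup_lim f \<phi> * indicator (space P0) \<phi> \<partial>P0)"
    by (intro nn_integral_cong) simp
  also have "\<dots> = emeasure Q (space P0)"
    unfolding Q_def using sets.top[of P0] by (intro emeasure_density[symmetric]) auto
  also have "\<dots> = 1"
    using Q_prob sets_eq_imp_space_eq[of Q P0] prob_space.emeasure_space_1[of Q] by (simp add: prob_N0_def)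
  finally show ?thesis by (simp add: emeasure_unit_cube)
qed

text \<open>Seen from the point process of limit multiplicities, the typical point of \<open>\<Phi>\<close> is size-biased by
  its multiplicity.\<close>
lemma palm_image_limit:
  "palm_prob M \<theta> (\<lambda>\<omega>. image_limit f (\<Phi> \<omega>)) = density palm (\<lambda>\<omega>. mult_sup_lim f (\<Phi> \<omega>))"
proof (rule palm_prob_eqI)
  let ?D = "density palm (\<lambda>\<omega>. mult_sup_lim f (\<Phi> \<omega>))"
  fix A and B :: "'a set" assume AB: "A \<in> sets M" "B \<in> sets borel"
    and B: "0 < emeasure lborel B" "emeasure lborel B < \<infinity>"
  have eq: "(\<integral>\<^sup>+\<omega>. (\<integral>\<^sup>+t\<in>B. indicator A (\<theta> t \<omega>) \<partial>image_limit f (\<Phi> \<omega>)) \<partial>M) =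
      emeasure ?D A * (intensity M \<Phi> * emeasure lborel B)"
    unfolding palm_integral_density[OF AB] by (simp add: mult_ac)
  show "emeasure ?D A = (\<integral>\<^sup>+\<omega>. (\<integral>\<^sup>+t\<in>B. indicator A (\<theta> t \<omega>) \<partial>image_limit f (\<Phi> \<omega>)) \<partial>M) /
      (intensity M (\<lambda>\<omega>. image_limit f (\<Phi> \<omega>)) * emeasure lborel B)"
    unfolding eq intensity_image_limit using B intensity_pos intensity_finite
    by (intro ennreal_mult_divide_eq[symmetric]) (auto simp: ennreal_mult_eq_top_iff)
qed simp

end

theorem theorem2p14:
  fixes M :: "'w measure" and \<theta> :: "'a::euclidean_space \<Rightarrow> 'w \<Rightarrow> 'w"
    and \<Phi> :: "'w \<Rightarrow> 'a measure" and f :: "'a measure \<Rightarrow> 'a"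
    and P0 :: "'a measure measure"
  assumes stationary: "stationary_point_process M \<theta> \<Phi>"
    and simple: "AE \<omega> in M. simple_meas (\<Phi> \<omega>)"
    and intensity: "nondegenerate M \<Phi>"
    and P0: "P0 = law_N0 (palm_prob M \<theta> \<Phi>) \<Phi>"
    and point_map: "point_map f"
    and periodic: "one_periodic f P0"
  shows "has_f_probability f P0 (f_probability f P0) \<and>
    f_probability f P0 = law_N0 (palm_prob M \<theta> (\<lambda>\<omega>. image_limit f (\<Phi> \<omega>))) \<Phi> \<and>
    absolutely_continuous P0 (f_probability f P0) \<and>
    (AE \<phi> in P0. RN_deriv P0 (f_probability f P0) \<phi> = mult_limit f \<phi>) \<and>
    f_probability f P0 = distr (f_probability f P0) N0_space (shift_by f)"
proof -
  interpret S: stationary_process M \<theta> \<Phi>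
    using stationary intensity by unfold_locales
  have P0_palm: "P0 = law_N0 S.palm \<Phi>" by (simp add: P0 S.palm_prob_\<Phi>)
  interpret periodic_point_shift M \<theta> \<Phi> f
    using simple point_map periodic unfolding P0_palm by unfold_locales
  have P0_eq: "P0 = periodic_point_shift.P0 M \<theta> \<Phi>"
    by (simp add: P0_palm P0_def)
  have "absolutely_continuous P0 Q"
    unfolding P0_eq Q_def
    by (rule absolutely_continuousI_density) (simp add: measurable_P0)
  moreover have "Q = law_N0 (palm_prob M \<theta> (\<lambda>\<omega>. image_limit f (\<Phi> \<omega>))) \<Phi>"
    by (simp add: palm_image_limit law_density)
  ultimately show ?thesis
    using has_f_probability_Q AE_RN_deriv_eq Q_invariant unfolding P0_eq f_probability_eq by blast
qed

end
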